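(* Consider the algebra isomorphisms $\varphi_0':\widetilde X(\mathfrak{sp}_2,\mathfrak{sp}_2)^{tw}\to\widetilde Y^-(2)$, $\widetilde S(u)\mapsto\widetilde S^\circ(u/2-1/2)$, and $\varphi_1':\widetilde X(\mathfrak{sp}_2,\mathfrak{gl}_1)^{tw}\to\widetilde Y^+(2)$, $\widetilde S(u)\mapsto\widetilde S^\circ(u/2-1/2)K$. The maps $\varphi_0'$ and $\varphi_1'$ descend to the algebras $X(\mathfrak{sp}_2,\mathfrak{sp}_2)^{tw}$ and $X(\mathfrak{sp}_2,\mathfrak{gl}_1)^{tw}$ and induce isomorphisms $$X(\mathfrak{sp}_2,\mathfrak{sp}_2)^{tw}\cong Y^-(2),\quad X(\mathfrak{sp}_2,\mathfrak{gl}_1)^{tw}\cong Y^+(2),\quad Y(\mathfrak{sp}_2,\mathfrak{sp}_2)^{tw}\cong SY^-(2),\quad Y(\mathfrak{sp}_2,\mathfrak{gl}_1)^{tw}\cong SY^+(2).$$ There are also algebra isomorphisms $$X(\mathfrak{sp}_2,\mathfrak{sp}_2)^{tw}\cong\mathcal B(2,0),\quad X(\mathfrak{sp}_2,\mathfrak{gl}_1)^{tw}\cong\mathcal B(2,1),\quad Y(\mathfrak{sp}_2,\mathfrak{sp}_2)^{tw}\cong\mathcal{SB}(2,0),\quad Y(\mathfrak{sp}_2,\mathfrak{gl}_1)^{tw}\cong\mathcal{SB}(2,1).$$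
   Context: All algebras are unital associative over $\mathbb C$. Rows and columns of $2\times2$ matrices are indexed by $\{-1,1\}$; $K=E_{11}-E_{-1,-1}$, $P=\sum E_{ij}\otimes E_{ji}$, $(E_{ij})^{t_+}=E_{-j,-i}$, $(E_{ij})^{t_-}=\mathrm{sign}(i)\,\mathrm{sign}(j)E_{-j,-i}$, $Q^\pm$ is the partial transpose of $P$ under $t_\pm$ (in either factor). $R^\circ(u)=I-\frac Pu$, $R^\circ(u)^{t_\pm}=I-\frac{Q^\pm}{u}$, and for $\mathfrak{sp}_2$ (with $\kappa=2$) $R(u)=I-\frac Pu+\frac{Q^-}{u-2}$. Subscripts $1,2$ on matrices denote the tensor factor in which they act. Type A algebras. $Y(2)$ is generated by $t_{ij}^{(r)}$ ($r\ge0$, $t^{(0)}_{ij}=\delta_{ij}$), $T^\circ(u)=\sum E_{ij}\otimes t_{ij}^{(r)}u^{-r}$, with relation $R^\circ(u-v)T^\circ_1(u)T^\circ_2(v)=T^\circ_2(v)T^\circ_1(u)R^\circ(u-v)$. The coefficients of $\mathrm{qdet}\,T^\circ(u)=t_{-1,-1}(u-1)t_{11}(u)-t_{-1,1}(u-1)t_{1,-1}(u)$ are central; $SY(2)=Y(2)/(\mathrm{qdet}\,T^\circ(u)-1)$, with $\mathcal T^\circ(u)$ the image of $T^\circ(u)$. $Y^\pm(2)\subset Y(2)$ is the subalgebra generated by the coefficients of $S^\circ(u)=T^\circ(u)T^\circ(-u)^{t_\pm}$, and $SY^\pm(2)\subset SY(2)$ is the subalgebra generated by the coefficients of $\mathcal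 T^\circ(u)\mathcal T^\circ(-u)^{t_\pm}$. For $q\in\{0,1\}$, $\mathcal B(2,q)\subset Y(2)$ (resp. $\mathcal{SB}(2,q)\subset SY(2)$) is the subalgebra generated by the coefficients of $T^\circ(u)\mathcal G_qT^\circ(-u)^{-1}$ (resp. $\mathcal T^\circ(u)\mathcal G_q\mathcal T^\circ(-u)^{-1}$), $\mathcal G_q=E_{-1,-1}+(-1)^qE_{11}$. $\mathfrak{sp}_2$ algebras. $X(\mathfrak{sp}_2)$ is defined like $Y(2)$ with $R(u)$ in place of $R^\circ(u)$; its matrix $T(u)$ satisfies $T(u)T(u+2)^{t_-}=z(u)I$ with $z(u)$ a series with central coefficients, and $Y(\mathfrak{sp}_2)=X(\mathfrak{sp}_2)/(z(u)-1)$, with $\mathcal T(u)$ the image of $T(u)$. Put $\mathcal G=I$ for the pair $(\mathfrak{sp}_2,\mathfrak{sp}_2)$ and $\mathcal G=K$ for $(\mathfrak{sp}_2,\mathfrak{gl}_1)$. $X(\mathfrak{sp}_2,\cdot)^{tw}\subset X(\mathfrak{sp}_2)$ (resp. $Y(\mathfrak{sp}_2,\cdot)^{tw}\subset Y(\mathfrak{sp}_2)$) is the subalgebra generated by the coefficients of $S(u)=T(u-1)\,\mathcal G\,T(-u+1)^{t_-}$ (resp. of $\mathcal T(u-1)\,\mathcal G\,\mathcal T(-u+1)^{t_-}$). Extended algebras and known presentations. $\widetilde X(\mathfrak{sp}_2,\cdot)^{tw}$ is generated by the coefficients of $\widetilde S(u)=\mathcal G+O(u^{-1})$ with the single relation $R(u-v)\widetilde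 S_1(u)R(u+v)\widetilde S_2(v)=\widetilde S_2(v)R(u+v)\widetilde S_1(u)R(u-v)$; there is a series $\mathsf c(u)\in 1+u^{-1}\widetilde X[[u^{-1}]]$ with central coefficients such that $Q^-\widetilde S_1(u)R(2u-2)\widetilde S_2(2-u)^{-1}=p(u)\mathsf c(u)Q^-$, where $p(u)=1+\frac1{2u-2}+\frac{2}{2u-4}$ if $\mathcal G=I$ and $p(u)=-1+\frac1{2u-2}$ if $\mathcal G=K$; $X(\mathfrak{sp}_2,\cdot)^{tw}$ is identified with $\widetilde X(\mathfrak{sp}_2,\cdot)^{tw}/(\mathsf c(u)-1)$ via $\widetilde S(u)\mapsto S(u)$. $\widetilde Y^\pm(2)$ is generated by the coefficients of $\widetilde S^\circ(u)=I+O(u^{-1})$ with relation $R^\circ(u-v)\widetilde S^\circ_1(u)R^\circ(-u-v)^{t_\pm}\widetilde S^\circ_2(v)=\widetilde S^\circ_2(v)R^\circ(-u-v)^{t_\pm}\widetilde S^\circ_1(u)R^\circ(u-v)$; there is a series $\mathsf c^\circ(u)$ with central coefficients such that $Q^\pm\widetilde S^\circ_1(u)R^\circ(2u)\widetilde S^\circ_2(-u)^{-1}=(1\mp\frac1{2u})\mathsf c^\circ(u)Q^\pm$, and $Y^\pm(2)$ is identified with $\widetilde Y^\pm(2)/(\mathsf c^\circ(u)-1)$ via $\widetilde S^\circ(u)\mapsto S^\circ(u)$. In $X(\mathfrak{sp}_2,\cdot)^{tw}$ one has $S(u)S(-u)=w(u)I$ with $w(u)$ having central coefficients, and $Y(\mathfrak{sp}_2,\cdot)^{tw}\cong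 X(\mathfrak{sp}_2,\cdot)^{tw}/(w(u)-1)$. Likewise $SY^\pm(2)\cong Y^\pm(2)/(\mathrm{sdet}\,S^\circ(u)-\gamma_2(u))$, where $\gamma_2(u)=1$ for $Y^+(2)$, $\gamma_2(u)=\frac{2u+1}{2u-1}$ for $Y^-(2)$, and $\mathrm{sdet}\,S^\circ(u)=\gamma_2(u)\,\mathrm{qdet}\,T^\circ(u)\,\mathrm{qdet}\,T^\circ(1-u)\in Y^\pm(2)[[u^{-1}]]$ is the Sklyanin determinant. Here a quotient by "$(s(u)-s_0(u))$" means by the ideal generated by all coefficients of that series. *)

theory Defs
  imports
    "HOL-Analysis.Analysis"
    "HOL-Computational_Algebra.Computational_Algebra"
    "HOL-Library.Poly_Mapping"
begin

no_notation fps_nth (infixl \<open>$\<close> 75)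

section \<open>Unital associative algebras over the complex numbers\<close>

text \<open>The algebra structure is given by the structure map \<open>\<complex> \<rightarrow> Z(A)\<close>.\<close>

class calgebra = ring_1 +
  fixes of_C :: "complex \<Rightarrow> 'a"
  assumes of_C_1 [simp]: "of_C 1 = 1"
    and of_C_add: "of_C (a + b) = of_C a + of_C b"
    and of_C_mult: "of_C (a * b) = of_C a * of_C b"
    and of_C_central: "of_C a * x = x * of_C a"

definition alg_hom_on :: "'a::calgebra set \<Rightarrow> ('a \<Rightarrow> 'b::calgebra) \<Rightarrow> bool" where
  "alg_hom_on A f \<longleftrightarrow>
     (\<forall>c. f (of_C c) = of_C c) \<and>
     (\<forall>x\<in>A. \<forall>y\<in>A. f (x + y) = f x + f y \<and> f (x * y) = f x * f y)"

text \<open>Here \<open>A\<close> and \<open>B\<close> are (carriers of) unital subalgebras of the two ambient algebras.\<close>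

definition alg_iso :: "'a::calgebra set \<Rightarrow> 'b::calgebra set \<Rightarrow> ('a \<Rightarrow> 'b) \<Rightarrow> bool" where
  "alg_iso A B f \<longleftrightarrow> alg_hom_on A f \<and> bij_betw f A B"

inductive_set subalgebra_gen :: "'a::calgebra set \<Rightarrow> 'a set" for G where
  scalar: "of_C c \<in> subalgebra_gen G"
| gen: "x \<in> G \<Longrightarrow> x \<in> subalgebra_gen G"
| add: "x \<in> subalgebra_gen G \<Longrightarrow> y \<in> subalgebra_gen G \<Longrightarrow> x + y \<in> subalgebra_gen G"
| mult: "x \<in> subalgebra_gen G \<Longrightarrow> y \<in> subalgebra_gen G \<Longrightarrow> x * y \<in> subalgebra_gen G"

text \<open>Two-sided ideal generated by \<open>R\<close>: the finite sums of elements \<open>a r b\<close> with \<open>r \<in> R\<close>.\<close>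

inductive_set ideal_gen :: "'a::ring_1 set \<Rightarrow> 'a set" for R where
  zero: "0 \<in> ideal_gen R"
| add: "x \<in> ideal_gen R \<Longrightarrow> r \<in> R \<Longrightarrow> x + a * r * b \<in> ideal_gen R"

lemma ideal_gen_plus:
  assumes "x \<in> ideal_gen R" "y \<in> ideal_gen R"
  shows "x + y \<in> ideal_gen R"
  using assms(2) by induction (use assms(1) ideal_gen.add in \<open>auto simp: add.assoc [symmetric]\<close>)

lemma ideal_gen_mult_left: "x \<in> ideal_gen R \<Longrightarrow> c * x \<in> ideal_gen R"
proof (induction rule: ideal_gen.induct)
  case (add x r a b)
  then show ?case using ideal_gen.add [of "c * x" R r "c * a" b]
    by (simp add: algebra_simps)
qed (auto intro: ideal_gen.zero)

lemma ideal_gen_mult_right: "x \<in> ideal_gen R \<Longrightarrow> x * c \<in> ideal_gen R"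
proof (induction rule: ideal_gen.induct)
  case (add x r a b)
  then show ?case using ideal_gen.add [of "x * c" R r a "b * c"]
    by (simp add: algebra_simps)
qed (auto intro: ideal_gen.zero)

lemma ideal_gen_uminus: "x \<in> ideal_gen R \<Longrightarrow> - x \<in> ideal_gen R"
  using ideal_gen_mult_left [of x R "- 1"] by simp

lemma ideal_gen_diff: "x \<in> ideal_gen R \<Longrightarrow> y \<in> ideal_gen R \<Longrightarrow> x - y \<in> ideal_gen R"
  using ideal_gen_plus [OF _ ideal_gen_uminus] by fastforce

section \<open>The free algebra\<close>

datatype 'g free_word = Word "'g list"

instantiation free_word :: (type) monoid_add
begin
definition zero_free_word :: "'a free_word" where "0 = Word []"
fun plus_free_word :: "'a free_word \<Rightarrow> 'a free_word \<Rightarrow> 'a free_word" where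
  "Word xs + Word ys = Word (xs @ ys)"
instance
proof
  fix a b c :: "'a free_word"
  show "a + b + c = a + (b + c)" by (cases a; cases b; cases c) simp
  show "0 + a = a" "a + 0 = a" by (cases a; simp add: zero_free_word_def)+
qed
end

datatype idx = Neg | Pos  \<comment> \<open>the row and column indices \<open>-1\<close> and \<open>1\<close>\<close>

lemma UNIV_idx: "UNIV = {Neg, Pos}"
  using idx.exhaust by auto

instance idx :: finite
  by standard (simp add: UNIV_idx)

fun opp :: "idx \<Rightarrow> idx" where "opp Neg = Pos" | "opp Pos = Neg"

fun sgn_idx :: "idx \<Rightarrow> 'a::ring_1" where "sgn_idx Neg = - 1" | "sgn_idx Pos = 1"

text \<open>
  All algebras below have generators \<open>t\<^bsub>ij\<^esub>\<^bsup>(r)\<^esup>\<close> with \<open>r \<ge> 1\<close>; the triple \<open>(i, j, n)\<close> stands for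
  \<open>t\<^bsub>ij\<^esub>\<^bsup>(n+1)\<^esup>\<close>.  The free algebra on them is the monoid algebra of the free monoid.
\<close>

type_synonym generator = "idx \<times> idx \<times> nat"
type_synonym free_alg = "generator free_word \<Rightarrow>\<^sub>0 complex"

instantiation complex :: calgebra
begin
definition of_C_complex :: "complex \<Rightarrow> complex" where "of_C_complex c = c"
instance by standard (simp_all add: of_C_complex_def)
end

instantiation poly_mapping :: (monoid_add, calgebra) calgebra
begin
definition of_C_poly_mapping :: "complex \<Rightarrow> 'a \<Rightarrow>\<^sub>0 'b" where
  "of_C_poly_mapping c = Poly_Mapping.single 0 (of_C c)"
instance
proof
  fix a b :: complex and x :: "'a \<Rightarrow>\<^sub>0 'b"
  show "of_C 1 = (1 :: 'a \<Rightarrow>\<^sub>0 'b)" by (simp add: of_C_poly_mapping_def)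
  show "of_C (a + b) = (of_C a + of_C b :: 'a \<Rightarrow>\<^sub>0 'b)"
    by (simp add: of_C_poly_mapping_def of_C_add single_add)
  show "of_C (a * b) = (of_C a * of_C b :: 'a \<Rightarrow>\<^sub>0 'b)"
    by (simp add: of_C_poly_mapping_def of_C_mult mult_single)
  show "of_C a * x = x * of_C a"
  proof (induction x rule: update_induct)
    case const
    show ?case by simp
  next
    case (update f k v)
    have "Poly_Mapping.update k v f = f + Poly_Mapping.single k v"
      using update(1) by (intro poly_mapping_eqI)
        (auto simp: lookup_add lookup_single lookup_update in_keys_iff when_def)
    then show ?case using update
      by (simp add: distrib_left distrib_right of_C_poly_mapping_def mult_single of_C_central)
  qed
qed
end


section \<open>Series and matrices\<close>

text \<open>
  A series in \<open>A[[u\<^sup>-\<^sup>1]]\<close> is an \<open>'a fps\<close> whose formal variable stands for \<open>u\<^sup>-\<^sup>1\<close>; likewise for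
  \<open>'a fls\<close>, so that \<open>fls_X_inv\<close> is \<open>u\<close>.  Expressions in two parameters \<open>u, v\<close> live in
  \<open>A((v\<^sup>-\<^sup>1))((u\<^sup>-\<^sup>1))\<close>, i.e. in \<open>'a fls fls\<close>, where \<open>1 / (u - v)\<close> is expanded in powers of \<open>v/u\<close>.
\<close>

definition map_fps :: "('a \<Rightarrow> 'b) \<Rightarrow> 'a fps \<Rightarrow> 'b fps" where
  "map_fps h f = Abs_fps (\<lambda>n. h (fps_nth f n))"

definition map_fls :: "('a::zero \<Rightarrow> 'b::zero) \<Rightarrow> 'a fls \<Rightarrow> 'b fls" where
  "map_fls h f = Abs_fls (\<lambda>n. h (fls_nth f n))"

abbreviation lift1 :: "complex fls \<Rightarrow> 'a::calgebra fls" where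
  "lift1 \<equiv> map_fls of_C"

abbreviation lift2 :: "complex fls fls \<Rightarrow> 'a::calgebra fls fls" where
  "lift2 \<equiv> map_fls (map_fls of_C)"

definition in_u :: "'a::zero fps \<Rightarrow> 'a fls fls" where
  "in_u f = map_fls fls_const (fps_to_fls f)"

definition in_v :: "'a::zero fps \<Rightarrow> 'a fls fls" where
  "in_v f = fls_const (fps_to_fls f)"

definition param_u :: "complex fls fls" where "param_u = fls_X_inv"
definition param_v :: "complex fls fls" where "param_v = fls_const fls_X_inv"

text \<open>
  \<open>subst_affine a b f\<close> is \<open>f(a u + b)\<close> for \<open>a \<noteq> 0\<close>: the variable \<open>u\<^sup>-\<^sup>1\<close> is replaced by
  \<open>(a u + b)\<^sup>-\<^sup>1 = u\<^sup>-\<^sup>1 / (a + b u\<^sup>-\<^sup>1)\<close>.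
\<close>

definition subst_affine :: "complex \<Rightarrow> complex \<Rightarrow> 'a::calgebra fps \<Rightarrow> 'a fps" where
  "subst_affine a b f =
     f oo map_fps of_C (fps_X * inverse (fps_const a + fps_const b * fps_X))"

type_synonym 'a mat2 = "'a ^ idx ^ idx"
type_synonym 'a mat4 = "'a ^ (idx \<times> idx) ^ (idx \<times> idx)"

abbreviation msubst :: "complex \<Rightarrow> complex \<Rightarrow> 'a::calgebra fps mat2 \<Rightarrow> 'a fps mat2" where
  "msubst a b \<equiv> map_matrix (subst_affine a b)"

definition series_coeffs :: "'a fps mat2 \<Rightarrow> 'a set" where
  "series_coeffs M = {fps_nth (M $ i $ j) n | i j n. True}"

definition series_coeffs2 :: "'a::zero fls fls mat4 \<Rightarrow> 'a set" where
  "series_coeffs2 M = {fls_nth (fls_nth (M $ i $ j) m) n | i j m n. True}"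

definition unit_mat :: "idx \<Rightarrow> idx \<Rightarrow> 'a::ring_1 mat2" where
  "unit_mat i j = (\<chi> k l. if k = i \<and> l = j then 1 else 0)"

definition K_mat :: "'a::ring_1 mat2" where
  "K_mat = unit_mat Pos Pos - unit_mat Neg Neg"

definition kron :: "'a::ring_1 mat2 \<Rightarrow> 'a mat2 \<Rightarrow> 'a mat4" where
  "kron A B = (\<chi> p q. A $ fst p $ fst q * B $ snd p $ snd q)"

definition factor1 :: "'a::ring_1 mat2 \<Rightarrow> 'a mat4" where "factor1 A = kron A (mat 1)"
definition factor2 :: "'a::ring_1 mat2 \<Rightarrow> 'a mat4" where "factor2 A = kron (mat 1) A"

definition P_mat :: "'a::ring_1 mat4" where
  "P_mat = (\<Sum>i\<in>UNIV. \<Sum>j\<in>UNIV. kron (unit_mat i j) (unit_mat j i))"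

datatype tsign = Plus | Minus

fun theta :: "tsign \<Rightarrow> idx \<Rightarrow> idx \<Rightarrow> 'a::ring_1" where
  "theta Plus i j = 1"
| "theta Minus i j = sgn_idx i * sgn_idx j"

text \<open>
  The transpositions \<open>E\<^bsub>ij\<^esub> \<mapsto> \<theta>\<^bsub>ij\<^esub> E\<^bsub>-j,-i\<^esub>\<close>, and the same acting in the second tensor factor.
\<close>

definition mtransp :: "tsign \<Rightarrow> 'a::ring_1 mat2 \<Rightarrow> 'a mat2" where
  "mtransp s A = (\<chi> k l. theta s k l * A $ opp l $ opp k)"

definition ptransp :: "tsign \<Rightarrow> 'a::ring_1 mat4 \<Rightarrow> 'a mat4" where
  "ptransp s M = (\<chi> p q. theta s (snd p) (snd q) *
                     M $ (fst p, opp (snd q)) $ (fst q, opp (snd p)))"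

definition Q_mat :: "tsign \<Rightarrow> 'a::ring_1 mat4" where
  "Q_mat s = ptransp s P_mat"

definition R_gl :: "'k::field \<Rightarrow> 'k mat4" where
  "R_gl x = mat 1 - map_matrix (\<lambda>y. y / x) P_mat"

definition R_sp :: "'k::field \<Rightarrow> 'k mat4" where
  "R_sp x = mat 1 - map_matrix (\<lambda>y. y / x) P_mat + map_matrix (\<lambda>y. y / (x - 2)) (Q_mat Minus)"

datatype sym_pair = SP2_SP2 | SP2_GL1

fun G_mat :: "sym_pair \<Rightarrow> 'a::ring_1 mat2" where
  "G_mat SP2_SP2 = mat 1"
| "G_mat SP2_GL1 = K_mat"

section \<open>Defining relations\<close>

text \<open>The matrix \<open>G + \<Sum>\<^bsub>r\<ge>1\<^esub> t\<^bsup>(r)\<^esup> u\<^bsup>-r\<^esup>\<close> whose entries are generating series.\<close>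

definition gen_matrix :: "(generator \<Rightarrow> 'a) \<Rightarrow> 'a::ring_1 mat2 \<Rightarrow> 'a fps mat2" where
  "gen_matrix g G = (\<chi> i j. Abs_fps (\<lambda>r. case r of 0 \<Rightarrow> G $ i $ j | Suc n \<Rightarrow> g (i, j, n)))"

definition free_gen :: "generator \<Rightarrow> free_alg" where
  "free_gen g = Poly_Mapping.single (Word [g]) 1"

text \<open>
  Differences of the two sides of \<open>R T\<^sub>1(u) T\<^sub>2(v) = T\<^sub>2(v) T\<^sub>1(u) R\<close> and of
  \<open>R S\<^sub>1(u) R' S\<^sub>2(v) = S\<^sub>2(v) R' S\<^sub>1(u) R\<close>.
\<close>

definition rtt_defect :: "complex fls fls mat4 \<Rightarrow> 'a::calgebra fps mat2 \<Rightarrow> 'a fls fls mat4" where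
  "rtt_defect R T =
     (let R = map_matrix lift2 R;
          T1 = factor1 (map_matrix in_u T); T2 = factor2 (map_matrix in_v T)
      in R ** T1 ** T2 - T2 ** T1 ** R)"

definition refl_defect ::
  "complex fls fls mat4 \<Rightarrow> complex fls fls mat4 \<Rightarrow> 'a::calgebra fps mat2 \<Rightarrow> 'a fls fls mat4" where
  "refl_defect R R' S =
     (let R = map_matrix lift2 R; R' = map_matrix lift2 R';
          S1 = factor1 (map_matrix in_u S); S2 = factor2 (map_matrix in_v S)
      in R ** S1 ** R' ** S2 - S2 ** R' ** S1 ** R)"

definition qdet :: "'a::calgebra fps mat2 \<Rightarrow> 'a fps" where
  "qdet T = subst_affine 1 (-1) (T $ Neg $ Neg) * T $ Pos $ Pos
          - subst_affine 1 (-1) (T $ Neg $ Pos) * T $ Pos $ Neg"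

definition Y_gl_relators :: "free_alg set" where
  "Y_gl_relators = series_coeffs2 (rtt_defect (R_gl (param_u - param_v)) (gen_matrix free_gen (mat 1)))"

definition X_sp_relators :: "free_alg set" where
  "X_sp_relators = series_coeffs2 (rtt_defect (R_sp (param_u - param_v)) (gen_matrix free_gen (mat 1)))"

definition SY_gl_relators :: "free_alg set" where
  "SY_gl_relators = Y_gl_relators \<union>
     {fps_nth (qdet (gen_matrix free_gen (mat 1)) - 1) n | n. True}"

text \<open>
  The quotient of the extended Yangian by \<open>z(u) - 1\<close>: since \<open>T(u) T(u+2)\<^sup>t = z(u) I\<close> modulo
  \<open>X_sp_relators\<close>, the ideal is generated by the coefficients of \<open>T(u) T(u+2)\<^sup>t - I\<close>.
\<close>

definition Y_sp_relators :: "free_alg set" where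
  "Y_sp_relators = X_sp_relators \<union>
     (let T = gen_matrix free_gen (mat 1) in series_coeffs (T ** mtransp Minus (msubst 1 2 T) - mat 1))"

definition Xt_relators :: "sym_pair \<Rightarrow> free_alg set" where
  "Xt_relators q = series_coeffs2 (refl_defect (R_sp (param_u - param_v)) (R_sp (param_u + param_v))
                     (gen_matrix free_gen (G_mat q)))"

definition Yt_relators :: "tsign \<Rightarrow> free_alg set" where
  "Yt_relators s = series_coeffs2 (refl_defect (R_gl (param_u - param_v))
                     (ptransp s (R_gl (- param_u - param_v))) (gen_matrix free_gen (mat 1)))"

section \<open>Consistency of the relations\<close>

text \<open>
  The type class \<open>ring_1\<close> contains the axiom \<open>0 \<noteq> 1\<close>, so each presented algebra has to be
  shown non-zero.  All relators vanish under the augmentation killing the generators.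
\<close>

definition aug :: "free_alg \<Rightarrow> complex" where
  "aug x = Poly_Mapping.lookup x 0"

lemma aug_0 [simp]: "aug 0 = 0" and aug_1 [simp]: "aug 1 = 1"
  and aug_add: "aug (x + y) = aug x + aug y" and aug_diff: "aug (x - y) = aug x - aug y"
  and aug_of_C [simp]: "aug (of_C c) = c" and aug_gen [simp]: "aug (free_gen g) = 0"
  by (simp_all add: aug_def lookup_one lookup_add lookup_minus of_C_poly_mapping_def
      of_C_complex_def free_gen_def lookup_single zero_free_word_def)

lemma aug_mult: "aug (x * y) = aug x * aug y"
proof -
  have *: "0 = l + q \<longleftrightarrow> l = 0 \<and> q = 0" for l q :: "generator free_word"
    by (cases l; cases q) (auto simp: zero_free_word_def)
  have "aug (x * y) = Sum_any (\<lambda>l. Poly_Mapping.lookup x l *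
      Sum_any (\<lambda>q. Poly_Mapping.lookup y q when 0 = l + q))"
    by (simp add: aug_def lookup_mult)
  also have "\<dots> = Sum_any (\<lambda>l. (Poly_Mapping.lookup x l *
      Sum_any (\<lambda>q. Poly_Mapping.lookup y q when q = 0)) when l = 0)"
    by (intro Sum_any.cong) (auto simp: * when_def)
  also have "\<dots> = aug x * aug y"
    by (simp add: aug_def)
  finally show ?thesis .
qed

lemma one_notin_ideal:
  assumes "\<And>r. r \<in> R \<Longrightarrow> aug r = 0"
  shows "1 \<notin> ideal_gen R"
proof -
  have "aug x = 0" if "x \<in> ideal_gen R" for x
    using that by induction (simp_all add: aug_add aug_mult assms)
  then show ?thesis by force
qed


definition is_hom :: "('a::ring_1 \<Rightarrow> 'b::ring_1) \<Rightarrow> bool" where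
  "is_hom h \<longleftrightarrow> h 1 = 1 \<and> (\<forall>x y. h (x + y) = h x + h y \<and> h (x * y) = h x * h y)"

lemma is_homD:
  assumes "is_hom h"
  shows "h 1 = 1" "h (x + y) = h x + h y" "h (x * y) = h x * h y" "h 0 = 0"
    "h (x - y) = h x - h y" "h (- x) = - h x" "h (sum f A) = (\<Sum>a\<in>A. h (f a))" "h (x ^ n) = h x ^ n"
proof -
  show 1: "h 1 = 1" and add: "\<And>x y. h (x + y) = h x + h y" and mult: "\<And>x y. h (x * y) = h x * h y"
    using assms by (auto simp: is_hom_def)
  show z: "h 0 = 0" using add [of 0 0] by simp
  show diff: "h (x - y) = h x - h y" for x y using add [of "x - y" y] by simp
  show "h (- x) = - h x" using diff [of 0 x] z by simp
  show "h (sum f A) = (\<Sum>a\<in>A. h (f a))"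
    by (induction A rule: infinite_finite_induct) (simp_all add: z add)
  show "h (x ^ n) = h x ^ n" by (induction n) (simp_all add: 1 mult)
qed

lemma is_hom_aug: "is_hom aug"
  by (simp add: is_hom_def aug_add aug_mult)

lemma map_fls_nth: "h 0 = 0 \<Longrightarrow> fls_nth (map_fls h f) n = h (fls_nth f n)"
  unfolding map_fls_def
  by (rule nth_Abs_fls_lower_bound [of "fls_subdegree f"]) simp

lemma fls_times_nth_bound:
  fixes f g :: "'a::ring_1 fls"
  assumes "\<And>i. i < a \<Longrightarrow> fls_nth f i = 0" "\<And>i. i < b \<Longrightarrow> fls_nth g i = 0"
  shows "fls_nth (f * g) n = (\<Sum>i=a..n-b. fls_nth f i * fls_nth g (n - i))"
proof (cases "f = 0 \<or> g = 0")
  case False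
  then have "a \<le> fls_subdegree f" "b \<le> fls_subdegree g"
    using assms by (meson linorder_not_less nth_fls_subdegree_nonzero)+
  then show ?thesis
    unfolding fls_times_nth(2) by (intro sum.mono_neutral_left) auto
qed auto

lemma is_hom_map_fls:
  assumes h: "is_hom h"
  shows "is_hom (map_fls h)"
  unfolding is_hom_def
proof (intro conjI allI)
  note h0 = is_homD(4) [OF h]
  show "map_fls h 1 = 1"
    by (rule fls_eqI) (simp add: map_fls_nth h0 is_homD(1) [OF h])
  fix f g
  show "map_fls h (f + g) = map_fls h f + map_fls h g"
    by (rule fls_eqI) (simp add: map_fls_nth h0 is_homD(2) [OF h])
  show "map_fls h (f * g) = map_fls h f * map_fls h g"
  proof (rule fls_eqI)
    fix n
    show "fls_nth (map_fls h (f * g)) n = fls_nth (map_fls h f * map_fls h g) n"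
      by (simp add: map_fls_nth h0 is_homD(3,7) [OF h] fls_times_nth(2) [of f g]
          fls_times_nth_bound [of "fls_subdegree f" "map_fls h f" "fls_subdegree g" "map_fls h g"])
  qed
qed

lemma is_hom_map_fps:
  assumes h: "is_hom h"
  shows "is_hom (map_fps h)"
  unfolding is_hom_def
  by (intro conjI allI fps_ext)
    (simp_all add: map_fps_def fps_mult_nth is_homD [OF h] fps_one_def)

lemma map_matrix_mult:
  assumes "is_hom h"
  shows "map_matrix h (A ** B) = map_matrix h A ** map_matrix h B"
  by (simp add: vec_eq_iff matrix_matrix_mult_def is_homD [OF assms])

lemma map_matrix_diff:
  assumes "is_hom h"
  shows "map_matrix h (A - B) = map_matrix h A - map_matrix h B"
  by (simp add: vec_eq_iff is_homD [OF assms])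

lemma map_matrix_kron:
  assumes "is_hom h"
  shows "map_matrix h (kron A B) = kron (map_matrix h A) (map_matrix h B)"
  by (simp add: vec_eq_iff kron_def is_homD [OF assms])

lemma map_matrix_mat_1:
  assumes "is_hom h"
  shows "map_matrix h (mat 1) = mat 1"
  by (simp add: vec_eq_iff mat_def is_homD [OF assms])

lemma map_matrix_factor:
  assumes "is_hom h"
  shows "map_matrix h (factor1 A) = factor1 (map_matrix h A)"
    "map_matrix h (factor2 A) = factor2 (map_matrix h A)"
  by (simp_all add: factor1_def factor2_def map_matrix_kron [OF assms] map_matrix_mat_1 [OF assms])

abbreviation aug2 :: "free_alg fls fls \<Rightarrow> complex fls fls" where
  "aug2 \<equiv> map_fls (map_fls aug)"

lemma is_hom_aug2: "is_hom aug2"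
  by (intro is_hom_map_fls is_hom_aug)

lemma aug2_nth: "fls_nth (fls_nth (aug2 x) m) n = aug (fls_nth (fls_nth x m) n)"
  by (simp add: map_fls_nth is_homD(4) [OF is_hom_map_fls [OF is_hom_aug]])

lemma of_C_0 [simp]: "of_C 0 = (0 :: 'a::calgebra)"
  using of_C_add [of 0 0, where 'a = 'a] by simp

lemma is_hom_of_C: "is_hom (of_C :: complex \<Rightarrow> 'a::calgebra)"
  by (simp add: is_hom_def of_C_add of_C_mult)

lemma aug2_lift2: "aug2 (lift2 x) = x"
  by (intro fls_eqI) (simp add: map_fls_nth is_homD(4) [OF is_hom_map_fls [OF is_hom_aug]]
    is_homD(4) [OF is_hom_map_fls [OF is_hom_of_C]])

lemma in_u_nth: "fls_nth (fls_nth (in_u f) m) n = (if m < 0 \<or> n \<noteq> 0 then 0 else fps_nth f (nat m))"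
  by (simp add: in_u_def map_fls_nth)

lemma in_v_nth: "fls_nth (fls_nth (in_v f) m) n = (if m \<noteq> 0 \<or> n < 0 then 0 else fps_nth f (nat n))"
  by (simp add: in_v_def)

lemma gen_matrix_nth:
  "fps_nth (gen_matrix g G $ i $ j) r = (case r of 0 \<Rightarrow> G $ i $ j | Suc n \<Rightarrow> g (i, j, n))"
  by (simp add: gen_matrix_def)

lemma aug_G_mat: "aug (G_mat q $ i $ j) = G_mat q $ i $ j"
  by (cases q) (auto simp: mat_def K_mat_def unit_mat_def aug_diff)

lemma aug2_gen:
  "map_matrix aug2 (map_matrix in_u (gen_matrix free_gen (G_mat q))) = G_mat q"
    "map_matrix aug2 (map_matrix in_v (gen_matrix free_gen (G_mat q))) = G_mat q"
proof -
  have *: "fls_nth (fls_nth (G_mat q $ i $ j :: complex fls fls) m) n =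
      (if m = 0 \<and> n = 0 then G_mat q $ i $ j else 0)" for i j m n
    by (cases q) (auto simp: mat_def K_mat_def unit_mat_def)
  have "aug2 (in_u (gen_matrix free_gen (G_mat q) $ i $ j)) = G_mat q $ i $ j"
    "aug2 (in_v (gen_matrix free_gen (G_mat q) $ i $ j)) = G_mat q $ i $ j" for i j
    unfolding fls_eq_iff aug2_nth in_u_nth in_v_nth gen_matrix_nth *
    by (auto simp: aug_G_mat split: nat.splits)
  then show "map_matrix aug2 (map_matrix in_u (gen_matrix free_gen (G_mat q))) = G_mat q"
    "map_matrix aug2 (map_matrix in_v (gen_matrix free_gen (G_mat q))) = G_mat q"
    by (simp_all add: vec_eq_iff)
qed

lemma aug_coeffs2:
  assumes "r \<in> series_coeffs2 M" "map_matrix aug2 M = 0"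
  shows "aug r = 0"
proof -
  from assms(1) obtain i j m n where r: "r = fls_nth (fls_nth (M $ i $ j) m) n"
    by (auto simp: series_coeffs2_def)
  have "aug2 (M $ i $ j) = 0"
    using assms(2) by (metis nth_map_matrix zero_index)
  then show ?thesis
    by (simp add: r flip: aug2_nth)
qed

lemma UNIV_idx2: "(UNIV :: (idx \<times> idx) set) = {(Neg, Neg), (Neg, Pos), (Pos, Neg), (Pos, Pos)}"
  by (auto simp: UNIV_idx simp flip: UNIV_Times_UNIV)

lemma all_idx: "(\<forall>i. Q i) \<longleftrightarrow> Q Neg \<and> Q Pos"
  by (metis idx.exhaust)

lemma P_mat_entry: "P_mat $ p $ q = (if fst p = snd q \<and> snd p = fst q then 1 else 0)"
  by (cases p; cases q; rename_tac a b c d; case_tac a; case_tac b; case_tac c; case_tac d;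
      simp add: P_mat_def kron_def unit_mat_def UNIV_idx)


lemma kron_1: "kron (mat 1) (mat 1) = mat 1"
  by (auto simp: vec_eq_iff kron_def mat_def)

lemma factor_1: "factor1 (mat 1) = mat 1" "factor2 (mat 1) = mat 1"
  by (simp_all add: factor1_def factor2_def kron_1)

lemma aug2_rtt:
  "map_matrix aug2 (rtt_defect R (gen_matrix free_gen (mat 1))) = 0"
  unfolding rtt_defect_def Let_def map_matrix_diff [OF is_hom_aug2] map_matrix_mult [OF is_hom_aug2]
    map_matrix_factor [OF is_hom_aug2] aug2_gen [of SP2_SP2, unfolded G_mat.simps] factor_1
  by simp

lemma aug2_refl:
  "map_matrix aug2 (refl_defect R R' (gen_matrix free_gen (G_mat q))) =
     R ** factor1 (G_mat q) ** R' ** factor2 (G_mat q)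
     - factor2 (G_mat q) ** R' ** factor1 (G_mat q) ** R"
proof -
  have lift: "map_matrix aug2 (map_matrix lift2 M) = M" for M :: "complex fls fls mat4"
    by (simp add: vec_eq_iff aug2_lift2)
  show ?thesis
    unfolding refl_defect_def Let_def map_matrix_diff [OF is_hom_aug2] map_matrix_mult [OF is_hom_aug2]
      map_matrix_factor [OF is_hom_aug2] aug2_gen lift ..
qed

lemma mat_mult_entry4:
  "(A ** B :: 'a::ring_1 mat4) $ p $ q = A $ p $ (Neg, Neg) * B $ (Neg, Neg) $ q
     + A $ p $ (Neg, Pos) * B $ (Neg, Pos) $ q
     + A $ p $ (Pos, Neg) * B $ (Pos, Neg) $ q + A $ p $ (Pos, Pos) * B $ (Pos, Pos) $ q"
  by (simp add: matrix_matrix_mult_def UNIV_idx2 add.assoc)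

lemma R_sp_alt:
  obtains a b where
    "R_sp x = (\<chi> p q. (if p = q then a else 0) - (if fst p = snd q \<and> snd p = fst q then b else 0))"
proof
  show "R_sp x = (\<chi> p q. (if p = q then 1 + 1 / (x - 2) else 0)
      - (if fst p = snd q \<and> snd p = fst q then 1 / x + 1 / (x - 2) else 0))"
    by (simp add: R_sp_def vec_eq_iff all_idx P_mat_entry Q_mat_def ptransp_def mat_def)
qed

lemma refl_trivial_sp:
  "R_sp x ** factor1 (G_mat q) ** R_sp y ** factor2 (G_mat q) =
   factor2 (G_mat q) ** R_sp y ** factor1 (G_mat q) ** R_sp x"
proof -
  obtain a b where x: "R_sp x = (\<chi> p q. (if p = q then a else 0)
      - (if fst p = snd q \<and> snd p = fst q then b else 0))"
    by (rule R_sp_alt)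
  obtain c d where y: "R_sp y = (\<chi> p q. (if p = q then c else 0)
      - (if fst p = snd q \<and> snd p = fst q then d else 0))"
    by (rule R_sp_alt)
  show ?thesis
    by (cases q, simp_all add: x y vec_eq_iff all_idx mat_mult_entry4 mat_def
        factor1_def factor2_def kron_def K_mat_def unit_mat_def mult.commute)
      (simp add: algebra_simps)
qed

lemma refl_trivial_gl:
  "R_gl x ** ptransp s (R_gl y) = ptransp s (R_gl y) ** R_gl x"
proof -
  define a c where "a = 1 / x" "c = 1 / y"
  have x: "R_gl x = (\<chi> p q. (if p = q then 1 else 0) - (if fst p = snd q \<and> snd p = fst q then a else 0))"
    and y: "R_gl y = (\<chi> p q. (if p = q then 1 else 0) - (if fst p = snd q \<and> snd p = fst q then c else 0))"
    by (simp_all add: R_gl_def a_c_def vec_eq_iff all_idx P_mat_entry mat_def)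
  show ?thesis
    by (cases s, simp_all add: x y ptransp_def vec_eq_iff all_idx mat_mult_entry4 mult.commute)
      (simp add: algebra_simps)
qed

lemma map_fps_aug_subst_affine:
  "map_fps aug (subst_affine a b f) = subst_affine a b (map_fps aug f)"
proof (rule fps_ext)
  fix n
  let ?g = "fps_X * inverse (fps_const a + fps_const b * fps_X)"
  have *: "map_fps aug (map_fps of_C ?g) = map_fps of_C ?g"
    by (simp add: map_fps_def of_C_complex_def)
  have "aug (fps_nth (map_fps of_C ?g ^ i) n) = fps_nth (map_fps of_C ?g ^ i) n" for i
    using is_homD(8) [OF is_hom_map_fps [OF is_hom_aug], of "map_fps of_C ?g" i]
    unfolding * by (simp add: map_fps_def [of aug] fps_eq_iff)
  then show "fps_nth (map_fps aug (subst_affine a b f)) n = fps_nth (subst_affine a b (map_fps aug f)) n"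
    by (simp add: subst_affine_def fps_compose_nth map_fps_def [of aug] is_homD [OF is_hom_aug])
qed

lemma map_fps_aug_gen: "map_fps aug (gen_matrix free_gen (mat 1) $ i $ j) = mat 1 $ i $ j"
  by (auto simp: fps_eq_iff map_fps_def gen_matrix_nth mat_def split: nat.splits)

lemma subst_affine_0_1 [simp]: "subst_affine a b 0 = 0" "subst_affine a b 1 = 1"
  by (simp_all add: subst_affine_def fps_compose_0 fps_compose_1)

lemma aug_sp_center:
  "map_matrix (map_fps aug) (let T = gen_matrix free_gen (mat 1) in
     T ** mtransp Minus (msubst a b T) - mat 1) = 0"
  by (simp add: Let_def vec_eq_iff all_idx matrix_matrix_mult_def UNIV_idx mtransp_def
      is_homD [OF is_hom_map_fps [OF is_hom_aug]]
      map_fps_aug_subst_affine map_fps_aug_gen)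
    (simp add: mat_def is_homD [OF is_hom_map_fps [OF is_hom_aug]])

lemma aug_qdet: "map_fps aug (qdet (gen_matrix free_gen (mat 1)) - 1) = 0"
  by (simp add: qdet_def is_homD [OF is_hom_map_fps [OF is_hom_aug]]
      map_fps_aug_subst_affine map_fps_aug_gen) (simp add: mat_def)

lemma aug_fps: "map_fps aug f = 0 \<Longrightarrow> aug (fps_nth f n) = 0"
  by (simp add: map_fps_def fps_eq_iff)

lemma aug_Y_gl: "r \<in> Y_gl_relators \<Longrightarrow> aug r = 0"
  unfolding Y_gl_relators_def by (erule aug_coeffs2) (rule aug2_rtt)

lemma aug_X_sp: "r \<in> X_sp_relators \<Longrightarrow> aug r = 0"
  unfolding X_sp_relators_def by (erule aug_coeffs2) (rule aug2_rtt)

lemma aug_SY_gl: "r \<in> SY_gl_relators \<Longrightarrow> aug r = 0"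
  using aug_fps [OF aug_qdet] by (auto simp: SY_gl_relators_def aug_Y_gl)

lemma aug_Y_sp: "r \<in> Y_sp_relators \<Longrightarrow> aug r = 0"
proof -
  assume r: "r \<in> Y_sp_relators"
  define M :: "free_alg fps mat2" where
    "M = (let T = gen_matrix free_gen (mat 1) in T ** mtransp Minus (msubst 1 2 T) - mat 1)"
  have "map_fps aug (M $ i $ j) = 0" for i j
    using aug_sp_center [of 1 2, folded M_def] by (metis nth_map_matrix zero_index)
  then have "aug r = 0" if "r \<in> series_coeffs M"
    using that aug_fps by (auto simp: series_coeffs_def)
  then show "aug r = 0"
    using r aug_X_sp by (auto simp: Y_sp_relators_def M_def Let_def)
qed

lemma aug_Xt: "r \<in> Xt_relators q \<Longrightarrow> aug r = 0"
  unfolding Xt_relators_def by (erule aug_coeffs2) (simp add: aug2_refl refl_trivial_sp)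

lemma aug_Yt: "r \<in> Yt_relators s \<Longrightarrow> aug r = 0"
  unfolding Yt_relators_def
  by (erule aug_coeffs2) (use aug2_refl [of _ _ SP2_SP2] in \<open>simp add: factor_1 refl_trivial_gl\<close>)


section \<open>The presented algebras\<close>

text \<open>
  A presentation is carried by a tag type \<open>'p\<close>; \<open>'p palg\<close> is the quotient of the free algebra by
  the two-sided ideal generated by the relators attached to \<open>'p\<close>.
\<close>

class presentation =
  fixes relators :: "'a itself \<Rightarrow> free_alg set"
  assumes one_notin_relators: "1 \<notin> ideal_gen (relators TYPE('a))"

quotient_type (overloaded) 'p palg = free_alg /
  "\<lambda>x y. x - y \<in> ideal_gen (relators TYPE('p::presentation))"
proof (rule equivpI)
  show "reflp (\<lambda>x y. x - y \<in> ideal_gen (relators TYPE('p)))"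
    by (rule reflpI) (simp add: ideal_gen.zero)
  show "symp (\<lambda>x y. x - y \<in> ideal_gen (relators TYPE('p)))"
    by (rule sympI) (use ideal_gen_uminus in fastforce)
  show "transp (\<lambda>x y. x - y \<in> ideal_gen (relators TYPE('p)))"
  proof (rule transpI)
    fix x y z :: free_alg
    assume "x - y \<in> ideal_gen (relators TYPE('p))" "y - z \<in> ideal_gen (relators TYPE('p))"
    from ideal_gen_plus [OF this] show "x - z \<in> ideal_gen (relators TYPE('p))" by simp
  qed
qed

instantiation palg :: (presentation) calgebra
begin

lift_definition zero_palg :: "'a palg" is 0 .
lift_definition one_palg :: "'a palg" is 1 .
lift_definition of_C_palg :: "complex \<Rightarrow> 'a palg" is of_C .
lift_definition plus_palg :: "'a palg \<Rightarrow> 'a palg \<Rightarrow> 'a palg" is "(+)"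
proof -
  fix x x' y y' :: free_alg
  assume "x - x' \<in> ideal_gen (relators TYPE('a))" "y - y' \<in> ideal_gen (relators TYPE('a))"
  from ideal_gen_plus [OF this] show "x + y - (x' + y') \<in> ideal_gen (relators TYPE('a))"
    by (simp add: algebra_simps)
qed
lift_definition uminus_palg :: "'a palg \<Rightarrow> 'a palg" is uminus
proof -
  fix x y :: free_alg
  assume "x - y \<in> ideal_gen (relators TYPE('a))"
  from ideal_gen_uminus [OF this] show "- x - - y \<in> ideal_gen (relators TYPE('a))"
    by (simp add: algebra_simps)
qed
lift_definition minus_palg :: "'a palg \<Rightarrow> 'a palg \<Rightarrow> 'a palg" is "(-)"
proof -
  fix x x' y y' :: free_alg
  assume "x - x' \<in> ideal_gen (relators TYPE('a))" "y - y' \<in> ideal_gen (relators TYPE('a))"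
  from ideal_gen_diff [OF this] show "x - y - (x' - y') \<in> ideal_gen (relators TYPE('a))"
    by (simp add: algebra_simps)
qed
lift_definition times_palg :: "'a palg \<Rightarrow> 'a palg \<Rightarrow> 'a palg" is "(*)"
proof -
  fix x x' y y' :: free_alg
  assume "x - x' \<in> ideal_gen (relators TYPE('a))" "y - y' \<in> ideal_gen (relators TYPE('a))"
  then have "(x - x') * y + x' * (y - y') \<in> ideal_gen (relators TYPE('a))"
    by (intro ideal_gen_plus ideal_gen_mult_left ideal_gen_mult_right)
  then show "x * y - x' * y' \<in> ideal_gen (relators TYPE('a))"
    by (simp add: algebra_simps)
qed

instance
proof
  fix a b c :: "'a palg" and k l :: complex
  show "a + b + c = a + (b + c)" by transfer (simp add: add.assoc ideal_gen.zero)
  show "a + b = b + a" by transfer (simp add: add.commute ideal_gen.zero)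
  show "0 + a = a" by transfer (simp add: ideal_gen.zero)
  show "- a + a = 0" by transfer (simp add: ideal_gen.zero)
  show "a - b = a + - b" by transfer (simp add: ideal_gen.zero)
  show "a * b * c = a * (b * c)" by transfer (simp add: mult.assoc ideal_gen.zero)
  show "1 * a = a" by transfer (simp add: ideal_gen.zero)
  show "a * 1 = a" by transfer (simp add: ideal_gen.zero)
  show "(a + b) * c = a * c + b * c" by transfer (simp add: distrib_right ideal_gen.zero)
  show "a * (b + c) = a * b + a * c" by transfer (simp add: distrib_left ideal_gen.zero)
  show "(0 :: 'a palg) \<noteq> 1"
  proof transfer
    show "0 - 1 \<notin> ideal_gen (relators TYPE('a))"
      using ideal_gen_uminus [of "0 - 1" "relators TYPE('a)"] one_notin_relators by auto
  qed
  show "of_C 1 = (1 :: 'a palg)" by transfer (simp add: ideal_gen.zero)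
  show "of_C (k + l) = (of_C k + of_C l :: 'a palg)"
    by transfer (simp add: of_C_add ideal_gen.zero)
  show "of_C (k * l) = (of_C k * of_C l :: 'a palg)"
    by transfer (simp add: of_C_mult ideal_gen.zero)
  show "of_C k * a = a * of_C k"
    by transfer (simp add: of_C_central ideal_gen.zero)
qed

end

lift_definition palg_gen :: "generator \<Rightarrow> 'p::presentation palg" is free_gen .

datatype Y2_pres = Y2_pres
instantiation Y2_pres :: presentation
begin
definition relators_Y2_pres :: "Y2_pres itself \<Rightarrow> free_alg set" where
  "relators_Y2_pres _ = Y_gl_relators"
instance by standard (simp add: relators_Y2_pres_def one_notin_ideal aug_Y_gl)
end
type_synonym Y2 = "Y2_pres palg"

datatype SY2_pres = SY2_pres
instantiation SY2_pres :: presentation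
begin
definition relators_SY2_pres :: "SY2_pres itself \<Rightarrow> free_alg set" where
  "relators_SY2_pres _ = SY_gl_relators"
instance by standard (simp add: relators_SY2_pres_def one_notin_ideal aug_SY_gl)
end
type_synonym SY2 = "SY2_pres palg"

datatype X_sp2_pres = X_sp2_pres
instantiation X_sp2_pres :: presentation
begin
definition relators_X_sp2_pres :: "X_sp2_pres itself \<Rightarrow> free_alg set" where
  "relators_X_sp2_pres _ = X_sp_relators"
instance by standard (simp add: relators_X_sp2_pres_def one_notin_ideal aug_X_sp)
end
type_synonym X_sp2 = "X_sp2_pres palg"

datatype Y_sp2_pres = Y_sp2_pres
instantiation Y_sp2_pres :: presentation
begin
definition relators_Y_sp2_pres :: "Y_sp2_pres itself \<Rightarrow> free_alg set" where
  "relators_Y_sp2_pres _ = Y_sp_relators"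
instance by standard (simp add: relators_Y_sp2_pres_def one_notin_ideal aug_Y_sp)
end
type_synonym Y_sp2 = "Y_sp2_pres palg"

datatype Xt_sp2_sp2_pres = Xt_sp2_sp2_pres
instantiation Xt_sp2_sp2_pres :: presentation
begin
definition relators_Xt_sp2_sp2_pres :: "Xt_sp2_sp2_pres itself \<Rightarrow> free_alg set" where
  "relators_Xt_sp2_sp2_pres _ = Xt_relators SP2_SP2"
instance by standard (simp add: relators_Xt_sp2_sp2_pres_def one_notin_ideal aug_Xt)
end
type_synonym Xt_sp2_sp2 = "Xt_sp2_sp2_pres palg"

datatype Xt_sp2_gl1_pres = Xt_sp2_gl1_pres
instantiation Xt_sp2_gl1_pres :: presentation
begin
definition relators_Xt_sp2_gl1_pres :: "Xt_sp2_gl1_pres itself \<Rightarrow> free_alg set" where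
  "relators_Xt_sp2_gl1_pres _ = Xt_relators SP2_GL1"
instance by standard (simp add: relators_Xt_sp2_gl1_pres_def one_notin_ideal aug_Xt)
end
type_synonym Xt_sp2_gl1 = "Xt_sp2_gl1_pres palg"

datatype Yt_plus_pres = Yt_plus_pres
instantiation Yt_plus_pres :: presentation
begin
definition relators_Yt_plus_pres :: "Yt_plus_pres itself \<Rightarrow> free_alg set" where
  "relators_Yt_plus_pres _ = Yt_relators Plus"
instance by standard (simp add: relators_Yt_plus_pres_def one_notin_ideal aug_Yt)
end
type_synonym Yt_plus = "Yt_plus_pres palg"

datatype Yt_minus_pres = Yt_minus_pres
instantiation Yt_minus_pres :: presentation
begin
definition relators_Yt_minus_pres :: "Yt_minus_pres itself \<Rightarrow> free_alg set" where
  "relators_Yt_minus_pres _ = Yt_relators Minus"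
instance by standard (simp add: relators_Yt_minus_pres_def one_notin_ideal aug_Yt)
end
type_synonym Yt_minus = "Yt_minus_pres palg"


text \<open>
  \<open>T_gen\<close> is the matrix of generators \<open>T(u) = I + O(u\<^sup>-\<^sup>1)\<close> of any of the algebras, and
  \<open>St_gen q\<close> is \<open>G + O(u\<^sup>-\<^sup>1)\<close> for the pair \<open>q\<close>.
\<close>

definition T_gen :: "'p::presentation palg fps mat2" where
  "T_gen = gen_matrix palg_gen (mat 1)"

definition St_gen :: "sym_pair \<Rightarrow> 'p::presentation palg fps mat2" where
  "St_gen q = gen_matrix palg_gen (G_mat q)"

section \<open>Coideal subalgebras\<close>

definition S_sp :: "sym_pair \<Rightarrow> 'a::calgebra fps mat2 \<Rightarrow> 'a fps mat2" where
  "S_sp q T = msubst 1 (-1) T ** G_mat q ** mtransp Minus (msubst (-1) 1 T)"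

definition S_gl :: "tsign \<Rightarrow> 'a::calgebra fps mat2 \<Rightarrow> 'a fps mat2" where
  "S_gl s T = T ** mtransp s (msubst (-1) 0 T)"

definition B_gl :: "nat \<Rightarrow> 'a::calgebra fps mat2 \<Rightarrow> 'a fps mat2" where
  "B_gl q T = T ** (unit_mat Neg Neg + map_matrix ((*) ((-1) ^ q)) (unit_mat Pos Pos))
     ** matrix_inv (msubst (-1) 0 T)"

definition X_tw :: "sym_pair \<Rightarrow> X_sp2 set" where
  "X_tw q = subalgebra_gen (series_coeffs (S_sp q T_gen))"

definition Y_tw :: "sym_pair \<Rightarrow> Y_sp2 set" where
  "Y_tw q = subalgebra_gen (series_coeffs (S_sp q T_gen))"

definition Y_ol :: "tsign \<Rightarrow> Y2 set" where
  "Y_ol s = subalgebra_gen (series_coeffs (S_gl s T_gen))"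

definition SY_ol :: "tsign \<Rightarrow> SY2 set" where
  "SY_ol s = subalgebra_gen (series_coeffs (S_gl s T_gen))"

definition B_refl :: "nat \<Rightarrow> Y2 set" where
  "B_refl q = subalgebra_gen (series_coeffs (B_gl q T_gen))"

definition SB_refl :: "nat \<Rightarrow> SY2 set" where
  "SB_refl q = subalgebra_gen (series_coeffs (B_gl q T_gen))"

section \<open>The central series of the extended algebras\<close>

text \<open>
  One-parameter identities are read in \<open>A((u\<^sup>-\<^sup>1))\<close>.  The predicates below are the defining
  identities of \<open>c(u)\<close>,
  \<open>Q S\<^sub>1(u) R(2u-2) S\<^sub>2(2-u)\<^sup>-\<^sup>1 = p(u) c(u) Q\<close> and
  \<open>Q S\<^sub>1(u) R(2u) S\<^sub>2(-u)\<^sup>-\<^sup>1 = (1 \<mp> 1/2u) c(u) Q\<close>; each determines \<open>c(u)\<close> uniquely.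
\<close>

definition uu :: "complex fls" where "uu = fls_X_inv"

fun p_series :: "sym_pair \<Rightarrow> complex fls" where
  "p_series SP2_SP2 = 1 + 1 / (2 * uu - 2) + 2 / (2 * uu - 4)"
| "p_series SP2_GL1 = - 1 + 1 / (2 * uu - 2)"

definition is_c_sp :: "sym_pair \<Rightarrow> 'a::calgebra fps mat2 \<Rightarrow> 'a fps \<Rightarrow> bool" where
  "is_c_sp q S c \<longleftrightarrow>
     Q_mat Minus ** factor1 (map_matrix fps_to_fls S) ** map_matrix lift1 (R_sp (2 * uu - 2))
       ** factor2 (map_matrix fps_to_fls (matrix_inv (msubst (-1) 2 S)))
     = map_matrix (\<lambda>y. lift1 (p_series q) * fps_to_fls c * y) (Q_mat Minus)"

fun p_ol :: "tsign \<Rightarrow> complex fls" where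
  "p_ol Plus = 1 - 1 / (2 * uu)"
| "p_ol Minus = 1 + 1 / (2 * uu)"

definition is_c_ol :: "tsign \<Rightarrow> 'a::calgebra fps mat2 \<Rightarrow> 'a fps \<Rightarrow> bool" where
  "is_c_ol s S c \<longleftrightarrow>
     Q_mat s ** factor1 (map_matrix fps_to_fls S) ** map_matrix lift1 (R_gl (2 * uu))
       ** factor2 (map_matrix fps_to_fls (matrix_inv (msubst (-1) 0 S)))
     = map_matrix (\<lambda>y. lift1 (p_ol s) * fps_to_fls c * y) (Q_mat s)"

definition ideal_c :: "'a::calgebra fps \<Rightarrow> 'a set" where
  "ideal_c c = ideal_gen {fps_nth (c - 1) n | n. True}"

text \<open>
  A homomorphism from an algebra that the coefficients of \<open>M\<close> generate is determined by its
  values on them.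
\<close>

definition alg_hom_sending ::
  "'a::calgebra fps mat2 \<Rightarrow> 'b::calgebra fps mat2 \<Rightarrow> ('a \<Rightarrow> 'b) \<Rightarrow> bool" where
  "alg_hom_sending M N f \<longleftrightarrow> alg_hom_on UNIV f \<and> map_matrix (map_fps f) M = N"

end

theory Submission
  imports Defs
begin

text \<open>
  For \<open>2 \<times> 2\<close> matrices the transposition \<open>t\<^sub>-\<close> is the adjugate and \<open>P + Q\<^sup>- = I\<close>, so the R-matrix of
  \<open>sp\<^sub>2\<close> satisfies \<open>R(2x) \<sim> R\<^sup>\<circ>(x)\<close> and \<open>R(2x + 2) \<sim> R\<^sup>\<circ>(-x)\<^sup>t\<close> up to scalar factors.  Hence
  \<open>T(u) \<mapsto> T\<^sup>\<circ>(u/2)\<close> identifies \<open>X(sp\<^sub>2)\<close> with \<open>Y(2)\<close> and takes \<open>z(u)\<close> to \<open>qdet T\<^sup>\<circ>(u/2 + 1)\<close>, and the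
  same rescaling, together with \<open>K A\<^sup>t\<^sup>- = A\<^sup>t\<^sup>+ K\<close>, matches all twisted algebras.

  For the reflection algebras write \<open>qdet T\<^sup>\<circ>(u) = d(u) d(u - 1)\<close> with \<open>d\<close> central and \<open>T\<^sup>\<circ> = d T'\<close>.  Up to the
  shift \<open>u \<mapsto> u + 1/2\<close> both \<open>S(u) = T\<^sup>\<circ>(u) G T\<^sup>\<circ>(-u)\<^sup>t\<close> and \<open>B(u) = T\<^sup>\<circ>(u) G T\<^sup>\<circ>(-u)\<^sup>-\<^sup>1\<close> are central multiples
  of the same matrix formed from \<open>T'\<close>, namely by \<open>H(u) = d(u) d(-u)\<close> and \<open>e(u) = d(u) / d(-u)\<close>.  These central
  series lie in the respective subalgebras, but \<open>H\<close> is even while \<open>e(u) e(-u) = 1\<close>, so they have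
  to be recoded into each other: with \<open>k\<^sup>2 = H\<close>, the relation \<open>e = (1 + o) / (1 - o)\<close>, \<open>o(u) = u (k(u) - 1)\<close>
  is a bijection between such series.  Since \<open>T' \<mapsto> T'\<close> extends to an endomorphism of \<open>Y(2)\<close> with an
  arbitrary central image of \<open>d\<close>, the recoding is induced by endomorphisms of \<open>Y(2)\<close>.
\<close>

section \<open>Affine substitutions in Laurent series\<close>

text \<open>The delicate point is that the central factor lies in each subalgebra, because the two
  memberships need different arguments. For S the product S(u) S(-u-1) is the scalar H(u) H(u+1),
  and a series with constant term 1 is recovered, coefficient by coefficient and inside any
  subalgebra, from f(u) f(u+b). For B the product B(u) B(-u) loses e altogether, since e(u) e(-u) =
  1; instead the symmetry relation, which compares entries at u and -u, yields e(u) e(u+1). The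
  shape of the recoding is explained by parity. The Cayley transform turns e(u) e(-u) = 1 into
  oddness of o, while k is even with constant term 1, so that u (k(u) - 1) is an odd power series in
  u^-1. Sending d to 1 + o(u)/u, which is even, sends k to that same series; sending d to 1 + o
  sends e to (1 + o) / (1 - o). The two endomorphisms so obtained are mutually inverse between the
  subalgebras, although one of their composites sends d to k.\<close>

definition affine :: "complex \<Rightarrow> complex \<Rightarrow> complex fls" where
  "affine a b = fls_const a * fls_X_inv + fls_const b"

lemma affine_nth: "fls_nth (affine a b) k = (if k = -1 then a else if k = 0 then b else 0)"
  by (simp add: affine_def)

lemma fls_subdegree_affine: "a \<noteq> 0 \<Longrightarrow> fls_subdegree (affine a b) = -1"
  by (intro fls_subdegree_eqI) (auto simp: affine_nth)

lemma affine_nonzero: "a \<noteq> 0 \<Longrightarrow> affine a b \<noteq> 0"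
  using fls_subdegree_affine[of a b] by force

text \<open>Coefficient of u^-k in (a u + b)^-n. The array is upper triangular in (n, k), which
  keeps every sum over it finite.\<close>

definition affine_coeff :: "complex \<Rightarrow> complex \<Rightarrow> int \<Rightarrow> int \<Rightarrow> complex" where
  "affine_coeff a b n k = fls_nth (affine a b powi (- n)) k"

lemma affine_coeff_eq_0: "a \<noteq> 0 \<Longrightarrow> k < n \<Longrightarrow> affine_coeff a b n k = 0"
  unfolding affine_coeff_def by (intro fls_eq0_below_subdegree) (simp add: fls_subdegree_affine)

lemma affine_coeff_0: "affine_coeff a b 0 k = (if k = 0 then 1 else 0)"
  by (simp add: affine_coeff_def)

lemma affine_coeff_add:
  assumes "a \<noteq> 0"
  shows "affine_coeff a b (i + j) k = (\<Sum>l=i..k-j. affine_coeff a b i l * affine_coeff a b j (k - l))"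
proof -
  have "affine a b powi (- (i + j)) = affine a b powi (- i) * affine a b powi (- j)"
    using power_int_add[of "affine a b" "-i" "-j"] affine_nonzero[OF assms] by simp
  then show ?thesis
    unfolding affine_coeff_def
    by (simp add: fls_times_nth_bound[of i _ j] fls_eq0_below_subdegree fls_subdegree_affine assms)
qed

text \<open>Laurent counterpart of \<open>subst_affine\<close>, needed because u and v themselves
  occur in the R-matrices. Multiplicativity of \<open>subst_affine\<close> over a noncommutative
  algebra is also deduced from it.\<close>

definition subst_fls :: "complex \<Rightarrow> complex \<Rightarrow> 'a::calgebra fls \<Rightarrow> 'a fls" where
  "subst_fls a b f =
     Abs_fls (\<lambda>k. \<Sum>n=fls_subdegree f..k. fls_nth f n * of_C (affine_coeff a b n k))"

lemma subst_fls_nth: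
  assumes "\<And>i. i < N \<Longrightarrow> fls_nth f i = 0"
  shows "fls_nth (subst_fls a b f) k = (\<Sum>n=N..k. fls_nth f n * of_C (affine_coeff a b n k))"
proof (cases "f = 0")
  case False
  then have N: "N \<le> fls_subdegree f"
    using assms by (meson linorder_not_less nth_fls_subdegree_nonzero)
  have "fls_nth (subst_fls a b f) k =
      (\<Sum>n=fls_subdegree f..k. fls_nth f n * of_C (affine_coeff a b n k))"
    unfolding subst_fls_def by (rule nth_Abs_fls_lower_bound[of "fls_subdegree f"]) simp
  also have "\<dots> = (\<Sum>n=N..k. fls_nth f n * of_C (affine_coeff a b n k))"
    using N by (intro sum.mono_neutral_left) auto
  finally show ?thesis .
qed (simp add: subst_fls_def zero_fls_def)

lemma subst_fls_eq0_below:
  "(\<And>i. i < N \<Longrightarrow> fls_nth f i = 0) \<Longrightarrow> k < N \<Longrightarrow> fls_nth (subst_fls a b f) k = 0"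
  by (simp add: subst_fls_nth[of N])

lemma sum_int_shift: "(\<Sum>n=a..b. f n) = (\<Sum>j=a-i..b-i. f (i + j :: int))"
  by (rule sum.reindex_bij_witness[of _ "\<lambda>j. i + j" "\<lambda>n. n - i"]) auto

text \<open>The law (a u + b)^-(i+j) = (a u + b)^-i (a u + b)^-j, read coefficientwise in
  \<open>affine_coeff_add\<close>, combined with the centrality of scalars, which lets them pass the
  coefficients of \<open>g\<close>.\<close>

lemma subst_fls_mult:
  assumes a: "a \<noteq> 0"
  shows "subst_fls a b (f * g) = subst_fls a b f * subst_fls a b g"
proof (rule fls_eqI)
  fix k
  define M N where "M = fls_subdegree f" and "N = fls_subdegree g"
  have f0: "fls_nth f i = 0" if "i < M" for i using that by (simp add: M_def)
  have g0: "fls_nth g i = 0" if "i < N" for i using that by (simp add: N_def)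
  let ?c = "\<lambda>n k. of_C (affine_coeff a b n k) :: 'a"
  have sf: "fls_nth (subst_fls a b f) l = (\<Sum>n=M..l. fls_nth f n * ?c n l)" for l
    by (rule subst_fls_nth) (rule f0)
  have sg: "fls_nth (subst_fls a b g) l = (\<Sum>n=N..l. fls_nth g n * ?c n l)" for l
    by (rule subst_fls_nth) (rule g0)
  have fg: "fls_nth (f * g) n = (\<Sum>i=M..n-N. fls_nth f i * fls_nth g (n - i))" for n
    by (rule fls_times_nth_bound) (auto simp: f0 g0)
  have comm: "x * ?c n m = ?c n m * x" for x n m by (simp add: of_C_central)
  have "fls_nth (subst_fls a b (f * g)) k = (\<Sum>n=M+N..k. fls_nth (f * g) n * ?c n k)"
    by (rule subst_fls_nth) (simp add: fg)
  also have "\<dots> = (\<Sum>n=M+N..k. \<Sum>i=M..k-N. fls_nth f i * fls_nth g (n - i) * ?c n k)"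
    unfolding fg sum_distrib_right
    by (intro sum.cong refl sum.mono_neutral_left) (auto simp: g0)
  also have "\<dots> = (\<Sum>i=M..k-N. \<Sum>n=M+N..k. fls_nth f i * fls_nth g (n - i) * ?c n k)"
    by (rule sum.swap)
  also have "\<dots> = (\<Sum>i=M..k-N. \<Sum>j=N..k-M. fls_nth f i * fls_nth g j * ?c (i + j) k)"
  proof (rule sum.cong[OF refl])
    fix i assume i: "i \<in> {M..k-N}"
    have "(\<Sum>n=M+N..k. fls_nth f i * fls_nth g (n - i) * ?c n k)
        = (\<Sum>n=M+N..i+k-M. fls_nth f i * fls_nth g (n - i) * ?c n k)"
      using i by (intro sum.mono_neutral_left) (auto simp: affine_coeff_eq_0[OF a])
    also have "\<dots> = (\<Sum>n=i+N..i+k-M. fls_nth f i * fls_nth g (n - i) * ?c n k)"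
      using i by (intro sum.mono_neutral_right) (auto simp: g0)
    also have "\<dots> = (\<Sum>j=N..k-M. fls_nth f i * fls_nth g j * ?c (i + j) k)"
      by (subst sum_int_shift[of _ _ _ i]) (simp add: algebra_simps)
    finally show "(\<Sum>n=M+N..k. fls_nth f i * fls_nth g (n - i) * ?c n k)
        = (\<Sum>j=N..k-M. fls_nth f i * fls_nth g j * ?c (i + j) k)" .
  qed
  \<comment> \<open>All three ranges are widened to a fixed box, the added terms being 0 by
    triangularity; only then can the sums be interchanged.\<close>
  also have "\<dots> = (\<Sum>i=M..k-N. \<Sum>j=N..k-M. \<Sum>l=M..k-N.
      fls_nth f i * fls_nth g j * (?c i l * ?c j (k - l)))"
  proof (intro sum.cong refl)
    fix i j assume i: "i \<in> {M..k-N}" and j: "j \<in> {N..k-M}"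
    have "?c (i + j) k = (\<Sum>l=i..k-j. ?c i l * ?c j (k - l))"
      by (simp add: affine_coeff_add[OF a] is_homD[OF is_hom_of_C])
    also have "\<dots> = (\<Sum>l=M..k-N. ?c i l * ?c j (k - l))"
      using i j by (intro sum.mono_neutral_left) (auto simp: affine_coeff_eq_0[OF a])
    finally show "fls_nth f i * fls_nth g j * ?c (i + j) k =
        (\<Sum>l=M..k-N. fls_nth f i * fls_nth g j * (?c i l * ?c j (k - l)))"
      by (simp add: sum_distrib_left)
  qed
  also have "\<dots> = (\<Sum>i=M..k-N. \<Sum>l=M..k-N. \<Sum>j=N..k-M.
      fls_nth f i * fls_nth g j * (?c i l * ?c j (k - l)))"
    by (intro sum.cong refl sum.swap)
  also have "\<dots> = (\<Sum>l=M..k-N. \<Sum>i=M..k-N. \<Sum>j=N..k-M.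
      fls_nth f i * fls_nth g j * (?c i l * ?c j (k - l)))"
    by (rule sum.swap)
  also have "\<dots> = (\<Sum>l=M..k-N. \<Sum>i=M..k-N. \<Sum>j=N..k-M.
      (fls_nth f i * ?c i l) * (fls_nth g j * ?c j (k - l)))"
    by (intro sum.cong refl) (metis comm mult.assoc)
  also have "\<dots> = (\<Sum>l=M..k-N. (\<Sum>i=M..k-N. fls_nth f i * ?c i l) *
      (\<Sum>j=N..k-M. fls_nth g j * ?c j (k - l)))"
    by (simp add: sum_product)
  also have "\<dots> = (\<Sum>l=M..k-N. fls_nth (subst_fls a b f) l * fls_nth (subst_fls a b g) (k - l))"
  proof (intro sum.cong refl)
    fix l assume l: "l \<in> {M..k-N}"
    have "(\<Sum>i=M..k-N. fls_nth f i * ?c i l) = fls_nth (subst_fls a b f) l"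
      unfolding sf
      using l by (intro sum.mono_neutral_right) (auto simp: affine_coeff_eq_0[OF a])
    moreover have "(\<Sum>j=N..k-M. fls_nth g j * ?c j (k - l)) = fls_nth (subst_fls a b g) (k - l)"
      unfolding sg
      using l by (intro sum.mono_neutral_right) (auto simp: affine_coeff_eq_0[OF a])
    ultimately show "(\<Sum>i=M..k-N. fls_nth f i * ?c i l) * (\<Sum>j=N..k-M. fls_nth g j * ?c j (k - l))
        = fls_nth (subst_fls a b f) l * fls_nth (subst_fls a b g) (k - l)" by simp
  qed
  also have "\<dots> = fls_nth (subst_fls a b f * subst_fls a b g) k"
    by (subst fls_times_nth_bound[of M _ N]) (auto intro: subst_fls_eq0_below f0 g0)
  finally show "fls_nth (subst_fls a b (f * g)) k = fls_nth (subst_fls a b f * subst_fls a b g) k" .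
qed

lemma subst_fls_add: "subst_fls a b (f + g) = subst_fls a b f + subst_fls a b g"
proof (rule fls_eqI)
  fix k
  define N where "N = min (fls_subdegree f) (fls_subdegree g)"
  have *: "fls_nth f i = 0" "fls_nth g i = 0" if "i < N" for i
    using that by (simp_all add: N_def)
  show "fls_nth (subst_fls a b (f + g)) k = fls_nth (subst_fls a b f + subst_fls a b g) k"
    by (simp add: subst_fls_nth[of N] * distrib_right sum.distrib)
qed

lemma subst_fls_const [simp]: "subst_fls a b (fls_const c) = fls_const c"
  by (rule fls_eqI) (auto simp: subst_fls_nth[of 0] affine_coeff_0 if_distrib if_distribR
      sum.delta' cong: if_cong)

lemma fls_const_1 [simp]: "fls_const (1 :: 'a::ring_1) = 1"
  by (simp add: fls_eq_iff)

lemma is_hom_subst_fls: "a \<noteq> 0 \<Longrightarrow> is_hom (subst_fls a b)"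
  unfolding is_hom_def using subst_fls_const[of a b 1]
  by (simp add: subst_fls_mult subst_fls_add)

definition is_alg_hom :: "('a::calgebra \<Rightarrow> 'b::calgebra) \<Rightarrow> bool" where
  "is_alg_hom h \<longleftrightarrow> is_hom h \<and> (\<forall>c. h (of_C c) = of_C c)"

lemma map_fls_subst_fls:
  assumes "is_alg_hom h"
  shows "map_fls h (subst_fls a b f) = subst_fls a b (map_fls h f)"
proof (rule fls_eqI)
  fix k
  have h: "is_hom h" and hC: "\<And>c. h (of_C c) = of_C c"
    using assms by (auto simp: is_alg_hom_def)
  note h0 = is_homD(4)[OF h]
  show "fls_nth (map_fls h (subst_fls a b f)) k = fls_nth (subst_fls a b (map_fls h f)) k"
    by (simp add: map_fls_nth h0 subst_fls_nth[of "fls_subdegree f"] is_homD[OF h] hC)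
qed

text \<open>Makes substitution in u available on \<open>'a fls fls\<close>: there the coefficients
  are series in v, and these must again form an algebra over the scalars.\<close>

instantiation fls :: (calgebra) calgebra
begin
definition of_C_fls :: "complex \<Rightarrow> 'a fls" where "of_C_fls c = fls_const (of_C c)"
instance
proof
  fix a b :: complex and x :: "'a fls"
  show "of_C 1 = (1 :: 'a fls)" by (simp add: of_C_fls_def)
  show "of_C (a + b) = (of_C a + of_C b :: 'a fls)"
    by (simp add: of_C_fls_def of_C_add fls_plus_const)
  show "of_C (a * b) = (of_C a * of_C b :: 'a fls)"
    by (simp add: of_C_fls_def of_C_mult fls_const_mult_const)
  show "of_C a * x = x * of_C a"
    by (rule fls_eqI) (simp add: of_C_fls_def of_C_central)
qed
end

lemma is_alg_hom_fls_const: "is_alg_hom (fls_const :: 'a::calgebra \<Rightarrow> _)"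
  by (simp add: is_alg_hom_def is_hom_def of_C_fls_def fls_plus_const fls_const_mult_const)

lemma is_alg_hom_of_C: "is_alg_hom (of_C :: complex \<Rightarrow> 'a::calgebra)"
  by (simp add: is_alg_hom_def is_hom_of_C of_C_complex_def)

lemma map_fls_const: "h 0 = 0 \<Longrightarrow> map_fls h (fls_const c) = fls_const (h c)"
  by (rule fls_eqI) (simp add: map_fls_nth)

lemma is_alg_hom_map_fls: "is_alg_hom h \<Longrightarrow> is_alg_hom (map_fls h)"
  by (simp add: is_alg_hom_def is_hom_map_fls of_C_fls_def map_fls_const is_homD)

lemma subst_fls_X_inv:
  assumes "a \<noteq> 0"
  shows "subst_fls a b (fls_X_inv :: 'a::calgebra fls) = of_C a * fls_X_inv + of_C b"
proof (rule fls_eqI)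
  fix k
  have "fls_nth (subst_fls a b (fls_X_inv :: 'a fls)) k =
      (\<Sum>n=-1..k. fls_nth (fls_X_inv :: 'a fls) n * of_C (affine_coeff a b n k))"
    by (rule subst_fls_nth) simp
  also have "\<dots> = (\<Sum>n=-1..k. (if n = -1 then of_C (affine_coeff a b (-1) k) else 0))"
    by (intro sum.cong refl) simp
  also have "\<dots> = (if -1 \<le> k then of_C (affine_coeff a b (-1) k) else 0)"
    by simp
  also have "\<dots> = fls_nth (of_C a * fls_X_inv + of_C b :: 'a fls) k"
    by (auto simp: affine_coeff_def affine_nth of_C_fls_def)
  finally show "fls_nth (subst_fls a b (fls_X_inv :: 'a fls)) k
      = fls_nth (of_C a * fls_X_inv + of_C b :: 'a fls) k" .
qed

text \<open>Both sides come from powers of (a u + b)^-1, which in terms of X = u^-1 is X / (a + b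
  X), the series composed with in \<open>subst_affine\<close>.\<close>

lemma affine_coeff_fps:
  assumes "a \<noteq> 0"
  shows "affine_coeff a b (int i) (int n) =
     fps_nth ((fps_X * inverse (fps_const a + fps_const b * fps_X)) ^ i) n"
    (is "_ = fps_nth (?g ^ i) n")
proof -
  have "fps_nth (fps_const a + fps_const b * fps_X) 0 \<noteq> 0" using assms by simp
  then have "subdegree (fps_const a + fps_const b * fps_X) = 0" by (rule subdegree_eq_0)
  then have "fps_to_fls ?g = fls_X * inverse (fps_to_fls (fps_const a + fps_const b * fps_X))"
    by (simp only: fls_times_fps_to_fls fls_inverse_fps_to_fls fps_X_to_fls)
  also have "fps_to_fls (fps_const a + fps_const b * fps_X) = fls_X * affine a b"
    by (rule fls_eqI) (auto simp: affine_nth fls_times_fps_to_fls fls_X_times_conv_shift)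
  also have "fls_X * inverse (fls_X * affine a b) = inverse (affine a b)"
    by (simp add: field_simps)
  finally have "affine a b powi (- int i) = fps_to_fls (?g ^ i)"
    by (simp add: fps_to_fls_power power_int_minus power_inverse)
  then show ?thesis by (simp add: affine_coeff_def)
qed

lemma map_fps_power: "is_hom h \<Longrightarrow> map_fps h (f ^ n) = map_fps h f ^ n"
  by (rule is_homD(8)[OF is_hom_map_fps])

lemma map_fps_nth [simp]: "fps_nth (map_fps h f) n = h (fps_nth f n)"
  by (simp add: map_fps_def)

lemma subst_affine_nth:
  assumes "a \<noteq> 0"
  shows "fps_nth (subst_affine a b f) n =
    (\<Sum>i=0..n. fps_nth f i * of_C (affine_coeff a b (int i) (int n)))"
  unfolding subst_affine_def
  by (simp add: fps_compose_nth affine_coeff_fps[OF assms] flip: map_fps_power[OF is_hom_of_C])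

lemma fps_to_fls_subst_affine:
  assumes a: "a \<noteq> 0"
  shows "fps_to_fls (subst_affine a b f) = subst_fls a b (fps_to_fls f)"
proof (rule fls_eqI)
  fix k
  show "fls_nth (fps_to_fls (subst_affine a b f)) k = fls_nth (subst_fls a b (fps_to_fls f)) k"
  proof (cases "k < 0")
    case False
    then obtain n where k: "k = int n" by (metis linorder_not_less nat_0_le)
    have "(\<Sum>i=0..n. fps_nth f i * of_C (affine_coeff a b (int i) (int n)))
        = (\<Sum>i=0..int n. fps_nth f (nat i) * of_C (affine_coeff a b i (int n)))"
      by (rule sum.reindex_bij_witness[of _ nat int]) auto
    then show ?thesis
      by (simp add: k subst_affine_nth[OF a] subst_fls_nth[of 0])
  qed (simp add: subst_fls_nth[of 0])
qed

lemma is_hom_subst_affine: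
  assumes "a \<noteq> 0"
  shows "is_hom (subst_affine a b)"
  unfolding is_hom_def
  by (simp add: fps_to_fls_subst_affine[OF assms] is_homD[OF is_hom_subst_fls[OF assms]]
      fls_times_fps_to_fls flip: fps_to_fls_eq_iff)

lemma map_fps_subst_affine:
  assumes h: "is_alg_hom h" and a: "a \<noteq> 0"
  shows "map_fps h (subst_affine a b f) = subst_affine a b (map_fps h f)"
proof -
  have "h 0 = 0" using h by (simp add: is_alg_hom_def is_homD)
  then have *: "fps_to_fls (map_fps h f) = map_fls h (fps_to_fls f)" for f
    by (intro fls_eqI) (simp add: map_fls_nth)
  show ?thesis
    by (simp add: * fps_to_fls_subst_affine[OF a] map_fls_subst_fls[OF h] flip: fps_to_fls_eq_iff)
qed

text \<open>Applied to substitutions on scalar Laurent series, which form a field: it computes the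
  images of the denominators in the R-matrices.\<close>

lemma is_hom_inverse:
  assumes "is_hom (h :: 'a::field \<Rightarrow> 'b::field)"
  shows "h (inverse x) = inverse (h x)" "h (x / y) = h x / h y" "h (x powi n) = h x powi n"
    "h x = 0 \<longleftrightarrow> x = 0" "h (numeral m) = numeral m"
proof -
  show inv: "h (inverse x) = inverse (h x)" for x
  proof (cases "x = 0")
    case False
    then have "h x * h (inverse x) = 1"
      by (simp add: is_homD(1)[OF assms] flip: is_homD(3)[OF assms])
    then show ?thesis by (metis inverse_unique)
  qed (simp add: is_homD(4)[OF assms])
  show "h (x / y) = h x / h y"
    by (simp add: divide_inverse inv is_homD(3)[OF assms])
  show "h (x powi n) = h x powi n"
    by (simp add: power_int_def inv is_homD(8)[OF assms])
  show "h x = 0 \<longleftrightarrow> x = 0"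
    by (metis inv assms is_homD(1,3,4) mult_zero_left right_inverse zero_neq_one)
  have "h (of_nat k) = of_nat k" for k
    by (induction k) (simp_all add: is_homD[OF assms])
  from this[of "numeral m"] show "h (numeral m) = numeral m" by simp
qed

lemma subst_fls_affine:
  assumes "a \<noteq> 0" "c \<noteq> 0"
  shows "subst_fls a b (affine c d) = affine (c * a) (c * b + d)"
proof -
  note h = is_homD[OF is_hom_subst_fls[OF assms(1)]]
  show ?thesis
    by (rule fls_eqI)
      (simp add: affine_def h subst_fls_X_inv[OF assms(1)] of_C_fls_def of_C_complex_def algebra_simps)
qed

text \<open>Coefficients of (c u + d)^-n after the substitution u -> a u + b. Composition of
  substitutions on arbitrary series reduces to this identity between scalar arrays.\<close>

lemma affine_coeff_comp:
  assumes "a \<noteq> 0" "c \<noteq> 0"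
  shows "(\<Sum>l=n..k. affine_coeff c d n l * affine_coeff a b l k)
    = affine_coeff (c * a) (c * b + d) n k"
proof -
  have "affine_coeff (c * a) (c * b + d) n k = fls_nth (subst_fls a b (affine c d powi (- n))) k"
    unfolding affine_coeff_def subst_fls_affine[OF assms, symmetric]
    by (simp add: is_hom_inverse(3)[OF is_hom_subst_fls[OF assms(1)]])
  also have "\<dots> = (\<Sum>l=n..k. affine_coeff c d n l * affine_coeff a b l k)"
    by (subst subst_fls_nth[of n])
      (auto simp: affine_coeff_eq_0[OF assms(2)] affine_coeff_def[symmetric] of_C_complex_def)
  finally show ?thesis by simp
qed

lemma subst_fls_comp:
  assumes "a \<noteq> 0" "c \<noteq> 0"
  shows "subst_fls a b (subst_fls c d f) = subst_fls (c * a) (c * b + d) f"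
proof (rule fls_eqI)
  fix k
  define N where "N = fls_subdegree f"
  have f0: "fls_nth f i = 0" if "i < N" for i using that by (simp add: N_def)
  have sf: "fls_nth (subst_fls a b f) l =
      (\<Sum>n=N..l. fls_nth f n * of_C (affine_coeff a b n l))" for a b l
    by (rule subst_fls_nth) (rule f0)
  have "fls_nth (subst_fls a b (subst_fls c d f)) k =
      (\<Sum>l=N..k. fls_nth (subst_fls c d f) l * of_C (affine_coeff a b l k))"
    by (rule subst_fls_nth) (auto intro: subst_fls_eq0_below f0)
  also have "\<dots> = (\<Sum>l=N..k. \<Sum>n=N..k. fls_nth f n *
      (of_C (affine_coeff c d n l) * of_C (affine_coeff a b l k)))"
    unfolding sf sum_distrib_right mult.assoc
    by (intro sum.cong refl sum.mono_neutral_left) (auto simp: affine_coeff_eq_0[OF assms(2)])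
  also have "\<dots> = (\<Sum>n=N..k. \<Sum>l=N..k. fls_nth f n *
      (of_C (affine_coeff c d n l) * of_C (affine_coeff a b l k)))"
    by (rule sum.swap)
  also have "\<dots> = (\<Sum>n=N..k. fls_nth f n * of_C (affine_coeff (c * a) (c * b + d) n k))"
  proof (intro sum.cong refl)
    fix n assume n: "n \<in> {N..k}"
    have "(\<Sum>l=N..k. fls_nth f n * (of_C (affine_coeff c d n l) * of_C (affine_coeff a b l k)))
       = fls_nth f n * of_C (\<Sum>l=N..k. affine_coeff c d n l * affine_coeff a b l k)"
      by (simp add: sum_distrib_left is_homD(3,7)[OF is_hom_of_C])
    also have "(\<Sum>l=N..k. affine_coeff c d n l * affine_coeff a b l k)
        = (\<Sum>l=n..k. affine_coeff c d n l * affine_coeff a b l k)"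
      using n by (intro sum.mono_neutral_right) (auto simp: affine_coeff_eq_0[OF assms(2)])
    finally show "(\<Sum>l=N..k. fls_nth f n * (of_C (affine_coeff c d n l) * of_C (affine_coeff a b l k)))
       = fls_nth f n * of_C (affine_coeff (c * a) (c * b + d) n k)"
      by (simp add: affine_coeff_comp[OF assms])
  qed
  also have "\<dots> = fls_nth (subst_fls (c * a) (c * b + d) f) k"
    by (rule sf[symmetric])
  finally show "fls_nth (subst_fls a b (subst_fls c d f)) k
      = fls_nth (subst_fls (c * a) (c * b + d) f) k" .
qed

lemma affine_coeff_id: "affine_coeff 1 0 n k = (if n = k then 1 else 0)"
proof -
  have "affine 1 0 = fls_X powi (-1)" unfolding fls_X_power_int
    by (rule fls_eqI) (auto simp: affine_nth)
  then have "affine 1 0 powi (- n) = fls_X powi n" by (metis mult_minus_left mult_1 minus_minus power_int_mult)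
  then show ?thesis by (simp add: affine_coeff_def)
qed

lemma subst_fls_id [simp]: "subst_fls 1 0 f = f"
  by (rule fls_eqI)
    (auto simp: subst_fls_nth[of "fls_subdegree f"] affine_coeff_id if_distrib if_distribR
      sum.delta' cong: if_cong)

lemma subst_affine_comp:
  "a \<noteq> 0 \<Longrightarrow> c \<noteq> 0 \<Longrightarrow>
    subst_affine a b (subst_affine c d f) = subst_affine (c * a) (c * b + d) f"
  by (simp add: fps_to_fls_subst_affine subst_fls_comp flip: fps_to_fls_eq_iff)

lemma subst_affine_id [simp]: "subst_affine 1 0 f = f"
  by (simp add: fps_to_fls_subst_affine flip: fps_to_fls_eq_iff)

lemma subst_affine_nth_0 [simp]: "a \<noteq> 0 \<Longrightarrow> fps_nth (subst_affine a b f) 0 = fps_nth f 0"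
  by (simp add: subst_affine_nth affine_coeff_0)

section \<open>Matrix identities over a noncommutative ring\<close>

definition central :: "'a::ring_1 \<Rightarrow> bool" where
  "central x \<longleftrightarrow> (\<forall>y. x * y = y * x)"

lemma centralD: "central x \<Longrightarrow> x * y = y * x"
  by (simp add: central_def)

lemma centralD3: "central x \<Longrightarrow> y * (x * z) = x * (y * z)"
  by (metis centralD mult.assoc)

lemma central_uminus: "central x \<Longrightarrow> central (- x)"
  by (simp add: central_def)

abbreviation smul :: "'a::ring_1 \<Rightarrow> 'a ^ 'n ^ 'm \<Rightarrow> 'a ^ 'n ^ 'm" where
  "smul c \<equiv> map_matrix ((*) c)"

lemma smul_mult_left: "smul c A ** B = smul c (A ** B)"
  by (simp add: vec_eq_iff matrix_matrix_mult_def sum_distrib_left mult.assoc)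

lemma smul_mult_right: "central c \<Longrightarrow> A ** smul c B = smul c (A ** B)"
  by (simp add: vec_eq_iff matrix_matrix_mult_def sum_distrib_left centralD3)

lemma smul_smul: "smul c (smul d A) = smul (c * d) A"
  by (simp add: vec_eq_iff mult.assoc)

lemma smul_1 [simp]: "smul 1 A = A"
  by (simp add: vec_eq_iff)

lemma smul_cancel: "e * c = 1 \<Longrightarrow> smul c A = smul c B \<Longrightarrow> A = B"
  by (metis smul_smul smul_1)

lemma mat_mult_entry2:
  "(A ** B :: 'a::ring_1 mat2) $ i $ j = A $ i $ Neg * B $ Neg $ j + A $ i $ Pos * B $ Pos $ j"
  by (simp add: matrix_matrix_mult_def UNIV_idx)

lemma mat_1_entry: "(mat 1 :: 'a::ring_1 ^ 'n ^ 'n) $ i $ j = (if i = j then 1 else 0)"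
  by (simp add: mat_def)

lemma factor1_entry: "factor1 A $ p $ q = (if snd p = snd q then A $ fst p $ fst q else 0)"
  by (simp add: factor1_def kron_def mat_def)

lemma factor2_entry: "factor2 A $ p $ q = (if fst p = fst q then A $ snd p $ snd q else 0)"
  by (simp add: factor2_def kron_def mat_def)

lemma Q_mat_entry:
  "Q_mat s $ p $ q = (if snd p = opp (fst p) \<and> snd q = opp (fst q) then theta s (snd p) (snd q) else 0)"
  by (cases "fst p"; cases "snd p"; cases "fst q"; cases "snd q")
    (simp_all add: Q_mat_def ptransp_def P_mat_entry)

lemma factor1_mult: "factor1 (A ** B) = factor1 A ** factor1 B"
  by (simp add: vec_eq_iff all_idx mat_mult_entry4 mat_mult_entry2 factor1_entry)

lemma factor2_mult: "factor2 (A ** B) = factor2 A ** factor2 B"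
  by (simp add: vec_eq_iff all_idx mat_mult_entry4 mat_mult_entry2 factor2_entry)

lemma mtransp_entry: "mtransp s A $ i $ j = theta s i j * A $ opp j $ opp i"
  by (simp add: mtransp_def)

text \<open>The type A R-matrix with 1/u replaced by a ring element, so that matrix identities are
  proved over any ring and specialised to 1/(u-v), 2/(u-v) and the like afterwards.\<close>

definition RP :: "'a::ring_1 \<Rightarrow> 'a mat4" where
  "RP c = mat 1 - smul c P_mat"

definition RQ :: "tsign \<Rightarrow> 'a::ring_1 \<Rightarrow> 'a mat4" where
  "RQ s c = mat 1 - smul c (Q_mat s)"

text \<open>
  For central \<open>c\<close>, \<open>rtt c A B\<close> states \<open>RP c A\<^sub>1 B\<^sub>2 = B\<^sub>2 A\<^sub>1 RP c\<close> and \<open>rtt_inv c A B\<close> states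
  \<open>A\<^sub>1 B\<^sub>2 RP (-c) = RP (-c) B\<^sub>2 A\<^sub>1\<close>.
\<close>

definition rtt :: "'a::ring_1 \<Rightarrow> 'a mat2 \<Rightarrow> 'a mat2 \<Rightarrow> bool" where
  "rtt c A B \<longleftrightarrow> (\<forall>i j k l. A $ i $ j * B $ k $ l - B $ k $ l * A $ i $ j =
     c * (A $ k $ j * B $ i $ l - B $ k $ j * A $ i $ l))"

definition rtt_inv :: "'a::ring_1 \<Rightarrow> 'a mat2 \<Rightarrow> 'a mat2 \<Rightarrow> bool" where
  "rtt_inv c A B \<longleftrightarrow> (\<forall>i j k l. A $ i $ j * B $ k $ l - B $ k $ l * A $ i $ j =
     c * (B $ i $ l * A $ k $ j - A $ i $ l * B $ k $ j))"

lemma rttD: "rtt c A B \<Longrightarrow> A $ i $ j * B $ k $ l - B $ k $ l * A $ i $ j =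
     c * (A $ k $ j * B $ i $ l - B $ k $ j * A $ i $ l)"
  by (simp add: rtt_def)

lemma rtt_invD: "rtt_inv c A B \<Longrightarrow> A $ i $ j * B $ k $ l - B $ k $ l * A $ i $ j =
     c * (B $ i $ l * A $ k $ j - A $ i $ l * B $ k $ j)"
  by (simp add: rtt_inv_def)

text \<open>\<open>RP c\<close> times \<open>RP (- c)\<close> is the scalar 1 - c^2, so the R-matrix
  can be moved to the other side once this is a unit. Entrywise: applying the relation twice shows
  that the defect \<open>D\<close> of the new form equals c^2 \<open>D\<close>.\<close>

lemma rtt_imp_rtt_inv:
  assumes r: "rtt c A B" and e: "e * (1 - c * c) = 1"
  shows "rtt_inv c A B"
  unfolding rtt_inv_def
proof (intro allI)
  fix i j k l
  define D where "D = A $ i $ j * B $ k $ l - B $ k $ l * A $ i $ j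
    - c * (B $ i $ l * A $ k $ j - A $ i $ l * B $ k $ j)"
  have "D = c * ((A $ k $ j * B $ i $ l - B $ i $ l * A $ k $ j)
      + (A $ i $ l * B $ k $ j - B $ k $ j * A $ i $ l))"
    unfolding D_def rttD[OF r, of i j k l] by (simp add: algebra_simps)
  also have "\<dots> = c * c * ((A $ i $ j * B $ k $ l - B $ k $ l * A $ i $ j)
      + (A $ k $ l * B $ i $ j - B $ i $ j * A $ k $ l))"
    unfolding rttD[OF r, of k j i l] rttD[OF r, of i l k j] by (simp add: algebra_simps)
  also have "\<dots> = c * c * D"
    unfolding D_def rttD[OF r, of k l i j] by (simp add: algebra_simps)
  finally have "(1 - c * c) * D = 0" by (simp add: algebra_simps)
  then have "e * (1 - c * c) * D = 0" by (simp only: mult.assoc mult_zero_right)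
  then show "A $ i $ j * B $ k $ l - B $ k $ l * A $ i $ j =
     c * (B $ i $ l * A $ k $ j - A $ i $ l * B $ k $ j)"
    using e by (simp add: D_def)
qed

lemma mat4_eqI:
  assumes "\<And>i k j l. (A :: 'a mat4) $ (i, k) $ (j, l) = B $ (i, k) $ (j, l)"
  shows "A = B"
  using assms by (simp add: vec_eq_iff)

lemma P_mat_mult: "(P_mat ** M :: 'a::ring_1 mat4) $ p $ q = M $ (snd p, fst p) $ q"
  by (cases p; cases q; rename_tac a b c d; case_tac a; case_tac b)
    (simp_all add: mat_mult_entry4 P_mat_entry)

lemma mult_P_mat: "(M ** P_mat :: 'a::ring_1 mat4) $ p $ q = M $ p $ (snd q, fst q)"
  by (cases p; cases q; rename_tac a b c d; case_tac c; case_tac d)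
    (simp_all add: mat_mult_entry4 P_mat_entry)

lemma factor12_entry: "(factor1 A ** factor2 B) $ p $ q = A $ fst p $ fst q * B $ snd p $ snd q"
  by (cases "fst p"; cases "snd p"; cases "fst q"; cases "snd q")
    (simp_all add: mat_mult_entry4 factor1_entry factor2_entry)

lemma factor21_entry: "(factor2 B ** factor1 A) $ p $ q = B $ snd p $ snd q * A $ fst p $ fst q"
  by (cases "fst p"; cases "snd p"; cases "fst q"; cases "snd q")
    (simp_all add: mat_mult_entry4 factor1_entry factor2_entry)

lemma matrix_diff_distrib:
  fixes A :: "'a::ring_1 ^ 'n ^ 'm"
  shows "A ** (B - C) = A ** B - A ** C" "(D - E) ** A = D ** A - E ** A"
  by (simp_all add: vec_eq_iff matrix_matrix_mult_def algebra_simps sum_subtractf)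

lemma RP_mult: "RP c ** M = M - smul c (P_mat ** M)"
  by (simp add: RP_def smul_mult_left matrix_diff_distrib)

lemma mult_RP: "central c \<Longrightarrow> M ** RP c = M - smul c (M ** P_mat)"
  by (simp add: RP_def matrix_diff_distrib flip: smul_mult_right)

lemma rtt_iff:
  assumes c: "central c"
  shows "RP c ** factor1 A ** factor2 B = factor2 B ** factor1 A ** RP c \<longleftrightarrow> rtt c A B"
proof -
  have "RP c ** factor1 A ** factor2 B = factor2 B ** factor1 A ** RP c \<longleftrightarrow>
    (\<forall>i k j l. A $ i $ j * B $ k $ l - c * (A $ k $ j * B $ i $ l) =
      B $ k $ l * A $ i $ j - c * (B $ k $ j * A $ i $ l))"
    unfolding matrix_mul_assoc[symmetric, of "RP c"] unfolding RP_mult mult_RP[OF c]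
    by (simp add: vec_eq_iff P_mat_mult mult_P_mat factor12_entry factor21_entry)
  also have "\<dots> \<longleftrightarrow> rtt c A B"
    unfolding rtt_def by (auto simp: algebra_simps)
  finally show ?thesis .
qed

lemma opp_opp [simp]: "opp (opp i) = i"
  by (cases i) auto

text \<open>Partial transposition of the RTT relation in the first factor. It reverses products in
  that factor only, so \<open>A\<close> crosses over to the other side of R, and P becomes
  Q.\<close>

lemma rtt_transp1:
  assumes c: "central c" and r: "rtt c A B"
  shows "factor1 (mtransp s A) ** RQ s c ** factor2 B = factor2 B ** RQ s c ** factor1 (mtransp s A)"
proof (rule mat4_eqI)
  fix i k j l
  show "(factor1 (mtransp s A) ** RQ s c ** factor2 B) $ (i, k) $ (j, l) =
        (factor2 B ** RQ s c ** factor1 (mtransp s A)) $ (i, k) $ (j, l)"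
    using rttD[OF r, of "opp j" "opp i" k l] centralD3[OF c] centralD[OF c]
    by (cases s; cases i; cases j; cases k; cases l)
      (simp_all add: mat_mult_entry4 RQ_def Q_mat_entry factor1_entry factor2_entry mtransp_entry
        mat_1_entry algebra_simps)
qed

text \<open>The same in the second factor. For the transposed \<open>B\<close> to end up outermost
  one has to start from the form of the relation with R next to \<open>B\<close> on the other side,
  hence \<open>rtt_inv\<close>.\<close>

lemma rtt_inv_transp2:
  assumes c: "central c" and r: "rtt_inv c A B"
  shows "factor1 A ** RQ s (- c) ** factor2 (mtransp s B) = factor2 (mtransp s B) ** RQ s (- c) ** factor1 A"
proof (rule mat4_eqI)
  fix i k j l
  show "(factor1 A ** RQ s (- c) ** factor2 (mtransp s B)) $ (i, k) $ (j, l) =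
        (factor2 (mtransp s B) ** RQ s (- c) ** factor1 A) $ (i, k) $ (j, l)"
    using rtt_invD[OF r, of i j "opp l" "opp k"] centralD3[OF c] centralD[OF c]
    by (cases s; cases i; cases j; cases k; cases l)
      (simp_all add: mat_mult_entry4 RQ_def Q_mat_entry factor1_entry factor2_entry mtransp_entry
        mat_1_entry algebra_simps)
qed

text \<open>Transposing both factors fixes P, so R itself survives and only the order of all
  products is reversed.\<close>

lemma rtt_inv_transp12:
  assumes c: "central c" and r: "rtt_inv c A B"
  shows "RP (- c) ** factor1 (mtransp s A) ** factor2 (mtransp s B) =
    factor2 (mtransp s B) ** factor1 (mtransp s A) ** RP (- c)"
proof -
  have "rtt (- c) (mtransp s A) (mtransp s B)"
    unfolding rtt_def
  proof (intro allI)
    fix i j k l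
    show "mtransp s A $ i $ j * mtransp s B $ k $ l - mtransp s B $ k $ l * mtransp s A $ i $ j =
       - c * (mtransp s A $ k $ j * mtransp s B $ i $ l - mtransp s B $ k $ j * mtransp s A $ i $ l)"
      using rtt_invD[OF r, of "opp j" "opp i" "opp l" "opp k"]
      by (cases s; cases i; cases j; cases k; cases l) (simp_all add: mtransp_entry algebra_simps)
  qed
  then show ?thesis using rtt_iff[OF central_uminus[OF c]] by blast
qed

text \<open>P Q = Q P, equal to Q for the sign \<open>Plus\<close> and to -Q for
  \<open>Minus\<close>.\<close>

lemma RP_RQ_commute:
  assumes "central c" "central d"
  shows "RP c ** RQ s d = RQ s d ** RP c"
  by (rule mat4_eqI, rename_tac i k j l, case_tac s; case_tac i; case_tac k; case_tac j; case_tac l)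
    (simp_all add: mat_mult_entry4 RQ_def RP_def Q_mat_entry P_mat_entry mat_1_entry
      centralD[OF assms(1)])

text \<open>
  With \<open>A = T(u)\<close>, \<open>B = T(v)\<close>, \<open>A' = T(-u)\<close>, \<open>B' = T(-v)\<close>, this is the derivation of the reflection
  equation for \<open>T(u) T(-u)\<^sup>t\<close> from the RTT relation.
\<close>

lemma reflection_of_rtt:
  fixes s :: tsign and A A' B B' :: "'a::ring_1 mat2"
  assumes c: "central c" "central d"
    and e: "e * (1 - c * c) = 1" "e' * (1 - d * d) = 1"
    and AB: "rtt c A B" and A'B: "rtt d A' B" and AB': "rtt (- d) A B'" and A'B': "rtt (- c) A' B'"
  defines "S \<equiv> A ** mtransp s A'" and "S' \<equiv> B ** mtransp s B'"
  shows "RP c ** factor1 S ** RQ s d ** factor2 S' = factor2 S' ** RQ s d ** factor1 S ** RP c"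
proof -
  define R R' where "R = RP c" and "R' = RQ s d"
  define A1 B2 A1' B2' where "A1 = factor1 A" and "B2 = factor2 B"
    and "A1' = factor1 (mtransp s A')" and "B2' = factor2 (mtransp s B')"
  have 1: "R ** A1 ** B2 = B2 ** A1 ** R"
    using rtt_iff[OF c(1)] AB by (simp add: R_def A1_def B2_def)
  have 2: "A1' ** R' ** B2 = B2 ** R' ** A1'"
    using rtt_transp1[OF c(2) A'B] by (simp add: R'_def A1'_def B2_def)
  have "rtt_inv (- d) A B'" by (rule rtt_imp_rtt_inv[OF AB', of e']) (simp add: e)
  from rtt_inv_transp2[OF central_uminus[OF c(2)] this]
  have 3: "A1 ** R' ** B2' = B2' ** R' ** A1" by (simp add: R'_def A1_def B2'_def)
  have "rtt_inv (- c) A' B'" by (rule rtt_imp_rtt_inv[OF A'B', of e]) (simp add: e)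
  from rtt_inv_transp12[OF central_uminus[OF c(1)] this]
  have 4: "R ** A1' ** B2' = B2' ** A1' ** R" by (simp add: R_def A1'_def B2'_def)
  have 5: "R ** R' = R' ** R" using RP_RQ_commute[OF c] by (simp add: R_def R'_def)
  have "R ** (A1 ** A1') ** R' ** (B2 ** B2') = R ** A1 ** (A1' ** R' ** B2) ** B2'"
    by (simp only: matrix_mul_assoc)
  also have "\<dots> = (R ** A1 ** B2) ** R' ** A1' ** B2'"
    unfolding 2 by (simp only: matrix_mul_assoc)
  also have "\<dots> = B2 ** A1 ** (R ** R') ** A1' ** B2'"
    unfolding 1 by (simp only: matrix_mul_assoc)
  also have "\<dots> = B2 ** A1 ** R' ** (R ** A1' ** B2')"
    unfolding 5 by (simp only: matrix_mul_assoc)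
  also have "\<dots> = B2 ** (A1 ** R' ** B2') ** A1' ** R"
    unfolding 4 by (simp only: matrix_mul_assoc)
  also have "\<dots> = (B2 ** B2') ** R' ** (A1 ** A1') ** R"
    unfolding 3 by (simp only: matrix_mul_assoc)
  finally show ?thesis
    by (simp add: S_def S'_def factor1_mult factor2_mult R_def R'_def A1_def A1'_def B2_def B2'_def)
qed

section \<open>Substitutions in two parameters\<close>

lemma of_C_uminus: "of_C (- c) = (- of_C c :: 'a::calgebra)"
  and of_C_diff: "of_C (c - d) = (of_C c - of_C d :: 'a::calgebra)"
  by (simp_all add: is_homD[OF is_hom_of_C])

lemma of_C_numeral [simp]: "of_C (numeral n) = (numeral n :: 'a::calgebra)"
proof -
  have "of_C (of_nat k) = (of_nat k :: 'a)" for k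
    by (induction k) (simp_all add: of_C_add)
  from this[of "numeral n"] show ?thesis by simp
qed

lemma central_of_C: "central (of_C c)"
  by (simp add: central_def of_C_central)

lemma central_fls:
  fixes f :: "'a::ring_1 fls"
  assumes "\<And>n. central (fls_nth f n)"
  shows "central f"
  unfolding central_def
proof (intro allI fls_eqI)
  fix g :: "'a fls" and n
  define a b where "a = fls_subdegree f" and "b = fls_subdegree g"
  have "fls_nth (f * g) n = (\<Sum>i=a..n-b. fls_nth f i * fls_nth g (n - i))"
    by (rule fls_times_nth_bound) (simp_all add: a_def b_def)
  also have "\<dots> = (\<Sum>j=b..n-a. fls_nth g j * fls_nth f (n - j))"
    by (rule sum.reindex_bij_witness[of _ "\<lambda>j. n - j" "\<lambda>j. n - j"]) (auto simp: centralD[OF assms])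
  also have "\<dots> = fls_nth (g * f) n"
    by (rule fls_times_nth_bound[symmetric]) (simp_all add: a_def b_def)
  finally show "fls_nth (f * g) n = fls_nth (g * f) n" .
qed

lemma central_lift1: "central (lift1 x)"
  by (rule central_fls) (simp add: map_fls_nth central_of_C)

lemma central_lift2: "central (lift2 x)"
  by (rule central_fls) (simp add: map_fls_nth is_homD[OF is_hom_map_fls[OF is_hom_of_C]] central_lift1)

lemma is_hom_lift1: "is_hom (lift1 :: complex fls \<Rightarrow> 'a::calgebra fls)"
  by (intro is_hom_map_fls is_hom_of_C)

lemma is_hom_lift2: "is_hom (lift2 :: complex fls fls \<Rightarrow> 'a::calgebra fls fls)"
  by (intro is_hom_map_fls is_hom_of_C)

lemma is_hom_comp: "is_hom f \<Longrightarrow> is_hom g \<Longrightarrow> is_hom (\<lambda>x. f (g x))"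
  by (simp add: is_hom_def)

lemma is_alg_hom_comp: "is_alg_hom f \<Longrightarrow> is_alg_hom g \<Longrightarrow> is_alg_hom (\<lambda>x. f (g x))"
  by (simp add: is_alg_hom_def is_hom_comp)

lemma is_alg_homD: "is_alg_hom f \<Longrightarrow> is_hom f" "is_alg_hom f \<Longrightarrow> f (of_C c) = of_C c"
  by (simp_all add: is_alg_hom_def)

lemma map_fls_comp:
  assumes "is_hom f" "is_hom g"
  shows "map_fls f (map_fls g x) = map_fls (\<lambda>y. f (g y)) x"
  by (rule fls_eqI) (simp add: map_fls_nth is_homD(4)[OF assms(1)] is_homD(4)[OF assms(2)])

lemma is_hom_fps_to_fls: "is_hom (fps_to_fls :: 'a::ring_1 fps \<Rightarrow> _)"
  by (simp add: is_hom_def fls_times_fps_to_fls)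

lemma is_hom_fls_const: "is_hom (fls_const :: 'a::ring_1 \<Rightarrow> _)"
  by (simp add: is_hom_def fls_plus_const fls_const_mult_const)

lemma is_hom_in_u: "is_hom (in_u :: 'a::ring_1 fps \<Rightarrow> _)"
  unfolding in_u_def
  using is_hom_comp[OF is_hom_map_fls[OF is_hom_fls_const] is_hom_fps_to_fls] .

lemma is_hom_in_v: "is_hom (in_v :: 'a::ring_1 fps \<Rightarrow> _)"
  unfolding in_v_def using is_hom_comp[OF is_hom_fls_const is_hom_fps_to_fls] .

text \<open>v is the inner variable, so its substitution acts on the coefficients and that of u on
  the outer series.\<close>

definition subst_uv :: "complex \<Rightarrow> complex \<Rightarrow> complex \<Rightarrow> complex \<Rightarrow> 'a::calgebra fls fls \<Rightarrow> 'a fls fls" where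
  "subst_uv a b c d x = subst_fls a b (map_fls (subst_fls c d) x)"

lemma is_hom_subst_uv: "a \<noteq> 0 \<Longrightarrow> c \<noteq> 0 \<Longrightarrow> is_hom (subst_uv a b c d)"
  unfolding subst_uv_def
  by (rule is_hom_comp) (simp_all add: is_hom_subst_fls is_hom_map_fls)

lemma subst_uv_in_u:
  assumes "a \<noteq> 0" "c \<noteq> 0"
  shows "subst_uv a b c d (in_u f) = in_u (subst_affine a b f)"
proof -
  have "map_fls (subst_fls c d) (in_u f) = in_u f"
    unfolding in_u_def
    by (simp add: map_fls_comp is_hom_subst_fls is_hom_fls_const assms)
  then show ?thesis
    by (simp add: subst_uv_def in_u_def fps_to_fls_subst_affine assms
        map_fls_subst_fls[OF is_alg_hom_fls_const])
qed

lemma subst_uv_in_v: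
  assumes "a \<noteq> 0" "c \<noteq> 0"
  shows "subst_uv a b c d (in_v f) = in_v (subst_affine c d f)"
  by (simp add: subst_uv_def in_v_def fps_to_fls_subst_affine assms map_fls_const
      is_homD(4)[OF is_hom_subst_fls])

lemma subst_uv_lift2:
  assumes "a \<noteq> 0" "c \<noteq> 0"
  shows "subst_uv a b c d (lift2 x) = (lift2 (subst_uv a b c d x) :: 'a::calgebra fls fls)"
proof -
  have *: "is_alg_hom (map_fls of_C :: complex fls \<Rightarrow> 'a fls)"
    by (intro is_alg_hom_map_fls is_alg_hom_of_C)
  have "map_fls (subst_fls c d) (lift2 x) = (lift2 (map_fls (subst_fls c d) x) :: 'a fls fls)"
    by (simp add: map_fls_comp is_hom_subst_fls assms is_hom_map_fls is_hom_of_C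
        map_fls_subst_fls[OF is_alg_hom_of_C])
  then show ?thesis
    by (simp add: subst_uv_def map_fls_subst_fls[OF *])
qed

lemma subst_uv_param:
  assumes "a \<noteq> 0" "c \<noteq> 0"
  shows "subst_uv a b c d param_u = of_C a * param_u + of_C b"
    and "subst_uv a b c d param_v = of_C c * param_v + of_C d"
proof -
  note h0 = is_homD(4)[OF is_hom_subst_fls[OF assms(2), of d]]
    and h1 = is_homD(1)[OF is_hom_subst_fls[OF assms(2), of d]]
  have "map_fls (subst_fls c d) param_u = param_u"
    by (rule fls_eqI) (auto simp: map_fls_nth param_u_def h0 h1)
  then show "subst_uv a b c d param_u = of_C a * param_u + of_C b"
    by (simp add: subst_uv_def param_u_def subst_fls_X_inv[OF assms(1)])
  show "subst_uv a b c d param_v = of_C c * param_v + of_C d"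
    by (simp add: subst_uv_def param_v_def map_fls_const h0 subst_fls_X_inv[OF assms(2)]
        of_C_fls_def fls_plus_const fls_const_mult_const)
qed

text \<open>The coefficient of u is \<open>a\<close>. All denominators of the two-parameter
  R-matrices are linear forms of this kind.\<close>

lemma linear_form_nonzero:
  assumes "a \<noteq> 0"
  shows "of_C a * param_u + of_C b * param_v + of_C c \<noteq> 0"
proof
  assume "of_C a * param_u + of_C b * param_v + of_C c = 0"
  then have "fls_nth (of_C a * param_u + of_C b * param_v + of_C c) (-1) = 0"
    by simp
  then have "fls_nth (fls_nth (of_C a * param_u + of_C b * param_v + of_C c) (-1)) 0 = 0"
    by simp
  moreover have "fls_nth (fls_nth (of_C a * param_u + of_C b * param_v + of_C c) (-1)) 0 = a"
    by (simp add: of_C_fls_def of_C_complex_def param_u_def param_v_def fls_const_mult_const)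
  ultimately show False using assms by simp
qed

lemma linear_form_neq:
  assumes "a \<noteq> 0"
  shows "of_C a * param_u + of_C b * param_v + of_C c \<noteq> of_C d"
proof -
  have "of_C a * param_u + of_C b * param_v + of_C c - of_C d \<noteq> 0"
    using linear_form_nonzero[OF assms, of b "c - d"] by (simp only: of_C_diff add_diff_eq) simp
  then show ?thesis by (simp only: right_minus_eq) simp
qed

lemma param_neq:
  "param_u - param_v \<noteq> of_C k" "param_u + param_v \<noteq> of_C k" "- param_u - param_v \<noteq> of_C k"
  using linear_form_neq[of 1 "-1" 0 k] linear_form_neq[of 1 1 0 k] linear_form_neq[of "-1" "-1" 0 k]
  by (simp_all add: of_C_uminus)

lemma param_neq_numeral:
  "param_u - param_v \<noteq> 0" "param_u - param_v \<noteq> 1" "param_u - param_v \<noteq> -1" "param_u - param_v \<noteq> 2"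
  "param_u + param_v \<noteq> 0" "param_u + param_v \<noteq> 1" "param_u + param_v \<noteq> 2"
  "- param_u - param_v \<noteq> 0" "- param_u - param_v \<noteq> 1" "- param_u - param_v \<noteq> -1"
  using param_neq[of 0] param_neq[of 1] param_neq[of 2] param_neq[of "-1"]
  by (simp_all add: of_C_uminus)

section \<open>The defining relations as series identities\<close>

lemma rtt_hom:
  assumes h: "is_hom h" and "rtt c A B"
  shows "rtt (h c) (map_matrix h A) (map_matrix h B)"
  unfolding rtt_def
proof (intro allI)
  fix i j k l
  from arg_cong[OF rttD[OF assms(2), of i j k l], of h]
  show "map_matrix h A $ i $ j * map_matrix h B $ k $ l - map_matrix h B $ k $ l * map_matrix h A $ i $ j
      = h c * (map_matrix h A $ k $ j * map_matrix h B $ i $ l - map_matrix h B $ k $ j * map_matrix h A $ i $ l)"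
    by (simp add: is_homD[OF h])
qed

lemma map_matrix_hom_simps:
  assumes "is_hom h"
  shows "map_matrix h (smul c A) = smul (h c) (map_matrix h A)"
    "map_matrix h (mtransp s B) = mtransp s (map_matrix h B)"
    "map_matrix h P_mat = P_mat" "map_matrix h (Q_mat s) = Q_mat s"
    "map_matrix h (G_mat q) = G_mat q"
proof -
  have th: "h (theta s i j) = theta s i j" for i j
    by (cases s; cases i; cases j) (simp_all add: is_homD[OF assms])
  show "map_matrix h (smul c A) = smul (h c) (map_matrix h A)"
    by (simp add: vec_eq_iff is_homD[OF assms])
  show "map_matrix h (mtransp s B) = mtransp s (map_matrix h B)"
    by (simp add: vec_eq_iff mtransp_def is_homD[OF assms] th)
  show "map_matrix h P_mat = P_mat" "map_matrix h (Q_mat s) = Q_mat s"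
    by (simp_all add: vec_eq_iff P_mat_entry Q_mat_entry is_homD[OF assms] th)
  show "map_matrix h (G_mat q) = G_mat q"
    by (cases q) (simp_all add: vec_eq_iff K_mat_def unit_mat_def mat_def is_homD[OF assms])
qed

lemma map_matrix_RP:
  assumes "is_hom h"
  shows "map_matrix h (RP c) = RP (h c)" "map_matrix h (RQ s c) = RQ s (h c)"
  by (simp_all add: RP_def RQ_def map_matrix_diff[OF assms] map_matrix_hom_simps[OF assms]
      map_matrix_mat_1[OF assms])

lemma R_gl_eq: "R_gl x = RP (1 / x)"
  by (simp add: R_gl_def RP_def vec_eq_iff)

lemma ptransp_R_gl_eq: "ptransp s (R_gl x) = RQ s (1 / x)"
proof (rule mat4_eqI)
  fix i k j l
  show "ptransp s (R_gl x) $ (i, k) $ (j, l) = RQ s (1 / x) $ (i, k) $ (j, l)"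
    by (cases s; cases i; cases j; cases k; cases l)
      (simp_all add: ptransp_def R_gl_def RQ_def Q_mat_entry P_mat_entry mat_1_entry)
qed

lemma Q_mat_Minus: "Q_mat Minus = mat 1 - P_mat"
proof (rule mat4_eqI)
  fix i k j l
  show "Q_mat Minus $ (i, k) $ (j, l) = (mat 1 - P_mat) $ (i, k) $ (j, l)"
    by (cases i; cases j; cases k; cases l) (simp_all add: Q_mat_entry P_mat_entry mat_1_entry)
qed

text \<open>In rank one \<open>P + Q\<^sup>- = I\<close>, so the symplectic R-matrix is a multiple of the one of type A.\<close>

lemma RP_entry:
  "RP c $ p $ q = (if p = q then 1 else 0) - c * (if fst p = snd q \<and> snd p = fst q then 1 else 0)"
  by (simp add: RP_def P_mat_entry mat_1_entry)

lemma RQ_Minus_entry: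
  "RQ Minus c $ p $ q = (if p = q then 1 - c else 0) + c * (if fst p = snd q \<and> snd p = fst q then 1 else 0)"
  by (simp add: RQ_def Q_mat_Minus P_mat_entry mat_1_entry algebra_simps)

text \<open>With Q = I - P the coefficient of I is (x-1)/(x-2) and that of P is -(1/x + 1/(x-2));
  their ratio is -2/x, which accounts for the doubling of the spectral parameter.\<close>

lemma R_sp_eq:
  assumes "x \<noteq> 0" "x \<noteq> 2"
  shows "R_sp x = smul ((x - 1) / (x - 2)) (RP (2 / x))"
proof -
  define c where "c = (x - 1) / (x - 2)"
  have c1: "1 + 1 / (x - 2) = c" and c2: "1 / x + 1 / (x - 2) = c * (2 / x)"
    using assms unfolding c_def by (simp_all add: divide_simps)
  have "R_sp x $ p $ q = (if p = q then 1 + 1 / (x - 2) else 0)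
      - (if fst p = snd q \<and> snd p = fst q then 1 / x + 1 / (x - 2) else 0)" for p q
    by (simp add: R_sp_def Q_mat_Minus P_mat_entry mat_1_entry diff_divide_distrib)
  then have "R_sp x $ p $ q = smul c (RP (2 / x)) $ p $ q" for p q
    unfolding c1 c2 nth_map_matrix RP_entry right_diff_distrib by simp
  then show ?thesis by (simp add: vec_eq_iff c_def)
qed

text \<open>I - (I - P)/x is a multiple of I + P/(x-1). At x = -u-v the new parameter is 1/(1+u+v),
  and this 1 is the origin of the shift by 1/2 in the isomorphisms.\<close>

lemma RQ_Minus_eq:
  assumes "x \<noteq> 0" "x \<noteq> 1"
  shows "RQ Minus (1 / x) = smul ((x - 1) / x) (RP (1 / (1 - x) :: 'k::field))"
proof -
  define c where "c = (x - 1) / x"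
  have c1: "1 - 1 / x = c" and c2: "1 / x = - (c * (1 / (1 - x)))"
    using assms unfolding c_def by (simp_all add: divide_simps)
  have "RQ Minus (1 / x) $ p $ q = smul c (RP (1 / (1 - x))) $ p $ q" for p q
    unfolding RQ_Minus_entry c1 nth_map_matrix RP_entry right_diff_distrib by (subst c2) simp
  then show ?thesis by (simp add: vec_eq_iff c_def)
qed

lemma lift2_inverse: "x \<noteq> 0 \<Longrightarrow> lift2 (inverse x) * lift2 x = 1"
  by (simp add: is_homD(1)[OF is_hom_lift2] flip: is_homD(3)[OF is_hom_lift2])

lemma smul_cancel_iff: "e * c = 1 \<Longrightarrow> smul c A = smul c B \<longleftrightarrow> A = B"
  by (metis smul_cancel)

lemma rtt_defect_gl:
  "rtt_defect (R_gl x) T = 0 \<longleftrightarrow> rtt (lift2 (1 / x)) (map_matrix in_u T) (map_matrix in_v T)"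
  unfolding rtt_defect_def Let_def right_minus_eq R_gl_eq map_matrix_RP[OF is_hom_lift2]
  by (rule rtt_iff[OF central_lift2])

text \<open>The scalar (x-1)/(x-2) is non-zero, hence invertible, and occurs once on each
  side.\<close>

lemma rtt_defect_sp:
  assumes "x \<noteq> 0" "x \<noteq> 1" "x \<noteq> 2"
  shows "rtt_defect (R_sp x) T = 0 \<longleftrightarrow> rtt (lift2 (2 / x)) (map_matrix in_u T) (map_matrix in_v T)"
proof -
  define c where "c = (x - 1) / (x - 2)"
  have c: "c \<noteq> 0" using assms by (simp add: c_def)
  show ?thesis
    unfolding rtt_defect_def Let_def right_minus_eq R_sp_eq[OF assms(1,3)] c_def[symmetric]
      map_matrix_hom_simps[OF is_hom_lift2] map_matrix_RP[OF is_hom_lift2]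
      smul_mult_left smul_mult_right[OF central_lift2] rtt_iff[OF central_lift2, symmetric]
    by (rule smul_cancel_iff[OF lift2_inverse[OF c]])
qed

lemma rtt_series_subst:
  assumes "a \<noteq> 0" "c \<noteq> 0"
    and "rtt (lift2 x) (map_matrix in_u T) (map_matrix in_v T)"
  shows "rtt (lift2 (subst_uv a b c d x)) (map_matrix in_u (msubst a b T)) (map_matrix in_v (msubst c d T))"
proof -
  have "map_matrix (subst_uv a b c d) (map_matrix in_u T) = map_matrix in_u (msubst a b T)"
    "map_matrix (subst_uv a b c d) (map_matrix in_v T) = map_matrix in_v (msubst c d T)"
    by (simp_all add: vec_eq_iff subst_uv_in_u subst_uv_in_v assms)
  then show ?thesis
    using rtt_hom[OF is_hom_subst_uv[OF assms(1,2), of b d] assms(3)]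
    by (simp add: subst_uv_lift2[OF assms(1,2)])
qed

lemmas subst_uv_arith = is_hom_inverse(2)[OF is_hom_subst_uv] is_homD(1,2,5,6)[OF is_hom_subst_uv]
  is_hom_inverse(5)[OF is_hom_subst_uv]

abbreviation RTT :: "'a::calgebra fps mat2 \<Rightarrow> bool" where
  "RTT T \<equiv> rtt_defect (R_gl (param_u - param_v)) T = 0"

abbreviation RTT_sp :: "'a::calgebra fps mat2 \<Rightarrow> bool" where
  "RTT_sp T \<equiv> rtt_defect (R_sp (param_u - param_v)) T = 0"

lemma RTT_shift:
  assumes "RTT T" "a \<noteq> 0"
  shows "rtt (lift2 (1 / (of_C a * (param_u - param_v)))) (map_matrix in_u (msubst a b T)) (map_matrix in_v (msubst a b T))"
proof -
  have "subst_uv a b a b (1 / (param_u - param_v)) = 1 / (of_C a * (param_u - param_v))"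
    by (simp add: subst_uv_arith subst_uv_param assms right_diff_distrib)
  then show ?thesis
    using rtt_series_subst[of a a "1 / (param_u - param_v)" T b b] assms by (simp add: rtt_defect_gl)
qed

lemma of_C_half: "of_C (1 / 2) = (1 / 2 :: complex fls fls)"
proof -
  have "2 * of_C (1 / 2) = (1 :: complex fls fls)"
    using of_C_mult[of 2 "1/2", where 'a = "complex fls fls"] by simp
  then show ?thesis by (simp add: field_simps)
qed

text \<open>Halving both parameters turns 1/(u-v) into 2/(u-v), the value that
  \<open>R_sp_eq\<close> asks for.\<close>

lemma RTT_sp_of_RTT:
  assumes "RTT T"
  shows "RTT_sp (msubst (1/2) 0 T)"
proof -
  have "1 / (of_C (1/2) * (param_u - param_v)) = 2 / (param_u - param_v)"
    by (simp add: of_C_half)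
  then show ?thesis
    unfolding rtt_defect_sp[OF param_neq_numeral(1,2,4)]
    using RTT_shift[OF assms, of "1/2" 0] by simp
qed

text \<open>The third denominator is 1 + u + v in the form in which \<open>RQ_Minus_eq\<close>
  produces it at x = -u-v.\<close>

lemma subst_uv_linear:
  assumes "a \<noteq> 0"
  shows "subst_uv a b a b (x / (param_u - param_v)) =
      subst_uv a b a b x / (of_C a * (param_u - param_v))"
    and "subst_uv a b a b (x / (param_u + param_v)) =
      subst_uv a b a b x / (of_C a * (param_u + param_v) + of_C (2 * b))"
    and "subst_uv a b a b (x / (1 - (- param_u - param_v))) =
      subst_uv a b a b x / (of_C a * (param_u + param_v) + of_C (2 * b + 1))"
proof -
  let ?h = "subst_uv a b a b"
  note hom = is_hom_subst_uv[OF assms assms, of b b]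
  note p = subst_uv_param[OF assms assms, of b b]
  have 1: "?h (param_u - param_v) = of_C a * (param_u - param_v)"
    unfolding is_homD(5)[OF hom] p by algebra
  have 2: "?h (param_u + param_v) = of_C a * (param_u + param_v) + of_C (2 * b)"
    unfolding is_homD(2)[OF hom] p mult_2 of_C_add by algebra
  have 3: "?h (1 - (- param_u - param_v)) = of_C a * (param_u + param_v) + of_C (2 * b + 1)"
    unfolding is_homD(1,5,6)[OF hom] p mult_2 of_C_add of_C_1 by algebra
  show "?h (x / (param_u - param_v)) = ?h x / (of_C a * (param_u - param_v))"
    "?h (x / (param_u + param_v)) = ?h x / (of_C a * (param_u + param_v) + of_C (2 * b))"
    "?h (x / (1 - (- param_u - param_v))) = ?h x / (of_C a * (param_u + param_v) + of_C (2 * b + 1))"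
    unfolding is_hom_inverse(2)[OF hom] 1 2 3 by (rule refl)+
qed

lemma cancel_two: "2 / (2 * x) = 1 / (x :: complex fls fls)" "1 / (1 / 2 * x) = 2 / x"
  by simp_all

lemma RTT_of_RTT_sp:
  assumes "RTT_sp T"
  shows "RTT (msubst 2 0 T)"
proof -
  have two: "2 \<noteq> (0 :: complex)" by simp
  from assms have "rtt (lift2 (2 / (param_u - param_v))) (map_matrix in_u T) (map_matrix in_v T)"
    by (simp only: rtt_defect_sp[OF param_neq_numeral(1,2,4)])
  from rtt_series_subst[OF _ _ this, of 2 2 0 0]
  have "rtt (lift2 (subst_uv 2 0 2 0 (2 / (param_u - param_v)))) (map_matrix in_u (msubst 2 0 T)) (map_matrix in_v (msubst 2 0 T))"
    by simp
  moreover have "subst_uv 2 0 2 0 (2 / (param_u - param_v)) = 1 / (param_u - param_v)"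
    by (simp only: subst_uv_linear[OF two] is_hom_inverse(5)[OF is_hom_subst_uv[OF two two]]
        of_C_numeral cancel_two)
  ultimately show ?thesis by (simp add: rtt_defect_gl)
qed

lemma RTT_translate: "RTT T \<Longrightarrow> RTT (msubst 1 b T)"
  using RTT_shift[of T 1 b] by (simp add: rtt_defect_gl)

section \<open>The reflection equation\<close>

text \<open>Common normal form of all the reflection equations: each R-matrix is brought to the
  shape \<open>RP\<close>, and the types differ only in the parameters \<open>c\<close> and
  \<open>d\<close>.\<close>

definition refl3 :: "'a::ring_1 \<Rightarrow> 'a \<Rightarrow> 'a mat2 \<Rightarrow> 'a mat2 \<Rightarrow> bool" where
  "refl3 c d A B \<longleftrightarrow> RP c ** factor1 A ** RP d ** factor2 B = factor2 B ** RP d ** factor1 A ** RP c"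

lemma refl3_hom:
  assumes h: "is_hom h" and "refl3 c d A B"
  shows "refl3 (h c) (h d) (map_matrix h A) (map_matrix h B)"
  using arg_cong[OF assms(2)[unfolded refl3_def], of "map_matrix h"]
  by (simp add: refl3_def map_matrix_mult[OF h] map_matrix_RP[OF h] map_matrix_factor[OF h])

lemma refl_defect_sp:
  assumes "x \<noteq> 0" "x \<noteq> 1" "x \<noteq> 2" "y \<noteq> 0" "y \<noteq> 1" "y \<noteq> 2"
  shows "refl_defect (R_sp x) (R_sp y) S = 0 \<longleftrightarrow>
    refl3 (lift2 (2 / x)) (lift2 (2 / y)) (map_matrix in_u S) (map_matrix in_v S)"
proof -
  define c d where "c = (x - 1) / (x - 2)" and "d = (y - 1) / (y - 2)"
  have c: "c * d \<noteq> 0" using assms by (simp add: c_def d_def)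
  have dc: "d * c = c * d" by (rule mult.commute)
  show ?thesis
    unfolding refl_defect_def Let_def right_minus_eq R_sp_eq[OF assms(1,3)] R_sp_eq[OF assms(4,6)]
      c_def[symmetric] d_def[symmetric] refl3_def
      map_matrix_hom_simps[OF is_hom_lift2] map_matrix_RP[OF is_hom_lift2]
      smul_mult_left smul_mult_right[OF central_lift2] smul_smul is_homD(3)[OF is_hom_lift2, symmetric] dc
    by (rule smul_cancel_iff[OF lift2_inverse[OF c]])
qed

lemma refl_defect_gl:
  "refl_defect (R_gl x) (ptransp s (R_gl z)) S = 0 \<longleftrightarrow>
    RP (lift2 (1 / x)) ** factor1 (map_matrix in_u S) ** RQ s (lift2 (1 / z)) ** factor2 (map_matrix in_v S)
    = factor2 (map_matrix in_v S) ** RQ s (lift2 (1 / z)) ** factor1 (map_matrix in_u S) ** RP (lift2 (1 / x))"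
  unfolding refl_defect_def Let_def right_minus_eq R_gl_eq[of x] ptransp_R_gl_eq
    map_matrix_RP[OF is_hom_lift2] ..

fun pair_sign :: "sym_pair \<Rightarrow> tsign" where
  "pair_sign SP2_SP2 = Minus"
| "pair_sign SP2_GL1 = Plus"

lemma K_mat_entry: "K_mat $ i $ j = (if i = j then sgn_idx i else 0)"
  by (cases i; cases j) (simp_all add: K_mat_def unit_mat_def)

lemma K_mat_sq [simp]: "K_mat ** K_mat = mat 1"
  by (simp add: vec_eq_iff all_idx mat_mult_entry2 K_mat_entry mat_1_entry)

lemma G_mat_sq [simp]: "G_mat q ** G_mat q = mat 1"
  by (cases q) simp_all

lemma matrix_cancel_right:
  fixes A B :: "'a::ring_1 ^ 'n ^ 'm"
  shows "M ** M = mat 1 \<Longrightarrow> A ** M = B ** M \<longleftrightarrow> A = B"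
  by (metis matrix_mul_assoc matrix_mul_rid)

text \<open>Conjugation by K in a single tensor factor exchanges the two matrices Q; this is the
  rule K A^t = A^t' K for the two transpositions, at the level of R-matrices.\<close>

lemma RQ_G_mat:
  "factor1 (G_mat q) ** RQ Minus d = RQ (pair_sign q) d ** factor1 (G_mat q)"
  "factor2 (G_mat q) ** RQ Minus d = RQ (pair_sign q) d ** factor2 (G_mat q)"
proof -
  have "factor1 K_mat ** RQ Minus d = RQ Plus d ** factor1 K_mat"
    "factor2 K_mat ** RQ Minus d = RQ Plus d ** factor2 K_mat"
    by (rule mat4_eqI, rename_tac i k j l, case_tac i; case_tac k; case_tac j; case_tac l,
      simp_all add: mat_mult_entry4 RQ_def Q_mat_entry factor1_entry factor2_entry K_mat_entry mat_1_entry)+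
  then show "factor1 (G_mat q) ** RQ Minus d = RQ (pair_sign q) d ** factor1 (G_mat q)"
    "factor2 (G_mat q) ** RQ Minus d = RQ (pair_sign q) d ** factor2 (G_mat q)"
    by (cases q; simp add: factor_1)+
qed

lemma factor_G_commute:
  fixes B :: "'a::ring_1 mat2"
  shows
  "factor1 (G_mat q) ** factor2 B = factor2 B ** factor1 (G_mat q)"
  "factor2 (G_mat q) ** factor1 B = factor1 B ** factor2 (G_mat q)"
proof -
  have K: "sgn_idx i * x = x * sgn_idx i" for i and x :: 'a by (cases i) simp_all
  show "factor1 (G_mat q) ** factor2 B = factor2 B ** factor1 (G_mat q)"
    "factor2 (G_mat q) ** factor1 B = factor1 B ** factor2 (G_mat q)"
    by (cases q; simp add: factor_1;
      simp add: vec_eq_iff factor12_entry factor21_entry K_mat_entry K)+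
qed

lemma factor_G_RP:
  "factor1 (G_mat q) ** factor2 (G_mat q) ** RP c = RP c ** factor1 (G_mat q) ** factor2 (G_mat q)"
proof -
  have "factor1 K_mat ** factor2 K_mat ** RP c = RP c ** factor1 K_mat ** factor2 K_mat"
    by (rule mat4_eqI, rename_tac i k j l, case_tac i; case_tac k; case_tac j; case_tac l)
      (simp_all add: mat_mult_entry4 RP_def P_mat_entry factor1_entry factor2_entry K_mat_entry mat_1_entry)
  then show ?thesis by (cases q) (simp_all add: factor_1)
qed

text \<open>The equation is multiplied on the right by the involution \<open>G\<close> =
  \<open>G_1 G_2\<close>. One of its factors changes the sign type of Q when it crosses
  \<open>RQ\<close>, and the product commutes with \<open>RP c\<close>.\<close>

lemma refl_twist:
  "RP c ** factor1 A ** RQ (pair_sign q) d ** factor2 B = factor2 B ** RQ (pair_sign q) d ** factor1 A ** RP c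
   \<longleftrightarrow> RP c ** factor1 (A ** G_mat q) ** RQ Minus d ** factor2 (B ** G_mat q)
     = factor2 (B ** G_mat q) ** RQ Minus d ** factor1 (A ** G_mat q) ** RP c"
proof -
  define G where "G = factor1 (G_mat q) ** factor2 (G_mat q :: 'a mat2)"
  have GG: "G ** G = mat 1"
  proof -
    have "G ** G = factor1 (G_mat q) ** (factor2 (G_mat q) ** factor1 (G_mat q)) ** factor2 (G_mat q)"
      by (simp only: G_def matrix_mul_assoc)
    also have "\<dots> = factor1 (G_mat q ** G_mat q) ** factor2 (G_mat q ** G_mat q)"
      by (simp only: factor_G_commute(2)[of q "G_mat q"] factor1_mult factor2_mult matrix_mul_assoc)
    finally show ?thesis by (simp add: factor_1)
  qed
  have L: "RP c ** factor1 (A ** G_mat q) ** RQ Minus d ** factor2 (B ** G_mat q)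
     = (RP c ** factor1 A ** RQ (pair_sign q) d ** factor2 B) ** G"
  proof -
    have "RP c ** factor1 (A ** G_mat q) ** RQ Minus d ** factor2 (B ** G_mat q)
       = RP c ** factor1 A ** (factor1 (G_mat q) ** RQ Minus d) ** factor2 B ** factor2 (G_mat q)"
      by (simp only: factor1_mult factor2_mult matrix_mul_assoc)
    also have "\<dots> = RP c ** factor1 A ** RQ (pair_sign q) d ** (factor1 (G_mat q) ** factor2 B) ** factor2 (G_mat q)"
      unfolding RQ_G_mat by (simp only: matrix_mul_assoc)
    also have "\<dots> = (RP c ** factor1 A ** RQ (pair_sign q) d ** factor2 B) ** G"
      unfolding factor_G_commute(1)[of q B] G_def by (simp only: matrix_mul_assoc)
    finally show ?thesis .
  qed
  have R: "factor2 (B ** G_mat q) ** RQ Minus d ** factor1 (A ** G_mat q) ** RP c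
     = (factor2 B ** RQ (pair_sign q) d ** factor1 A ** RP c) ** G"
  proof -
    have "factor2 (B ** G_mat q) ** RQ Minus d ** factor1 (A ** G_mat q) ** RP c
       = factor2 B ** (factor2 (G_mat q) ** RQ Minus d) ** factor1 A ** factor1 (G_mat q) ** RP c"
      by (simp only: factor1_mult factor2_mult matrix_mul_assoc)
    also have "\<dots> = factor2 B ** RQ (pair_sign q) d ** (factor2 (G_mat q) ** factor1 A) ** factor1 (G_mat q) ** RP c"
      unfolding RQ_G_mat by (simp only: matrix_mul_assoc)
    also have "\<dots> = factor2 B ** RQ (pair_sign q) d ** factor1 A ** (factor2 (G_mat q) ** factor1 (G_mat q)) ** RP c"
      unfolding factor_G_commute(2)[of q A] by (simp only: matrix_mul_assoc)
    also have "\<dots> = factor2 B ** RQ (pair_sign q) d ** factor1 A ** (factor1 (G_mat q) ** factor2 (G_mat q) ** RP c)"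
      unfolding factor_G_commute(1)[symmetric] by (simp only: matrix_mul_assoc)
    also have "\<dots> = (factor2 B ** RQ (pair_sign q) d ** factor1 A ** RP c) ** G"
      unfolding factor_G_RP G_def by (simp only: matrix_mul_assoc)
    finally show ?thesis .
  qed
  show ?thesis unfolding L R by (rule matrix_cancel_right[OF GG, symmetric])
qed

lemma refl_defect_gl_iff_refl3:
  assumes "z \<noteq> 0" "z \<noteq> 1"
  shows "refl_defect (R_gl x) (ptransp (pair_sign q) (R_gl z)) S = 0 \<longleftrightarrow>
    refl3 (lift2 (1 / x)) (lift2 (1 / (1 - z)))
      (map_matrix in_u (S ** G_mat q)) (map_matrix in_v (S ** G_mat q))"
proof -
  define c where "c = (z - 1) / z"
  have c: "c \<noteq> 0" using assms by (simp add: c_def)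
  have RQ: "RQ Minus (lift2 (1 / z)) = smul (lift2 c) (RP (lift2 (1 / (1 - z))))"
    using arg_cong[OF RQ_Minus_eq[OF assms], of "map_matrix lift2"]
    by (simp add: map_matrix_hom_simps[OF is_hom_lift2] map_matrix_RP[OF is_hom_lift2] c_def)
  show ?thesis
    unfolding refl_defect_gl refl_twist refl3_def RQ
      map_matrix_mult[OF is_hom_in_u] map_matrix_mult[OF is_hom_in_v]
      map_matrix_hom_simps[OF is_hom_in_u] map_matrix_hom_simps[OF is_hom_in_v]
      smul_mult_left smul_mult_right[OF central_lift2]
    by (rule smul_cancel_iff[OF lift2_inverse[OF c]])
qed

lemma refl3_subst:
  assumes "a \<noteq> 0"
    and "refl3 (lift2 x) (lift2 y) (map_matrix in_u S) (map_matrix in_v S)"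
  shows "refl3 (lift2 (subst_uv a b a b x)) (lift2 (subst_uv a b a b y))
    (map_matrix in_u (msubst a b S)) (map_matrix in_v (msubst a b S))"
proof -
  have "map_matrix (subst_uv a b a b) (map_matrix in_u S) = map_matrix in_u (msubst a b S)"
    "map_matrix (subst_uv a b a b) (map_matrix in_v S) = map_matrix in_v (msubst a b S)"
    by (simp_all add: vec_eq_iff subst_uv_in_u subst_uv_in_v assms)
  then show ?thesis
    using refl3_hom[OF is_hom_subst_uv[OF assms(1,1), of b b] assms(2)]
    by (simp add: subst_uv_lift2[OF assms(1,1)])
qed

abbreviation REFL_sp :: "'a::calgebra fps mat2 \<Rightarrow> bool" where
  "REFL_sp S \<equiv> refl_defect (R_sp (param_u - param_v)) (R_sp (param_u + param_v)) S = 0"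

abbreviation REFL_gl :: "tsign \<Rightarrow> 'a::calgebra fps mat2 \<Rightarrow> bool" where
  "REFL_gl s S \<equiv> refl_defect (R_gl (param_u - param_v)) (ptransp s (R_gl (- param_u - param_v))) S = 0"

lemma msubst_mult_G:
  "a \<noteq> 0 \<Longrightarrow> msubst a b (S ** G_mat q) = msubst a b S ** G_mat q"
  by (simp add: map_matrix_mult[OF is_hom_subst_affine] map_matrix_hom_simps[OF is_hom_subst_affine])

lemma REFL_sp_of_REFL_gl:
  assumes "REFL_gl (pair_sign q) S"
  shows "REFL_sp (msubst (1/2) (-1/2) S ** G_mat q)"
proof -
  have half: "1 / 2 \<noteq> (0 :: complex)" by simp
  note h1 = is_homD(1)[OF is_hom_subst_uv[OF half half]]
  have 1: "subst_uv (1/2) (-1/2) (1/2) (-1/2) (1 / (param_u - param_v)) = 2 / (param_u - param_v)"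
    by (simp only: subst_uv_linear[OF half] h1 of_C_half cancel_two)
  \<comment> \<open>This cancellation fixes the translation: u -> (u-1)/2 takes 1 + u + v to (u+v)/2
    without a constant.\<close>
  have b: "2 * (- 1 / 2) + 1 = (0 :: complex)" by simp
  have 2: "subst_uv (1/2) (-1/2) (1/2) (-1/2) (1 / (1 - (- param_u - param_v))) = 2 / (param_u + param_v)"
    by (simp only: subst_uv_linear[OF half] b h1 of_C_half of_C_0 add_0_right cancel_two)
  from assms have "refl3 (lift2 (1 / (param_u - param_v))) (lift2 (1 / (1 - (- param_u - param_v))))
      (map_matrix in_u (S ** G_mat q)) (map_matrix in_v (S ** G_mat q))"
    by (simp only: refl_defect_gl_iff_refl3[OF param_neq_numeral(8,9)])
  from refl3_subst[OF half this, of "-1/2"] show ?thesis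
    unfolding 1 2 by (simp add: refl_defect_sp[OF param_neq_numeral(1,2,4-7)] msubst_mult_G)
qed

lemma REFL_gl_of_REFL_sp:
  assumes "REFL_sp S"
  shows "REFL_gl (pair_sign q) (msubst 2 1 S ** G_mat q)"
proof -
  have two: "2 \<noteq> (0 :: complex)" by simp
  note h2 = is_hom_inverse(5)[OF is_hom_subst_uv[OF two two]]
  have 1: "subst_uv 2 1 2 1 (2 / (param_u - param_v)) = 1 / (param_u - param_v)"
    by (simp only: subst_uv_linear[OF two] h2 of_C_numeral cancel_two)
  have "2 * (param_u + param_v) + 2 = 2 * (1 - (- param_u - param_v))" by algebra
  \<comment> \<open>Conversely 2u+1 and 2v+1 add up to twice 1 + u + v.\<close>
  then have 2: "subst_uv 2 1 2 1 (2 / (param_u + param_v)) = 1 / (1 - (- param_u - param_v))"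
    by (simp only: subst_uv_linear[OF two] h2 of_C_numeral mult_1_right cancel_two)
  from assms have "refl3 (lift2 (2 / (param_u - param_v))) (lift2 (2 / (param_u + param_v)))
      (map_matrix in_u S) (map_matrix in_v S)"
    by (simp only: refl_defect_sp[OF param_neq_numeral(1,2,4-7)])
  from refl3_subst[OF two this, of 1] show ?thesis
    unfolding 1 2
    by (simp add: refl_defect_gl_iff_refl3[OF param_neq_numeral(8,9)] flip: matrix_mul_assoc)
qed

lemma lift2_unit:
  assumes "x \<noteq> 0" "x \<noteq> 1" "x \<noteq> -1"
  shows "\<exists>e :: 'a::calgebra fls fls. e * (1 - lift2 (1 / x) * lift2 (1 / x)) = 1"
proof -
  have "1 - 1 / x * (1 / x) \<noteq> 0"
    using assms by (simp add: field_simps) (metis power2_eq_1_iff power2_eq_square)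
  from lift2_inverse[OF this]
  have "lift2 (inverse (1 - 1 / x * (1 / x))) * (1 - lift2 (1 / x) * lift2 (1 / x) :: 'a fls fls) = 1"
    by (simp only: is_homD(1,3,5)[OF is_hom_lift2])
  then show ?thesis by blast
qed

text \<open>The RTT relation is used at (u, v), (-u, v), (u, -v) and (-u, -v); its parameter is
  there c, d, -d and -c, where c = 1/(u-v) and d = 1/(-u-v).\<close>

lemma REFL_gl_S_gl:
  fixes T :: "'a::calgebra fps mat2"
  assumes "RTT T"
  shows "REFL_gl s (S_gl s T)"
proof -
  let ?u = "param_u" and ?v = "param_v"
  let ?T' = "msubst (-1) 0 T"
  let ?c = "lift2 (1 / (?u - ?v)) :: 'a fls fls"
    and ?d = "lift2 (1 / (- ?u - ?v)) :: 'a fls fls"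
  obtain e where e: "e * (1 - ?c * ?c) = 1"
    using lift2_unit[OF param_neq_numeral(1-3)] by blast
  obtain e' where e': "e' * (1 - ?d * ?d) = 1"
    using lift2_unit[OF param_neq_numeral(8-10)] by blast
  from assms have r: "rtt ?c (map_matrix in_u T) (map_matrix in_v T)"
    by (simp add: rtt_defect_gl)
  have neg: "1 / (- x) = - (1 / x)" for x :: "complex fls fls" by simp
  have id: "msubst 1 0 T = T" by (simp add: vec_eq_iff)
  have A'B: "rtt ?d (map_matrix in_u ?T') (map_matrix in_v T)"
    using rtt_series_subst[OF _ _ r, of "-1" 1 0 0]
    by (simp add: subst_uv_arith subst_uv_param of_C_uminus id)
  have AB': "rtt (- ?d) (map_matrix in_u T) (map_matrix in_v ?T')"
  proof -
    have "subst_uv 1 0 (-1) 0 (1 / (?u - ?v)) = - (1 / (- ?u - ?v))"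
      unfolding neg[symmetric] by (simp add: subst_uv_arith subst_uv_param of_C_uminus)
    then show ?thesis
      using rtt_series_subst[OF _ _ r, of 1 "-1" 0 0] by (simp add: id is_homD[OF is_hom_lift2])
  qed
  have A'B': "rtt (- ?c) (map_matrix in_u ?T') (map_matrix in_v ?T')"
  proof -
    have "subst_uv (-1) 0 (-1) 0 (1 / (?u - ?v)) = - (1 / (?u - ?v))"
      unfolding neg[symmetric] by (simp add: subst_uv_arith subst_uv_param of_C_uminus)
    then show ?thesis
      using rtt_series_subst[OF _ _ r, of "-1" "-1" 0 0] by (simp add: is_homD[OF is_hom_lift2])
  qed
  show ?thesis
    unfolding refl_defect_gl S_gl_def map_matrix_mult[OF is_hom_in_u] map_matrix_mult[OF is_hom_in_v]
      map_matrix_hom_simps[OF is_hom_in_u] map_matrix_hom_simps[OF is_hom_in_v]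
    by (rule reflection_of_rtt[OF central_lift2 central_lift2 e e' r A'B AB' A'B'])
qed

section \<open>Homomorphisms from presented algebras\<close>

fun word_prod :: "('g \<Rightarrow> 'a::monoid_mult) \<Rightarrow> 'g free_word \<Rightarrow> 'a" where
  "word_prod \<gamma> (Word xs) = prod_list (map \<gamma> xs)"

lemma word_prod_plus: "word_prod \<gamma> (v + w) = word_prod \<gamma> v * word_prod \<gamma> w"
  by (cases v; cases w) simp

definition free_ext :: "(generator \<Rightarrow> 'a::calgebra) \<Rightarrow> free_alg \<Rightarrow> 'a" where
  "free_ext \<gamma> x = (\<Sum>w\<in>Poly_Mapping.keys x. of_C (Poly_Mapping.lookup x w) * word_prod \<gamma> w)"

lemma free_ext_superset:
  assumes "finite S" "Poly_Mapping.keys x \<subseteq> S"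
  shows "free_ext \<gamma> x = (\<Sum>w\<in>S. of_C (Poly_Mapping.lookup x w) * word_prod \<gamma> w)"
  unfolding free_ext_def using assms
  by (intro sum.mono_neutral_left) (auto simp: in_keys_iff)

lemma free_ext_add: "free_ext \<gamma> (x + y) = free_ext \<gamma> x + free_ext \<gamma> y"
proof -
  let ?S = "Poly_Mapping.keys x \<union> Poly_Mapping.keys y"
  have "finite ?S" by simp
  note ext = free_ext_superset[OF this]
  show ?thesis
    by (simp add: ext[of "x + y"] ext[of x] ext[of y] Poly_Mapping.keys_add lookup_add of_C_add
        distrib_right sum.distrib)
qed

lemma free_ext_single: "free_ext \<gamma> (Poly_Mapping.single w c) = of_C c * word_prod \<gamma> w"
  by (cases "c = 0") (simp_all add: free_ext_def)

lemma poly_mapping_add_single_induct [case_names zero add]: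
  assumes "P 0" "\<And>f k v. P f \<Longrightarrow> P (f + Poly_Mapping.single k v)"
  shows "P (x :: 'k \<Rightarrow>\<^sub>0 'v::monoid_add)"
proof (induction x rule: update_induct)
  case const
  show ?case by (rule assms)
next
  case (update f k v)
  have "Poly_Mapping.update k v f = f + Poly_Mapping.single k v"
    using update(1) by (intro poly_mapping_eqI)
      (auto simp: lookup_add lookup_single lookup_update in_keys_iff when_def)
  then show ?case using assms(2)[OF update(3)] by simp
qed

lemma free_ext_0: "free_ext \<gamma> 0 = 0"
  by (simp add: free_ext_def)

lemma free_ext_mult: "free_ext \<gamma> (x * y) = free_ext \<gamma> x * free_ext \<gamma> y"
proof (induction x rule: poly_mapping_add_single_induct)
  case (add f k v)
  have "free_ext \<gamma> (Poly_Mapping.single k v * y) = free_ext \<gamma> (Poly_Mapping.single k v) * free_ext \<gamma> y"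
  proof (induction y rule: poly_mapping_add_single_induct)
    case (add f' k' v')
    have "of_C v * of_C v' * (word_prod \<gamma> k * word_prod \<gamma> k')
        = of_C v * word_prod \<gamma> k * (of_C v' * word_prod \<gamma> k')"
      by (metis mult.assoc of_C_central)
    with add show ?case
      by (simp add: distrib_left free_ext_add mult_single free_ext_single word_prod_plus of_C_mult)
  qed (simp add: free_ext_0)
  with add show ?case by (simp add: distrib_right free_ext_add)
qed (simp add: free_ext_0)

lemma word_prod_0: "word_prod \<gamma> 0 = 1"
  by (simp add: zero_free_word_def)

lemma free_ext_of_C: "free_ext \<gamma> (of_C c) = of_C c"
  by (simp add: of_C_poly_mapping_def of_C_complex_def free_ext_single word_prod_0)

lemma is_alg_hom_free_ext: "is_alg_hom (free_ext \<gamma>)"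
  using free_ext_of_C[of \<gamma> 1]
  by (simp add: is_alg_hom_def is_hom_def free_ext_add free_ext_mult free_ext_of_C)

lemma free_ext_gen: "free_ext \<gamma> (free_gen g) = \<gamma> g"
  by (simp add: free_gen_def free_ext_single)

lemma free_alg_hom_eq:
  assumes "is_alg_hom h"
  shows "h x = free_ext (\<lambda>g. h (free_gen g)) x"
proof (induction x rule: poly_mapping_add_single_induct)
  case zero
  show ?case by (simp add: free_ext_0 is_homD(4)[OF is_alg_homD(1)[OF assms]])
next
  case (add f k v)
  note h = is_homD[OF is_alg_homD(1)[OF assms]]
  have w: "h (Poly_Mapping.single (Word xs) 1) = prod_list (map (\<lambda>g. h (free_gen g)) xs)" for xs
  proof (induction xs)
    case Nil
    have "Poly_Mapping.single (Word []) 1 = (1 :: free_alg)"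
      by (metis single_one zero_free_word_def)
    then show ?case by (simp add: h)
  next
    case (Cons a xs)
    have "Poly_Mapping.single (Word (a # xs)) 1 = free_gen a * Poly_Mapping.single (Word xs) 1"
      by (simp add: free_gen_def mult_single)
    then show ?case by (simp add: h Cons)
  qed
  obtain xs where k: "k = Word xs" by (cases k)
  have "Poly_Mapping.single k v = of_C v * Poly_Mapping.single k 1"
    by (simp add: of_C_poly_mapping_def of_C_complex_def mult_single)
  then have "h (Poly_Mapping.single k v) = of_C v * prod_list (map (\<lambda>g. h (free_gen g)) xs)"
    by (simp add: h is_alg_homD(2)[OF assms] w k)
  with add show ?case by (simp add: h free_ext_add free_ext_single k)
qed

lemma hom_ideal_gen_0:
  assumes "is_hom h" "\<And>r. r \<in> R \<Longrightarrow> h r = 0" "x \<in> ideal_gen R"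
  shows "h x = 0"
  using assms(3) by induction (simp_all add: is_homD[OF assms(1)] assms(2))

lemma is_alg_hom_abs_palg: "is_alg_hom (abs_palg :: _ \<Rightarrow> 'p::presentation palg)"
  by (simp add: is_alg_hom_def is_hom_def plus_palg.abs_eq times_palg.abs_eq one_palg.abs_eq of_C_palg.abs_eq)

lemma abs_palg_relator:
  assumes "r \<in> relators TYPE('p::presentation)"
  shows "(abs_palg r :: 'p palg) = 0"
proof -
  have "r \<in> ideal_gen (relators TYPE('p))"
    using ideal_gen.add[OF ideal_gen.zero assms, of 1 1] by simp
  then show ?thesis by (simp add: zero_palg.abs_eq palg.abs_eq_iff)
qed

lemma abs_rep_palg [simp]: "abs_palg (rep_palg x) = (x :: 'p::presentation palg)"
  by (rule Quotient_abs_rep[OF Quotient_palg])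

lemma palg_hom_exists:
  fixes \<gamma> :: "generator \<Rightarrow> 'a::calgebra"
  assumes "\<And>r. r \<in> relators TYPE('p::presentation) \<Longrightarrow> free_ext \<gamma> r = 0"
  shows "\<exists>f :: 'p palg \<Rightarrow> 'a. is_alg_hom f \<and> (\<forall>g. f (palg_gen g) = \<gamma> g)"
proof -
  define f :: "'p palg \<Rightarrow> 'a" where "f x = free_ext \<gamma> (rep_palg x)" for x
  note ext = is_alg_hom_free_ext[of \<gamma>]
  note hom = is_alg_homD(1)[OF ext]
  have f_abs: "f (abs_palg x) = free_ext \<gamma> x" for x
  proof -
    have "(abs_palg (rep_palg (abs_palg x :: 'p palg)) :: 'p palg) = abs_palg x" by simp
    then have "rep_palg (abs_palg x :: 'p palg) - x \<in> ideal_gen (relators TYPE('p))"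
      unfolding palg.abs_eq_iff .
    from hom_ideal_gen_0[OF hom assms this] show ?thesis
      by (simp add: f_def is_homD(5)[OF hom])
  qed
  note abs = is_alg_hom_abs_palg[where 'p = 'p]
  note abshom = is_homD[OF is_alg_homD(1)[OF abs]]
  have "f (x + y) = f x + f y" "f (x * y) = f x * f y" for x y
    using f_abs[of "rep_palg x + rep_palg y"] f_abs[of "rep_palg x * rep_palg y"]
    by (simp_all add: abshom is_homD[OF hom] f_def)
  moreover have "f (of_C c) = of_C c" for c
    using f_abs[of "of_C c"] by (simp add: is_alg_homD(2)[OF abs] is_alg_homD(2)[OF ext])
  moreover from this[of 1] have "f 1 = 1" by simp
  moreover have "f (palg_gen g) = \<gamma> g" for g
    by (simp add: palg_gen.abs_eq f_abs free_ext_gen)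
  ultimately show ?thesis
    by (auto simp: is_alg_hom_def is_hom_def)
qed

lemma palg_hom_eqI:
  fixes f g :: "'p::presentation palg \<Rightarrow> 'a::calgebra"
  assumes "is_alg_hom f" "is_alg_hom g" "\<And>x. f (palg_gen x) = g (palg_gen x)"
  shows "f = g"
proof
  fix x :: "'p palg"
  note abs = is_alg_hom_abs_palg[where 'p = 'p]
  have "f (abs_palg y) = g (abs_palg y)" for y
    using free_alg_hom_eq[OF is_alg_hom_comp[OF assms(1) abs], of y]
      free_alg_hom_eq[OF is_alg_hom_comp[OF assms(2) abs], of y]
    by (simp add: palg_gen.abs_eq[symmetric] assms(3))
  from this[of "rep_palg x"] show "f x = g x" by (simp only: abs_rep_palg)
qed

abbreviation mmap :: "('a \<Rightarrow> 'b) \<Rightarrow> 'a fps mat2 \<Rightarrow> 'b fps mat2" where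
  "mmap h \<equiv> map_matrix (map_fps h)"

text \<open>Generators exist for r >= 1 only, so a matrix series can be the image of a generator
  matrix only if it has the prescribed constant term. This is the role of the hypotheses on
  \<open>lead\<close>.\<close>

definition lead :: "'a::ring_1 fps mat2 \<Rightarrow> 'a mat2" where
  "lead N = map_matrix (\<lambda>f. fps_nth f 0) N"

definition coeff_gen :: "'a fps mat2 \<Rightarrow> generator \<Rightarrow> 'a" where
  "coeff_gen N = (\<lambda>(i, j, n). fps_nth (N $ i $ j) (Suc n))"

lemma lead_entry: "fps_nth (N $ i $ j) 0 = lead N $ i $ j"
  by (simp add: lead_def)

lemma gen_matrix_coeff_gen: "lead N = G \<Longrightarrow> gen_matrix (coeff_gen N) G = N"
  by (auto simp: vec_eq_iff fps_eq_iff gen_matrix_nth coeff_gen_def lead_def split: nat.splits)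

lemma lead_gen_matrix [simp]: "lead (gen_matrix g G) = G"
  by (simp add: lead_def vec_eq_iff gen_matrix_nth)

lemma mmap_gen_matrix:
  assumes "is_hom h"
  shows "mmap h (gen_matrix g (G_mat q)) = gen_matrix (\<lambda>x. h (g x)) (G_mat q)"
proof -
  have "h (G_mat q $ i $ j) = G_mat q $ i $ j" for i j
    using map_matrix_hom_simps(5)[OF assms, of q] by (metis nth_map_matrix)
  then show ?thesis
    by (auto simp: vec_eq_iff fps_eq_iff gen_matrix_nth split: nat.splits)
qed

lemma gen_matrix_inject: "gen_matrix g G = gen_matrix h G \<longleftrightarrow> g = h"
proof
  assume *: "gen_matrix g G = gen_matrix h G"
  have "g (i, j, n) = h (i, j, n)" for i j n
    using arg_cong[OF *, of "\<lambda>M. fps_nth (M $ i $ j) (Suc n)"] by (simp add: gen_matrix_nth)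
  then show "g = h" by auto
qed simp

lemma palg_hom_to:
  fixes N :: "'a::calgebra fps mat2"
  assumes "lead N = G_mat q"
    and "\<And>r. r \<in> relators TYPE('p::presentation) \<Longrightarrow> free_ext (coeff_gen N) r = 0"
  shows "\<exists>f :: 'p palg \<Rightarrow> 'a. is_alg_hom f \<and> mmap f (St_gen q) = N"
proof -
  from palg_hom_exists[of "coeff_gen N", OF assms(2)] obtain f :: "'p palg \<Rightarrow> 'a"
    where f: "is_alg_hom f" "\<And>g. f (palg_gen g) = coeff_gen N g" by blast
  from f(2) have "(\<lambda>g. f (palg_gen g)) = coeff_gen N" by (rule ext)
  with f(1) show ?thesis
    using gen_matrix_coeff_gen[OF assms(1)]
    by (auto simp: St_gen_def mmap_gen_matrix is_alg_homD)
qed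

lemma palg_hom_unique:
  fixes f g :: "'p::presentation palg \<Rightarrow> 'a::calgebra"
  assumes "is_alg_hom f" "is_alg_hom g" "mmap f (St_gen q) = mmap g (St_gen q)"
  shows "f = g"
proof (rule palg_hom_eqI[OF assms(1,2)])
  fix x
  from assms(3) show "f (palg_gen x) = g (palg_gen x)"
    unfolding St_gen_def mmap_gen_matrix[OF is_alg_homD(1)[OF assms(1)]]
      mmap_gen_matrix[OF is_alg_homD(1)[OF assms(2)]] gen_matrix_inject
    by (rule fun_cong)
qed

text \<open>Lets every statement about \<open>St_gen q\<close> be specialised to the algebras whose
  generator matrix starts with I.\<close>

lemma T_gen_eq: "T_gen = St_gen SP2_SP2"
  by (simp add: T_gen_def St_gen_def)

lemma map_fls_lift1: "is_alg_hom h \<Longrightarrow> map_fls h (lift1 x) = lift1 x"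
  by (simp add: map_fls_comp is_alg_homD is_hom_of_C)

lemma map_fls_lift2: "is_alg_hom h \<Longrightarrow> map_fls (map_fls h) (lift2 x) = lift2 x"
  by (simp add: map_fls_comp is_alg_homD is_hom_of_C is_hom_map_fls)

lemma map_fls_fps_to_fls: "h 0 = 0 \<Longrightarrow> map_fls h (fps_to_fls f) = fps_to_fls (map_fps h f)"
  by (intro fls_eqI) (simp add: map_fls_nth)

lemma map_fls_in_u_v:
  assumes "is_hom h"
  shows "map_fls (map_fls h) (in_u f) = in_u (map_fps h f)"
    and "map_fls (map_fls h) (in_v f) = in_v (map_fps h f)"
proof -
  note h0 = is_homD(4)[OF assms] and h1 = is_homD(4)[OF is_hom_map_fls[OF assms]]
  show "map_fls (map_fls h) (in_u f) = in_u (map_fps h f)"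
    by (intro fls_eqI) (simp add: map_fls_nth h0 h1 in_u_nth)
  show "map_fls (map_fls h) (in_v f) = in_v (map_fps h f)"
    by (intro fls_eqI) (simp add: map_fls_nth h0 h1 in_v_nth)
qed

lemma map_matrix_map_matrix: "map_matrix f (map_matrix g A) = map_matrix (\<lambda>x. f (g x)) A"
  by (simp add: vec_eq_iff)

lemma defect_hom:
  assumes h: "is_alg_hom h"
  shows "map_matrix (map_fls (map_fls h)) (rtt_defect R T) = rtt_defect R (mmap h T)"
    and "map_matrix (map_fls (map_fls h)) (refl_defect R R' T) = refl_defect R R' (mmap h T)"
proof -
  have hom: "is_hom (map_fls (map_fls h))"
    by (intro is_hom_map_fls is_alg_homD[OF h])
  note simps = map_matrix_diff[OF hom] map_matrix_mult[OF hom] map_matrix_factor[OF hom]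
    map_matrix_map_matrix map_fls_lift2[OF h] map_fls_in_u_v[OF is_alg_homD(1)[OF h]]
  show "map_matrix (map_fls (map_fls h)) (rtt_defect R T) = rtt_defect R (mmap h T)"
    "map_matrix (map_fls (map_fls h)) (refl_defect R R' T) = refl_defect R R' (mmap h T)"
    unfolding rtt_defect_def refl_defect_def Let_def simps by (rule refl)+
qed

lemma series_coeffs2_hom_0:
  assumes h: "is_hom h"
  shows "(\<forall>r\<in>series_coeffs2 M. h r = 0) \<longleftrightarrow> map_matrix (map_fls (map_fls h)) M = 0"
proof -
  note h0 = is_homD(4)[OF assms] and h1 = is_homD(4)[OF is_hom_map_fls[OF assms]]
  have "map_matrix (map_fls (map_fls h)) M = 0 \<longleftrightarrow>
      (\<forall>i j m n. h (fls_nth (fls_nth (M $ i $ j) m) n) = 0)"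
    by (simp add: vec_eq_iff fls_eq_iff map_fls_nth h0 h1)
  then show ?thesis unfolding series_coeffs2_def by blast
qed

lemma series_coeffs_hom_0: "(\<forall>r\<in>series_coeffs M. h r = 0) \<longleftrightarrow> mmap h M = 0"
proof -
  have "mmap h M = 0 \<longleftrightarrow> (\<forall>i j n. h (fps_nth (M $ i $ j) n) = 0)"
    by (simp add: vec_eq_iff fps_eq_iff)
  then show ?thesis by (auto simp: series_coeffs_def)
qed

lemma mmap_free_gen:
  assumes "lead N = G_mat q"
  shows "mmap (free_ext (coeff_gen N)) (gen_matrix free_gen (G_mat q)) = N"
  by (simp add: mmap_gen_matrix is_alg_homD[OF is_alg_hom_free_ext] free_ext_gen
      gen_matrix_coeff_gen[OF assms])

lemma palg_gen_eq: "palg_gen = (\<lambda>g. abs_palg (free_gen g))"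
  by (rule ext) (rule palg_gen.abs_eq)

lemma mmap_abs_palg: "mmap abs_palg (gen_matrix free_gen (G_mat q)) = St_gen q"
  by (simp add: mmap_gen_matrix is_alg_homD[OF is_alg_hom_abs_palg] St_gen_def palg_gen_eq)

lemma mmap_T_gen_abs:
  "mmap (abs_palg :: _ \<Rightarrow> 'p::presentation palg) (gen_matrix free_gen (mat 1)) = T_gen"
  using mmap_abs_palg[of SP2_SP2] by (simp add: T_gen_eq)

text \<open>Defects are natural in the matrix. With \<open>abs_palg\<close> this shows that the
  relation holds in the quotient; with \<open>free_ext\<close> it shows that a solution of the
  relation defines a homomorphism.\<close>

lemma relator_rtt:
  assumes "is_alg_hom h" "mmap h (gen_matrix free_gen (G_mat q)) = N"
  shows "(\<forall>r\<in>series_coeffs2 (rtt_defect R (gen_matrix free_gen (G_mat q))). h r = 0) \<longleftrightarrow> rtt_defect R N = 0"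
    and "(\<forall>r\<in>series_coeffs2 (refl_defect R R' (gen_matrix free_gen (G_mat q))). h r = 0) \<longleftrightarrow> refl_defect R R' N = 0"
  by (simp_all add: series_coeffs2_hom_0 is_alg_homD[OF assms(1)] defect_hom[OF assms(1)] assms(2))

lemma mmap_msubst: "is_alg_hom h \<Longrightarrow> a \<noteq> 0 \<Longrightarrow> mmap h (msubst a b N) = msubst a b (mmap h N)"
  by (simp add: vec_eq_iff map_fps_subst_affine)

lemma map_fps_qdet: "is_alg_hom h \<Longrightarrow> map_fps h (qdet T) = qdet (mmap h T)"
  by (simp add: qdet_def is_homD[OF is_hom_map_fps] is_alg_homD map_fps_subst_affine)

lemma mmap_simps:
  assumes "is_alg_hom h"
  shows "mmap h (A ** B) = mmap h A ** mmap h B" "mmap h (A - B) = mmap h A - mmap h B"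
    "mmap h (mtransp s A) = mtransp s (mmap h A)" "mmap h (mat 1) = mat 1"
    "mmap h (G_mat q) = G_mat q"
    "a \<noteq> 0 \<Longrightarrow> mmap h (msubst a b A) = msubst a b (mmap h A)"
proof -
  note hom = is_hom_map_fps[OF is_alg_homD(1)[OF assms]]
  show "mmap h (A ** B) = mmap h A ** mmap h B" by (rule map_matrix_mult[OF hom])
  show "mmap h (A - B) = mmap h A - mmap h B" by (rule map_matrix_diff[OF hom])
  show "mmap h (mtransp s A) = mtransp s (mmap h A)" by (rule map_matrix_hom_simps(2)[OF hom])
  show "mmap h (mat 1) = mat 1" by (rule map_matrix_mat_1[OF hom])
  show "mmap h (G_mat q) = G_mat q" by (rule map_matrix_hom_simps(5)[OF hom])
  show "a \<noteq> 0 \<Longrightarrow> mmap h (msubst a b A) = msubst a b (mmap h A)"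
    by (rule mmap_msubst[OF assms])
qed

lemma palg_defect_0:
  shows "series_coeffs2 (rtt_defect R (gen_matrix free_gen (G_mat q))) \<subseteq> relators TYPE('p::presentation) \<Longrightarrow>
      rtt_defect R (St_gen q :: 'p palg fps mat2) = 0"
    and "series_coeffs2 (refl_defect R R' (gen_matrix free_gen (G_mat q))) \<subseteq> relators TYPE('p) \<Longrightarrow>
      refl_defect R R' (St_gen q :: 'p palg fps mat2) = 0"
  using relator_rtt[OF is_alg_hom_abs_palg[where 'p = 'p] mmap_abs_palg, where q = q]
  by (blast intro: abs_palg_relator)+

lemma free_ext_defect:
  assumes "lead N = G_mat q"
  shows "rtt_defect R N = 0 \<Longrightarrow> r \<in> series_coeffs2 (rtt_defect R (gen_matrix free_gen (G_mat q))) \<Longrightarrow>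
      free_ext (coeff_gen N) r = 0"
    and "refl_defect R R' N = 0 \<Longrightarrow> r \<in> series_coeffs2 (refl_defect R R' (gen_matrix free_gen (G_mat q))) \<Longrightarrow>
      free_ext (coeff_gen N) r = 0"
  using relator_rtt[OF is_alg_hom_free_ext mmap_free_gen[OF assms]] by blast+

lemmas palg_defect_0_T = palg_defect_0[where q = SP2_SP2, folded T_gen_eq, unfolded G_mat.simps]
lemmas free_ext_defect_1 = free_ext_defect[where q = SP2_SP2, unfolded G_mat.simps]
lemmas palg_hom_to_T = palg_hom_to[where q = SP2_SP2, folded T_gen_eq, unfolded G_mat.simps]
lemmas mmap_free_gen_1 = mmap_free_gen[where q = SP2_SP2, unfolded G_mat.simps]

section \<open>Relations and universal properties of the individual algebras\<close>

lemma Y2_RTT: "RTT (T_gen :: Y2 fps mat2)"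
  by (rule palg_defect_0_T) (simp add: relators_Y2_pres_def Y_gl_relators_def)

lemma Y2_hom:
  fixes N :: "'a::calgebra fps mat2"
  assumes "lead N = mat 1" "RTT N"
  shows "\<exists>f :: Y2 \<Rightarrow> 'a. is_alg_hom f \<and> mmap f T_gen = N"
  using free_ext_defect_1(1)[OF assms]
  by (intro palg_hom_to_T assms(1)) (simp add: relators_Y2_pres_def Y_gl_relators_def)

lemma X_sp2_RTT: "RTT_sp (T_gen :: X_sp2 fps mat2)"
  by (rule palg_defect_0_T) (simp add: relators_X_sp2_pres_def X_sp_relators_def)

lemma X_sp2_hom:
  fixes N :: "'a::calgebra fps mat2"
  assumes "lead N = mat 1" "RTT_sp N"
  shows "\<exists>f :: X_sp2 \<Rightarrow> 'a. is_alg_hom f \<and> mmap f T_gen = N"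
  using free_ext_defect_1(1)[OF assms]
  by (intro palg_hom_to_T assms(1)) (simp add: relators_X_sp2_pres_def X_sp_relators_def)

lemma SY2_RTT: "RTT (T_gen :: SY2 fps mat2)"
  by (rule palg_defect_0_T) (simp add: relators_SY2_pres_def SY_gl_relators_def Y_gl_relators_def)

lemma SY2_qdet: "qdet (T_gen :: SY2 fps mat2) = 1"
proof -
  let ?h = "abs_palg :: _ \<Rightarrow> SY2"
  have "?h (fps_nth (qdet (gen_matrix free_gen (mat 1)) - 1) n) = 0" for n
    using abs_palg_relator[where 'p = SY2_pres] unfolding relators_SY2_pres_def SY_gl_relators_def by blast
  then have "map_fps ?h (qdet (gen_matrix free_gen (mat 1)) - 1) = 0"
    by (simp only: fps_eq_iff map_fps_nth fps_zero_nth) simp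
  then show ?thesis
    using mmap_T_gen_abs[where 'p = SY2_pres]
    by (simp add: is_homD[OF is_hom_map_fps[OF is_alg_homD(1)[OF is_alg_hom_abs_palg]]]
        map_fps_qdet[OF is_alg_hom_abs_palg])
qed

lemma SY2_hom:
  fixes N :: "'a::calgebra fps mat2"
  assumes "lead N = mat 1" "RTT N" "qdet N = 1"
  shows "\<exists>f :: SY2 \<Rightarrow> 'a. is_alg_hom f \<and> mmap f T_gen = N"
proof (rule palg_hom_to_T[OF assms(1)])
  let ?h = "free_ext (coeff_gen N)"
  have "map_fps ?h (qdet (gen_matrix free_gen (mat 1)) - 1) = 0"
    using mmap_free_gen_1[OF assms(1)] assms(3)
    by (simp add: is_homD[OF is_hom_map_fps[OF is_alg_homD(1)[OF is_alg_hom_free_ext]]]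
        map_fps_qdet[OF is_alg_hom_free_ext])
  then have "?h (fps_nth (qdet (gen_matrix free_gen (mat 1)) - 1) n) = 0" for n
    by (simp only: fps_eq_iff map_fps_nth fps_zero_nth)
  moreover fix r assume "r \<in> relators TYPE(SY2_pres)"
  ultimately show "?h r = 0"
    using free_ext_defect_1(1)[OF assms(1,2)]
    by (auto simp: relators_SY2_pres_def SY_gl_relators_def Y_gl_relators_def)
qed

lemma Y_sp2_RTT: "RTT_sp (T_gen :: Y_sp2 fps mat2)"
  by (rule palg_defect_0_T) (simp add: relators_Y_sp2_pres_def Y_sp_relators_def X_sp_relators_def)

lemma Y_sp2_unit: "(T_gen :: Y_sp2 fps mat2) ** mtransp Minus (msubst 1 2 T_gen) = mat 1"
proof -
  let ?h = "abs_palg :: _ \<Rightarrow> Y_sp2" and ?T = "gen_matrix free_gen (mat 1)"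
  have "\<forall>r\<in>series_coeffs (?T ** mtransp Minus (msubst 1 2 ?T) - mat 1). ?h r = 0"
    using abs_palg_relator[where 'p = Y_sp2_pres] by (simp add: relators_Y_sp2_pres_def Y_sp_relators_def Let_def)
  then show ?thesis
    unfolding series_coeffs_hom_0
    using mmap_T_gen_abs[where 'p = Y_sp2_pres]
    by (simp add: mmap_simps[OF is_alg_hom_abs_palg])
qed

lemma Y_sp2_hom:
  fixes N :: "'a::calgebra fps mat2"
  assumes "lead N = mat 1" "RTT_sp N" "N ** mtransp Minus (msubst 1 2 N) = mat 1"
  shows "\<exists>f :: Y_sp2 \<Rightarrow> 'a. is_alg_hom f \<and> mmap f T_gen = N"
proof (rule palg_hom_to_T[OF assms(1)])
  let ?h = "free_ext (coeff_gen N)" and ?T = "gen_matrix free_gen (mat 1)"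
  have "\<forall>r\<in>series_coeffs (?T ** mtransp Minus (msubst 1 2 ?T) - mat 1). ?h r = 0"
    unfolding series_coeffs_hom_0
    using mmap_free_gen_1[OF assms(1)] assms(3) by (simp add: mmap_simps[OF is_alg_hom_free_ext])
  moreover fix r assume "r \<in> relators TYPE(Y_sp2_pres)"
  ultimately show "?h r = 0"
    using free_ext_defect_1(1)[OF assms(1,2)]
    by (auto simp: relators_Y_sp2_pres_def Y_sp_relators_def X_sp_relators_def Let_def)
qed

lemma Xt_REFL:
  assumes "relators TYPE('p::presentation) = Xt_relators q"
  shows "REFL_sp (St_gen q :: 'p palg fps mat2)"
  using assms by (intro palg_defect_0(2)) (simp add: Xt_relators_def)

lemma Xt_hom:
  fixes N :: "'a::calgebra fps mat2"
  assumes p: "relators TYPE('p::presentation) = Xt_relators q" and l: "lead N = G_mat q" and "REFL_sp N"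
  shows "\<exists>f :: 'p palg \<Rightarrow> 'a. is_alg_hom f \<and> mmap f (St_gen q) = N"
  using free_ext_defect(2)[OF l assms(3)] by (intro palg_hom_to l) (simp add: p Xt_relators_def)

lemma Yt_REFL:
  assumes "relators TYPE('p::presentation) = Yt_relators s"
  shows "REFL_gl s (T_gen :: 'p palg fps mat2)"
  using assms by (intro palg_defect_0_T(2)) (simp add: Yt_relators_def)

lemma Yt_hom:
  fixes N :: "'a::calgebra fps mat2"
  assumes p: "relators TYPE('p::presentation) = Yt_relators s" and l: "lead N = mat 1" and "REFL_gl s N"
  shows "\<exists>f :: 'p palg \<Rightarrow> 'a. is_alg_hom f \<and> mmap f T_gen = N"
  using free_ext_defect_1(2)[OF l assms(3)] by (intro palg_hom_to_T l) (simp add: p Yt_relators_def)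

section \<open>Series with coefficients in a subalgebra\<close>

definition subalg :: "'a::calgebra set \<Rightarrow> bool" where
  "subalg A \<longleftrightarrow> range of_C \<subseteq> A \<and> (\<forall>x\<in>A. \<forall>y\<in>A. x + y \<in> A \<and> x * y \<in> A)"

definition fps_in :: "'a::calgebra set \<Rightarrow> 'a fps \<Rightarrow> bool" where
  "fps_in A f \<longleftrightarrow> (\<forall>n. fps_nth f n \<in> A)"

lemma fps_inD: "fps_in A f \<Longrightarrow> fps_nth f n \<in> A"
  by (simp add: fps_in_def)

lemma subalgD:
  assumes "subalg A"
  shows "of_C c \<in> A" "x \<in> A \<Longrightarrow> y \<in> A \<Longrightarrow> x + y \<in> A" "x \<in> A \<Longrightarrow> y \<in> A \<Longrightarrow> x * y \<in> A"
    "x \<in> A \<Longrightarrow> - x \<in> A" "x \<in> A \<Longrightarrow> y \<in> A \<Longrightarrow> x - y \<in> A" "0 \<in> A" "1 \<in> A"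
proof -
  show C: "of_C c \<in> A" for c using assms by (auto simp: subalg_def)
  show add: "x \<in> A \<Longrightarrow> y \<in> A \<Longrightarrow> x + y \<in> A" for x y using assms by (auto simp: subalg_def)
  show mult: "x \<in> A \<Longrightarrow> y \<in> A \<Longrightarrow> x * y \<in> A" for x y using assms by (auto simp: subalg_def)
  show neg: "x \<in> A \<Longrightarrow> - x \<in> A" for x using mult[OF C[of "-1"], of x] by (simp add: of_C_uminus)
  show "x \<in> A \<Longrightarrow> y \<in> A \<Longrightarrow> x - y \<in> A" using add[OF _ neg, of x y] by simp
  show "0 \<in> A" "1 \<in> A" using C[of 0] C[of 1] by simp_all
qed

lemma subalg_sum: "subalg A \<Longrightarrow> (\<And>i. i \<in> S \<Longrightarrow> f i \<in> A) \<Longrightarrow> sum f S \<in> A"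
  by (induction S rule: infinite_finite_induct) (auto intro: subalgD)

lemma subalg_subalgebra_gen: "subalg (subalgebra_gen G)"
  by (auto simp: subalg_def intro: subalgebra_gen.intros)

lemma subalgebra_gen_least: "subalg A \<Longrightarrow> G \<subseteq> A \<Longrightarrow> subalgebra_gen G \<subseteq> A"
proof
  fix x assume A: "subalg A" "G \<subseteq> A" and "x \<in> subalgebra_gen G"
  from this(3) show "x \<in> A" by induction (use A in \<open>auto intro: subalgD\<close>)
qed

lemma central_arith:
  assumes "central x" "central y"
  shows "central (x + y)" "central (x * y)"
proof -
  show "central (x + y)"
    unfolding central_def distrib_left distrib_right using assms by (simp add: centralD)
  show "central (x * y)"
    unfolding central_def by (metis assms centralD mult.assoc)
qed

lemma subalg_central: "subalg {z. central z}"
  by (auto simp: subalg_def central_of_C central_arith)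

lemma central_fps_commute: "fps_in {z. central z} f \<Longrightarrow> f * g = g * f"
proof (rule fps_ext)
  fix n assume f: "fps_in {z. central z} f"
  have "fps_nth (f * g) n = (\<Sum>i=0..n. fps_nth g (n - i) * fps_nth f i)"
    unfolding fps_mult_nth using f by (intro sum.cong refl centralD) (auto simp: fps_in_def)
  also have "\<dots> = fps_nth (g * f) n"
    unfolding fps_mult_nth
    by (rule sum.reindex_bij_witness[of _ "\<lambda>i. n - i" "\<lambda>i. n - i"]) auto
  finally show "fps_nth (f * g) n = fps_nth (g * f) n" .
qed

lemma subst_affine_const [simp]: "subst_affine a b (fps_const c) = fps_const c"
proof (rule fps_ext)
  fix n
  have "fps_nth (subst_affine a b (fps_const c)) n = (\<Sum>i=0..n. if i = 0 then fps_nth (fps_const c) n else 0)"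
    unfolding subst_affine_def fps_compose_nth by (intro sum.cong) auto
  then show "fps_nth (subst_affine a b (fps_const c)) n = fps_nth (fps_const c) n" by simp
qed

definition cfps :: "complex \<Rightarrow> 'a::calgebra fps" where "cfps c = fps_const (of_C c)"

lemma cfps_simps [simp]: "cfps 0 = 0" "cfps 1 = 1" "subst_affine a b (cfps c) = cfps c"
  "fps_nth (cfps c) n = (if n = 0 then of_C c else 0)"
  by (simp_all add: cfps_def)

lemma cfps_arith: "cfps c + cfps d = cfps (c + d)" "cfps c * cfps d = cfps (c * d)"
  "- cfps c = cfps (- c)" "cfps c - cfps d = cfps (c - d)"
  by (simp_all add: cfps_def of_C_add of_C_mult of_C_diff of_C_uminus fps_const_mult)

lemma fps_in_intros:
  assumes A: "subalg A"
  shows "fps_in A 0" "fps_in A 1" "fps_in A (cfps c)" "fps_in A fps_X"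
    "fps_in A f \<Longrightarrow> fps_in A g \<Longrightarrow> fps_in A (f + g)"
    "fps_in A f \<Longrightarrow> fps_in A g \<Longrightarrow> fps_in A (f - g)"
    "fps_in A f \<Longrightarrow> fps_in A g \<Longrightarrow> fps_in A (f * g)"
    "fps_in A f \<Longrightarrow> fps_in A (- f)"
    "a \<noteq> 0 \<Longrightarrow> fps_in A f \<Longrightarrow> fps_in A (subst_affine a b f)"
proof -
  note c = subalgD[OF A]
  show "fps_in A 0" "fps_in A 1" "fps_in A (cfps c)" "fps_in A fps_X"
    by (simp_all add: fps_in_def fps_X_def c)
  show "fps_in A f \<Longrightarrow> fps_in A g \<Longrightarrow> fps_in A (f + g)" "fps_in A f \<Longrightarrow> fps_in A g \<Longrightarrow> fps_in A (f - g)"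
    "fps_in A f \<Longrightarrow> fps_in A (- f)"
    by (simp_all add: fps_in_def c)
  show "fps_in A f \<Longrightarrow> fps_in A g \<Longrightarrow> fps_in A (f * g)"
    by (simp add: fps_in_def fps_mult_nth subalg_sum[OF A] c)
  show "a \<noteq> 0 \<Longrightarrow> fps_in A f \<Longrightarrow> fps_in A (subst_affine a b f)"
    by (simp add: fps_in_def subst_affine_nth subalg_sum[OF A] c)
qed

lemma fps_in_subst_iff:
  assumes "subalg A" "a \<noteq> 0"
  shows "fps_in A (subst_affine a b f) \<longleftrightarrow> fps_in A f"
proof
  assume "fps_in A (subst_affine a b f)"
  then have "fps_in A (subst_affine (1/a) (- b / a) (subst_affine a b f))"
    using fps_in_intros(9)[OF assms(1), of "1/a" "subst_affine a b f" "- b / a"] assms(2) by simp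
  moreover have "subst_affine (1/a) (- b / a) (subst_affine a b f) = f"
    using subst_affine_comp[of "1/a" a "- b / a" b f] assms(2) by simp
  ultimately show "fps_in A f" by simp
qed (use assms in \<open>auto intro: fps_in_intros\<close>)

text \<open>The recursion for the coefficients of the inverse divides by the scalar \<open>c\<close>
  only, so it never leaves \<open>A\<close>.\<close>

lemma fps_in_inverse:
  assumes A: "subalg A" and f: "fps_in A f" "fps_nth f 0 = of_C c" "c \<noteq> 0"
  shows "\<exists>g. fps_in A g \<and> f * g = 1 \<and> g * f = 1"
proof -
  let ?y = "of_C (1 / c) :: 'a"
  let ?g = "fps_right_inverse f ?y"
  have y: "fps_nth f 0 * ?y = 1" "?y * fps_nth f 0 = 1"
    using f(3) by (simp_all add: f(2) flip: of_C_mult)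
  have "f * ?g = 1" by (rule fps_right_inverse[OF y(1)])
  moreover have "?g * f = 1"
    using fps_left_inverse[OF y(2)] fps_left_inverse_eq_fps_right_inverse[OF y(2,1)] by simp
  moreover have "fps_nth ?g n \<in> A" for n
  proof (induction n rule: less_induct)
    case (less n)
    show ?case
    proof (cases n)
      case (Suc m)
      have "fps_nth ?g n = - ?y * (\<Sum>i=1..n. fps_nth f i * fps_nth ?g (n - i))"
        by (simp add: Suc)
      then show ?thesis
        using less by (simp del: mult_minus_left)
          (intro subalgD[OF A] subalg_sum[OF A] fps_inD[OF f(1)], auto)
    qed (simp add: subalgD[OF A])
  qed
  ultimately show ?thesis unfolding fps_in_def by blast
qed

lemma fps_inverse_unique: "f * g = 1 \<Longrightarrow> g' * f = 1 \<Longrightarrow> g' = (g :: 'a::ring_1 fps)"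
  by (metis mult.assoc mult_1_left mult_1_right)

lemma affine_coeff_diag: "affine_coeff 1 b (int n) (int n) = 1"
proof -
  have "fps_nth ((fps_X * inverse (fps_const 1 + fps_const b * fps_X)) ^ n) n = 1"
    by (simp add: power_mult_distrib fps_X_power_mult_nth fps_power_zeroth)
  then show ?thesis by (simp add: affine_coeff_fps)
qed

text \<open>The translation u -> u + b is unitriangular on powers of u^-1, hence preserves the
  lowest term.\<close>

lemma subst_affine_nth_low:
  assumes "\<And>i. i < m \<Longrightarrow> fps_nth f i = 0" "k \<le> m"
  shows "fps_nth (subst_affine 1 b f) k = fps_nth f k"
proof -
  have "fps_nth (subst_affine 1 b f) k = (\<Sum>i=0..k. if i = k then fps_nth f k else 0)"
    unfolding subst_affine_nth[OF one_neq_zero]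
    using assms by (intro sum.cong refl) (auto simp: affine_coeff_diag)
  then show ?thesis by simp
qed

lemma fps_mult_nth_low:
  fixes d f :: "'a::ring_1 fps"
  assumes "\<And>i. i < m \<Longrightarrow> fps_nth d i = 0" "k \<le> m"
  shows "fps_nth (d * f) k = fps_nth d k * fps_nth f 0" "fps_nth (f * d) k = fps_nth f 0 * fps_nth d k"
proof -
  have "fps_nth (d * f) k = (\<Sum>i=0..k. if i = k then fps_nth d k * fps_nth f 0 else 0)"
    unfolding fps_mult_nth using assms by (intro sum.cong refl) auto
  then show "fps_nth (d * f) k = fps_nth d k * fps_nth f 0" by simp
  have "fps_nth (f * d) k = (\<Sum>i=0..k. if i = 0 then fps_nth f 0 * fps_nth d k else 0)"
    unfolding fps_mult_nth using assms by (intro sum.cong refl) auto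
  then show "fps_nth (f * d) k = fps_nth f 0 * fps_nth d k" by simp
qed

text \<open>The equation \<open>f(u) f(u + b) = q(u)\<close> is solved coefficient by coefficient.\<close>

abbreviation shift_sq :: "complex \<Rightarrow> 'a::calgebra fps \<Rightarrow> 'a fps" where
  "shift_sq b f \<equiv> f * subst_affine 1 b f"

text \<open>Put f = g + d with d of order m. In degrees up to m both factors contribute d, because
  the constant terms are 1 and the translation preserves the lowest term of d. Each coefficient thus
  solves a linear equation with the factor 2.\<close>

lemma shift_sq_perturb:
  assumes "\<And>i. i < m \<Longrightarrow> fps_nth f i = fps_nth g i" "fps_nth f 0 = 1" "fps_nth g 0 = 1" "k \<le> m"
  shows "fps_nth (shift_sq b f) k = fps_nth (shift_sq b g) k + 2 * (fps_nth f k - fps_nth g k)"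
proof -
  let ?s = "subst_affine 1 b"
  define d where "d = f - g"
  have d: "fps_nth d i = 0" if "i < m" for i using assms(1) that by (simp add: d_def)
  have sd: "fps_nth (?s d) i = fps_nth d i" if "i \<le> m" for i
    using subst_affine_nth_low[of m d i b] d that by simp
  have "f = g + d" by (simp add: d_def)
  then have "shift_sq b f = shift_sq b g + d * ?s f + g * ?s d"
    by (simp add: is_homD[OF is_hom_subst_affine] algebra_simps)
  moreover have "fps_nth (d * ?s f) k = fps_nth d k"
    using fps_mult_nth_low(1)[of m d k "?s f"] d assms by simp
  moreover have "fps_nth (g * ?s d) k = fps_nth d k"
    using fps_mult_nth_low(2)[of m "?s d" k g] d sd assms by simp
  ultimately show ?thesis by (simp add: d_def mult_2)
qed

lemma half_cancel: "2 * (x :: 'a::calgebra) = 0 \<Longrightarrow> x = 0"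
proof -
  assume "2 * x = 0"
  then have "of_C (1/2) * (of_C 2 * x) = 0" by simp
  then have "(of_C (1/2) * of_C 2) * x = 0" by (simp only: mult.assoc)
  then show ?thesis by (simp del: of_C_numeral flip: of_C_mult)
qed

lemma shift_sq_unique:
  assumes "shift_sq b f = shift_sq b g" "fps_nth f 0 = 1" "fps_nth g 0 = 1"
  shows "f = g"
proof (rule fps_ext)
  fix n
  show "fps_nth f n = fps_nth g n"
  proof (induction n rule: less_induct)
    case (less n)
    from shift_sq_perturb[where m = n and k = n and b = b, OF less assms(2,3)] have "2 * (fps_nth f n - fps_nth g n) = 0"
      by (simp add: assms(1))
    from half_cancel[OF this] show ?case by simp
  qed
qed

lemma shift_sq_exists:
  assumes A: "subalg A" and q: "fps_in A q" "fps_nth q 0 = 1"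
  shows "\<exists>f. fps_in A f \<and> fps_nth f 0 = 1 \<and> shift_sq b f = q"
proof -
  \<comment> \<open>\<open>F n\<close> solves the equation up to degree n; the next coefficient is
    half of the remaining defect.\<close>
  define F where "F = rec_nat (1 :: 'a fps)
    (\<lambda>n f. f + fps_const (of_C (1/2) * fps_nth (q - shift_sq b f) (Suc n)) * fps_X ^ Suc n)"
  have F0: "F 0 = 1"
    and FS: "F (Suc n) = F n + fps_const (of_C (1/2) * fps_nth (q - shift_sq b (F n)) (Suc n)) * fps_X ^ Suc n" for n
    by (simp_all add: F_def)
  have F_nth: "fps_nth (F (Suc n)) k = fps_nth (F n) k +
      (if k = Suc n then of_C (1/2) * fps_nth (q - shift_sq b (F n)) (Suc n) else 0)" for n k
    by (simp only: FS fps_add_nth fps_mult_left_const_nth fps_X_power_iff) simp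
  have F_in: "fps_in A (F n)" for n
  proof (induction n)
    case (Suc n)
    then have "fps_in A (q - shift_sq b (F n))"
      using q A by (intro fps_in_intros) auto
    from fps_inD[OF this] have c: "of_C (1/2) * fps_nth (q - shift_sq b (F n)) (Suc n) \<in> A"
      by (rule subalgD(3)[OF A subalgD(1)[OF A]])
    show ?case
      unfolding fps_in_def F_nth
    proof (intro allI subalgD(2)[OF A] fps_inD[OF Suc])
      fix k
      show "(if k = Suc n then of_C (1/2) * fps_nth (q - shift_sq b (F n)) (Suc n) else 0) \<in> A"
        using c subalgD(6)[OF A] by (simp only: split: if_split) blast
    qed
  qed (simp add: F0 fps_in_intros[OF A])
  have F_0: "fps_nth (F n) 0 = 1" for n
    by (induction n) (simp_all add: F0 F_nth)
  have F_stable: "k \<le> n \<Longrightarrow> fps_nth (F n) k = fps_nth (F k) k" for n k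
    by (induction n) (auto simp: F_nth le_Suc_eq)
  have half: "2 * (of_C (1/2) * x) = x" for x :: 'a
  proof -
    have "2 * (of_C (1/2) * x) = (of_C 2 * of_C (1/2)) * x" by (simp add: mult.assoc)
    then show ?thesis by (simp del: of_C_numeral flip: of_C_mult)
  qed
  have F_sq: "k \<le> n \<Longrightarrow> fps_nth (shift_sq b (F n)) k = fps_nth q k" for n k
  proof (induction n)
    case (Suc n)
    have "fps_nth (shift_sq b (F (Suc n))) k = fps_nth (shift_sq b (F n)) k
        + 2 * (fps_nth (F (Suc n)) k - fps_nth (F n) k)"
      by (rule shift_sq_perturb[of "Suc n"]) (use Suc in \<open>auto simp: F_nth F_0\<close>)
    with Suc show ?case by (auto simp: F_nth half le_Suc_eq)
  qed (simp add: F0 q)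
  define f where "f = Abs_fps (\<lambda>n. fps_nth (F n) n)"
  have f_0: "fps_nth f 0 = 1" by (simp add: f_def F_0)
  have f_F: "fps_nth f k = fps_nth (F n) k" if "k < Suc n" for k n
    using F_stable[of k n] that by (simp only: f_def fps_nth_Abs_fps less_Suc_eq_le)
  have "fps_nth (shift_sq b f) n = fps_nth q n" for n
  proof -
    have "fps_nth (shift_sq b f) n = fps_nth (shift_sq b (F n)) n + 2 * (fps_nth f n - fps_nth (F n) n)"
      by (rule shift_sq_perturb[OF f_F f_0 F_0]) (assumption, rule le_SucI, rule le_refl)
    then show ?thesis using F_sq[of n n] f_F[of n n] by (simp only: lessI le_refl diff_self mult_zero_right add_0_right)
  qed
  moreover have "fps_in A f" using F_in by (simp add: f_def fps_in_def)
  ultimately show ?thesis using f_0 by (auto simp: fps_eq_iff)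
qed

text \<open>Existence inside \<open>A\<close> and uniqueness in the whole algebra single out the
  same series. In this way a central factor is shown to lie in a subalgebra as soon as its product
  with a translate does.\<close>

lemma shift_sq_in:
  assumes "subalg A" "fps_in A (shift_sq b f)" "fps_nth f 0 = 1"
  shows "fps_in A f"
proof -
  from shift_sq_exists[OF assms(1,2), of b] assms(3) obtain g
    where "fps_in A g" "fps_nth g 0 = 1" "shift_sq b g = shift_sq b f" by auto
  with shift_sq_unique[where b = b and f = g and g = f] assms(3) show ?thesis by simp
qed

section \<open>Specialising the second parameter\<close>

text \<open>Restriction to v = u: the coefficients of total degree k are added up.\<close>

definition diag_fps :: "'a::ring_1 fps fps \<Rightarrow> 'a fps" where
  "diag_fps F = Abs_fps (\<lambda>k. \<Sum>m=0..k. fps_nth (fps_nth F m) (k - m))"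

lemma is_hom_diag_fps: "is_hom (diag_fps :: 'a::ring_1 fps fps \<Rightarrow> _)"
  unfolding is_hom_def
proof (intro conjI allI)
  have "(\<Sum>m=0..n. fps_nth (fps_nth (1 :: 'a fps fps) m) (n - m)) = (\<Sum>m=0..n. if m = 0 then (if n = 0 then 1 else 0) else 0)" for n
    by (intro sum.cong) auto
  then show "diag_fps (1 :: 'a fps fps) = 1"
    by (intro fps_ext) (simp add: diag_fps_def)
  fix F G :: "'a fps fps"
  show "diag_fps (F + G) = diag_fps F + diag_fps G"
    by (rule fps_ext) (simp add: diag_fps_def sum.distrib)
  show "diag_fps (F * G) = diag_fps F * diag_fps G"
  proof (rule fps_ext)
    fix k :: nat
    let ?t = "\<lambda>i j p q. fps_nth (fps_nth F i) j * fps_nth (fps_nth G p) q"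
    let ?S = "SIGMA m:{0..k}. SIGMA i:{0..m}. {0..k-m}"
    let ?S' = "SIGMA s:{0..k}. SIGMA i:{0..s}. {0..k-s}"
    have "fps_nth (diag_fps (F * G)) k =
        (\<Sum>m=0..k. \<Sum>i=0..m. \<Sum>j=0..k-m. ?t i j (m - i) (k - m - j))"
      by (simp add: diag_fps_def fps_mult_nth fps_sum_nth)
    also have "\<dots> = (\<Sum>(m, i, j)\<in>?S. ?t i j (m - i) (k - m - j))"
      by (simp add: sum.Sigma)
    \<comment> \<open>Here s = i + j is the total degree taken from \<open>F\<close>, and p = m - i
      the outer degree taken from \<open>G\<close>.\<close>
    also have "\<dots> = (\<Sum>(s, i, p)\<in>?S'. ?t i (s - i) p (k - s - p))"
      by (rule sum.reindex_bij_witness[of _ "\<lambda>(s, i, p). (i + p, i, s - i)" "\<lambda>(m, i, j). (i + j, i, m - i)"])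
        (auto simp: add.commute)
    also have "\<dots> = (\<Sum>s=0..k. \<Sum>i=0..s. \<Sum>p=0..k-s. ?t i (s - i) p (k - s - p))"
      by (simp add: sum.Sigma)
    also have "\<dots> = fps_nth (diag_fps F * diag_fps G) k"
      by (simp add: diag_fps_def fps_mult_nth sum_product)
    finally show "fps_nth (diag_fps (F * G)) k = fps_nth (diag_fps F * diag_fps G) k" .
  qed
qed

text \<open>The value at v = a u + b: the inner substitution replaces v by a v + b, then the
  diagonal sets v = u.\<close>

definition eval_v :: "complex \<Rightarrow> complex \<Rightarrow> 'a::calgebra fps fps \<Rightarrow> 'a fps" where
  "eval_v a b F = diag_fps (map_fps (subst_affine a b) F)"

lemma is_hom_eval_v: "a \<noteq> 0 \<Longrightarrow> is_hom (eval_v a b)"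
  unfolding eval_v_def
  using is_hom_comp[OF is_hom_diag_fps is_hom_map_fps[OF is_hom_subst_affine]] by blast

lemma eval_v_u: "a \<noteq> 0 \<Longrightarrow> eval_v a b (map_fps fps_const f) = f"
proof (rule fps_ext)
  fix n assume "a \<noteq> 0"
  have "fps_nth (eval_v a b (map_fps fps_const f)) n = (\<Sum>m=0..n. if m = n then fps_nth f n else 0)"
    by (simp add: eval_v_def diag_fps_def)
  then show "fps_nth (eval_v a b (map_fps fps_const f)) n = fps_nth f n" by simp
qed

lemma eval_v_v: "eval_v a b (fps_const f) = subst_affine a b f"
proof (rule fps_ext)
  fix n
  have "fps_nth (eval_v a b (fps_const f)) n =
      (\<Sum>m=0..n. if m = 0 then fps_nth (subst_affine a b f) n else 0)"
    unfolding eval_v_def diag_fps_def fps_nth_Abs_fps map_fps_nth by (intro sum.cong) auto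
  then show "fps_nth (eval_v a b (fps_const f)) n = fps_nth (subst_affine a b f) n" by simp
qed

text \<open>\<open>eval_v\<close> makes sense on power series only, whereas the RTT relation lives
  in Laurent series. The relation is cleared of denominators and pulled back along this
  injection.\<close>

definition embed_uv :: "'a::ring_1 fps fps \<Rightarrow> 'a fls fls" where
  "embed_uv F = map_fls fps_to_fls (fps_to_fls F)"

lemma is_hom_embed_uv: "is_hom (embed_uv :: 'a::ring_1 fps fps \<Rightarrow> _)"
  unfolding embed_uv_def
  using is_hom_comp[OF is_hom_map_fls[OF is_hom_fps_to_fls] is_hom_fps_to_fls] .

lemma embed_uv_inject: "embed_uv F = embed_uv G \<longleftrightarrow> F = G"
proof
  assume *: "embed_uv F = embed_uv G"
  have "fps_to_fls (fps_nth F m) = fps_to_fls (fps_nth G m)" for m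
    using arg_cong[OF *, of "\<lambda>x. fls_nth x (int m)"] by (simp add: embed_uv_def map_fls_nth)
  then show "F = G" by (simp add: fps_eq_iff)
qed simp

lemma embed_uv_u: "embed_uv (map_fps fps_const f) = in_u f"
  by (intro fls_eqI) (simp add: embed_uv_def map_fls_nth in_u_nth)

lemma embed_uv_v: "embed_uv (fps_const f) = in_v f"
  by (intro fls_eqI) (simp add: embed_uv_def map_fls_nth in_v_nth)

lemma fls_X_inv_times_X: "fls_X_inv * fls_X = (1 :: 'a::ring_1 fls)"
  by (rule fls_eqI) (simp add: fls_X_times_conv_shift)

lemma param_times_X:
  "lift2 param_u * in_u fps_X = (1 :: 'a::calgebra fls fls)"
  "lift2 param_v * in_v fps_X = (1 :: 'a::calgebra fls fls)"
proof -
  have h1: "lift1 1 = (1 :: 'a fls)" "lift1 0 = (0 :: 'a fls)"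
    by (simp_all add: is_homD[OF is_hom_lift1])
  have u: "in_u fps_X = (fls_X :: 'a fls fls)"
    by (intro fls_eqI) (auto simp: in_u_nth)
  have "lift2 param_u = (fls_X_inv :: 'a fls fls)"
    by (rule fls_eqI) (auto simp: map_fls_nth param_u_def h1)
  then show "lift2 param_u * in_u fps_X = (1 :: 'a fls fls)"
    by (simp only: u fls_X_inv_times_X)
  have "lift1 fls_X_inv = (fls_X_inv :: 'a fls)"
    by (rule fls_eqI) (auto simp: map_fls_nth)
  then have "lift2 param_v = (fls_const fls_X_inv :: 'a fls fls)"
    by (simp add: param_v_def map_fls_const h1)
  then show "lift2 param_v * in_v fps_X = (1 :: 'a fls fls)"
    by (simp only: in_v_def fps_X_to_fls fls_const_mult_const fls_X_inv_times_X fls_const_1)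
qed

lemma fps_X_cancel: "fps_X * f = fps_X * g \<Longrightarrow> f = (g :: 'a::ring_1 fps)"
proof (rule fps_ext)
  fix n assume "fps_X * f = fps_X * g"
  then have "fps_nth (fps_X * f) (Suc n) = fps_nth (fps_X * g) (Suc n)" by simp
  then show "fps_nth f n = fps_nth g n" by simp
qed

lemma subst_affine_X:
  assumes "a \<noteq> 0"
  shows "(cfps a + cfps b * fps_X) * subst_affine a b fps_X = (fps_X :: 'a::calgebra fps)"
proof -
  let ?s = "subst_fls a b :: 'a fls \<Rightarrow> _"
  have X: "central (fls_X :: 'a fls)"
    by (rule central_fls) (simp add: central_def)
  have "fps_to_fls (cfps a + cfps b * fps_X :: 'a fps) = ?s fls_X_inv * fls_X"
    by (simp add: subst_fls_X_inv[OF assms] distrib_right mult.assoc fls_X_inv_times_X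
        fls_times_fps_to_fls cfps_def of_C_fls_def)
  then have "fps_to_fls ((cfps a + cfps b * fps_X) * subst_affine a b fps_X :: 'a fps) = ?s fls_X_inv * fls_X * ?s fls_X"
    by (simp only: fls_times_fps_to_fls fps_to_fls_subst_affine[OF assms] fps_X_to_fls)
  also have "\<dots> = fls_X * ?s (fls_X_inv * fls_X)"
    by (simp only: is_homD(3)[OF is_hom_subst_fls[OF assms]] mult.assoc centralD3[OF X])
  also have "\<dots> = fls_X"
    by (simp only: fls_X_inv_times_X is_homD(1)[OF is_hom_subst_fls[OF assms]] mult_1_right)
  finally show ?thesis by (simp flip: fps_X_to_fls)
qed

text \<open>The RTT relation at v = a u + b with its denominator cleared; the factor on the left is
  (u - v)/u.\<close>

lemma RTT_eval:
  fixes T :: "'a::calgebra fps mat2" and a b :: complex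
  assumes T: "RTT T" and a: "a \<noteq> 0"
  defines "s \<equiv> subst_affine a b"
  shows "(cfps (1 - a) - cfps b * fps_X) * (T $ i $ j * s (T $ k $ l) - s (T $ k $ l) * T $ i $ j)
    = fps_X * (T $ k $ j * s (T $ i $ l) - s (T $ k $ j) * T $ i $ l)"
proof -
  define U V where "U = (map_fps fps_const :: 'a fps \<Rightarrow> 'a fps fps)" and "V = (fps_const :: 'a fps \<Rightarrow> 'a fps fps)"
  define D where "D = U (T $ i $ j) * V (T $ k $ l) - V (T $ k $ l) * U (T $ i $ j)"
  define E where "E = U (T $ k $ j) * V (T $ i $ l) - V (T $ k $ j) * U (T $ i $ l)"
  note emb = is_homD[OF is_hom_embed_uv]
  let ?x = "param_u - param_v"
  have U: "embed_uv (U f) = in_u f" and V: "embed_uv (V f) = in_v f" for f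
    by (simp_all add: U_def V_def embed_uv_u embed_uv_v)
  have X: "central (in_u (fps_X :: 'a fps))" "central (in_v (fps_X :: 'a fps))"
    by (intro central_fls; simp add: in_u_nth in_v_nth central_def)+
  have "embed_uv D = lift2 (1 / ?x) * embed_uv E"
    using T[unfolded rtt_defect_gl, THEN rttD, of i j k l] by (simp add: D_def E_def emb U V)
  then have "lift2 ?x * embed_uv D = lift2 (?x * (1 / ?x)) * embed_uv E"
    by (simp only: is_homD(3)[OF is_hom_lift2] mult.assoc)
  also have "?x * (1 / ?x) = 1"
    using param_neq_numeral(1) by (simp add: divide_simps)
  finally have *: "lift2 ?x * embed_uv D = embed_uv E"
    by (simp only: is_homD(1)[OF is_hom_lift2] mult_1_left)
  have "x * y * (p - q) = y * (p * x) - x * (q * y)" if "central x" "central y" for x y p q :: "'a fls fls"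
  proof -
    have "x * y * p = y * (p * x)" "x * y * q = x * (q * y)"
      by (metis that centralD mult.assoc)+
    then show ?thesis by (simp only: right_diff_distrib)
  qed
  from this[OF X, of "lift2 param_u" "lift2 param_v"]
  have "in_u fps_X * in_v fps_X * lift2 ?x =
      in_v fps_X * (lift2 param_u * in_u fps_X) - in_u fps_X * (lift2 param_v * in_v (fps_X :: 'a fps))"
    by (simp only: is_homD(5)[OF is_hom_lift2])
  \<comment> \<open>(u - v) / (u v) = 1/v - 1/u: after multiplication by u^-1 v^-1 only power series
    remain.\<close>
  then have **: "in_u fps_X * in_v fps_X * lift2 ?x = in_v fps_X - in_u (fps_X :: 'a fps)"
    by (simp only: param_times_X mult_1_right)
  have "embed_uv ((V fps_X - U fps_X) * D) = in_u fps_X * in_v fps_X * lift2 ?x * embed_uv D"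
    by (simp only: emb U V **)
  also have "\<dots> = embed_uv (U fps_X * V fps_X * E)"
    by (simp only: mult.assoc * emb U V)
  finally have "(V fps_X - U fps_X) * D = U fps_X * V fps_X * E"
    by (simp only: embed_uv_inject)
  then have "eval_v a b ((V fps_X - U fps_X) * D) = eval_v a b (U fps_X * V fps_X * E)" by simp
  moreover have "eval_v a b (U f) = f" "eval_v a b (V f) = s f" for f
    by (simp_all add: U_def V_def eval_v_u[OF a] eval_v_v s_def)
  ultimately have "(s fps_X - fps_X) * eval_v a b D = fps_X * s fps_X * eval_v a b E"
    by (simp only: is_homD[OF is_hom_eval_v[OF a]])
  moreover have D: "eval_v a b D = T $ i $ j * s (T $ k $ l) - s (T $ k $ l) * T $ i $ j"
    and E: "eval_v a b E = T $ k $ j * s (T $ i $ l) - s (T $ k $ j) * T $ i $ l"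
    by (simp_all add: D_def E_def U_def V_def is_homD[OF is_hom_eval_v[OF a]] eval_v_u[OF a] eval_v_v s_def)
  \<comment> \<open>\<open>w\<close> is v/u. Multiplying by it turns 1/v into 1/u and leaves a
    common factor u^-1 to cancel.\<close>
  moreover define w where "w = (cfps a + cfps b * fps_X :: 'a fps)"
  ultimately have "w * ((s fps_X - fps_X) * eval_v a b D) = w * (fps_X * s fps_X * eval_v a b E)"
    by simp
  moreover have ws: "w * s fps_X = fps_X" unfolding w_def s_def by (rule subst_affine_X[OF a])
  moreover have wX: "w * fps_X = fps_X * w" by (simp add: fps_mult_fps_X_commute)
  ultimately have "fps_X * ((1 - w) * eval_v a b D) = fps_X * (fps_X * eval_v a b E)"
  proof -
    have "w * ((s fps_X - fps_X) * eval_v a b D) = (w * s fps_X - w * fps_X) * eval_v a b D"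
      by (simp only: right_diff_distrib left_diff_distrib mult.assoc)
    also have "\<dots> = fps_X * ((1 - w) * eval_v a b D)"
      unfolding ws wX by (simp only: right_diff_distrib left_diff_distrib mult.assoc mult_1_left mult_1_right)
    finally have 1: "w * ((s fps_X - fps_X) * eval_v a b D) = fps_X * ((1 - w) * eval_v a b D)" .
    have "w * (fps_X * s fps_X * eval_v a b E) = (w * fps_X) * s fps_X * eval_v a b E"
      by (simp only: mult.assoc)
    also have "\<dots> = fps_X * (w * s fps_X) * eval_v a b E"
      unfolding wX by (simp only: mult.assoc)
    also have "\<dots> = fps_X * (fps_X * eval_v a b E)"
      unfolding ws by (simp only: mult.assoc)
    finally have 2: "w * (fps_X * s fps_X * eval_v a b E) = fps_X * (fps_X * eval_v a b E)" .
    assume "w * ((s fps_X - fps_X) * eval_v a b D) = w * (fps_X * s fps_X * eval_v a b E)"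
    with 1 2 show ?thesis by simp
  qed
  from fps_X_cancel[OF this] have "(1 - w) * eval_v a b D = fps_X * eval_v a b E" .
  moreover have "(1 :: 'a fps) - cfps a = cfps (1 - a)"
    using cfps_arith(4)[of 1 a] by simp
  then have "1 - w = cfps (1 - a) - cfps b * fps_X"
    by (simp add: w_def flip: diff_diff_eq)
  ultimately show ?thesis by (simp only: D E)
qed

section \<open>The quantum determinant\<close>

abbreviation adj :: "'a::ring_1 mat2 \<Rightarrow> 'a mat2" where "adj \<equiv> mtransp Minus"

lemma adj_entries [simp]:
  "adj A $ Neg $ Neg = A $ Pos $ Pos" "adj A $ Pos $ Pos = A $ Neg $ Neg"
  "adj A $ Neg $ Pos = - A $ Neg $ Pos" "adj A $ Pos $ Neg = - A $ Pos $ Neg"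
  by (simp_all add: mtransp_entry)

lemma msubst_simps:
  assumes "a \<noteq> 0"
  shows "msubst a b (A ** B) = msubst a b A ** msubst a b B"
    "msubst a b (mtransp s A) = mtransp s (msubst a b A)" "msubst a b (mat 1) = mat 1"
    "msubst a b (G_mat q) = G_mat q" "msubst a b (smul f A) = smul (subst_affine a b f) (msubst a b A)"
    "c \<noteq> 0 \<Longrightarrow> msubst a b (msubst c d A) = msubst (c * a) (c * b + d) A"
proof -
  note h = is_hom_subst_affine[OF assms]
  show "msubst a b (A ** B) = msubst a b A ** msubst a b B" by (rule map_matrix_mult[OF h])
  show "msubst a b (mtransp s A) = mtransp s (msubst a b A)" by (rule map_matrix_hom_simps(2)[OF h])
  show "msubst a b (mat 1) = mat 1" by (rule map_matrix_mat_1[OF h])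
  show "msubst a b (G_mat q) = G_mat q" by (rule map_matrix_hom_simps(5)[OF h])
  show "msubst a b (smul f A) = smul (subst_affine a b f) (msubst a b A)"
    by (rule map_matrix_hom_simps(1)[OF h])
  show "c \<noteq> 0 \<Longrightarrow> msubst a b (msubst c d A) = msubst (c * a) (c * b + d) A"
    using assms by (simp add: vec_eq_iff subst_affine_comp)
qed

lemma msubst_id [simp]: "msubst 1 0 A = A"
  by (simp add: vec_eq_iff)

text \<open>At v = u - 1 the factor u - v is 1 and R degenerates to I - P, the point at which the
  quantum determinant arises.\<close>

lemma RTT_eval_shift:
  fixes T :: "'a::calgebra fps mat2"
  assumes "RTT T"
  defines "s \<equiv> subst_affine 1 (-1)"
  shows "T $ i $ j * s (T $ k $ l) - s (T $ k $ l) * T $ i $ j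
    = T $ k $ j * s (T $ i $ l) - s (T $ k $ j) * T $ i $ l"
proof (rule fps_X_cancel)
  have "cfps (1 - 1) - cfps (- 1) * fps_X = (fps_X :: 'a fps)"
    by (simp add: cfps_arith(3)[symmetric, of 1])
  with RTT_eval[OF assms(1) one_neq_zero, where b = "-1" and i = i and j = j and k = k and l = l]
  show "fps_X * (T $ i $ j * s (T $ k $ l) - s (T $ k $ l) * T $ i $ j)
    = fps_X * (T $ k $ j * s (T $ i $ l) - s (T $ k $ j) * T $ i $ l)"
    by (simp only: s_def)
qed

lemma mat2_eqI:
  assumes "A $ Neg $ Neg = B $ Neg $ Neg" "A $ Neg $ Pos = B $ Neg $ Pos"
    "A $ Pos $ Neg = B $ Pos $ Neg" "A $ Pos $ Pos = B $ Pos $ Pos"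
  shows "A = (B :: 'a mat2)"
  using assms by (simp add: vec_eq_iff all_idx)

text \<open>Quantum form of A adj(A) = det(A): the relation within one row kills the off-diagonal
  entries, and the relation between the rows identifies the two diagonal ones.\<close>

lemma RTT_mult_adj:
  fixes T :: "'a::calgebra fps mat2"
  assumes "RTT T"
  shows "msubst 1 (-1) T ** adj T = smul (qdet T) (mat 1)"
proof -
  let ?s = "subst_affine 1 (-1)"
  have row: "?s (T $ i $ l) * T $ i $ j = ?s (T $ i $ j) * T $ i $ l" for i j l
    using RTT_eval_shift[OF assms, of i j i l] by simp
  have "?s (T $ Pos $ Pos) * T $ Neg $ Neg - ?s (T $ Pos $ Neg) * T $ Neg $ Pos = qdet T"
  proof -
    have swap: "x - p = z - w \<Longrightarrow> p - w = x - z" for x p z w :: "'a fps"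
      by (simp add: algebra_simps)
    from swap[OF RTT_eval_shift[OF assms, of Neg Neg Pos Pos]] swap[OF RTT_eval_shift[OF assms, of Pos Neg Neg Pos]]
    show ?thesis unfolding qdet_def by (metis minus_diff_eq)
  qed
  moreover have "?s (T $ Pos $ Neg) * T $ Pos $ Pos = ?s (T $ Pos $ Pos) * T $ Pos $ Neg" by (rule row)
  moreover have "?s (T $ Neg $ Neg) * T $ Neg $ Pos = ?s (T $ Neg $ Pos) * T $ Neg $ Neg" by (rule row)
  ultimately show ?thesis
    by (intro mat2_eqI) (simp_all add: mat_mult_entry2 mat_1_entry qdet_def algebra_simps)
qed

lemma RTT_mult_adj_shift:
  assumes "RTT T"
  shows "T ** adj (msubst 1 1 T) = smul (subst_affine 1 1 (qdet T)) (mat 1)"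
  using arg_cong[OF RTT_mult_adj[OF assms], of "msubst 1 1"] by (simp add: msubst_simps)

lemma rtt_inv_iff:
  assumes c: "central c"
  shows "factor1 A ** factor2 B ** RP (- c) = RP (- c) ** factor2 B ** factor1 A \<longleftrightarrow> rtt_inv c A B"
proof -
  have "factor1 A ** factor2 B ** RP (- c) = RP (- c) ** factor2 B ** factor1 A \<longleftrightarrow>
    (\<forall>i k j l. A $ i $ j * B $ k $ l + c * (A $ i $ l * B $ k $ j) =
      B $ k $ l * A $ i $ j + c * (B $ i $ l * A $ k $ j))"
    unfolding matrix_mul_assoc[symmetric, of "RP (- c)"]
    unfolding RP_mult mult_RP[OF central_uminus[OF c]]
    by (simp add: vec_eq_iff P_mat_mult mult_P_mat factor12_entry factor21_entry)
  also have "\<dots> \<longleftrightarrow> rtt_inv c A B"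
    unfolding rtt_inv_def by (auto simp: algebra_simps)
  finally show ?thesis .
qed

text \<open>
  As \<open>R(x)\<^sup>t\<close> is proportional to \<open>R(x - 1)\<^sup>-\<^sup>1\<close>, the product \<open>T\<^sub>1(u) T\<^sub>1(u + 1)\<^sup>t\<close>, which is scalar, can be
  moved through \<open>R(u - v)\<^sup>-\<^sup>1 T\<^sub>2(v)\<close>.
\<close>

lemma RTT_qdet_in_u:
  fixes T :: "'a::calgebra fps mat2"
  assumes T: "RTT T"
  defines "Q \<equiv> in_u (subst_affine 1 1 (qdet T))"
  shows "Q * in_v (T $ k $ l) = in_v (T $ k $ l) * Q"
proof -
  let ?x = "param_u - param_v"
  let ?c = "lift2 (1 / ?x) :: 'a fls fls"
  define A A' B where "A = map_matrix in_u T" and "A' = map_matrix in_u (msubst 1 1 T)"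
    and "B = map_matrix in_v T"
  have x: "?x + 1 \<noteq> 0" "?x + 1 \<noteq> 1"
    unfolding add_eq_0_iff2 using param_neq_numeral(1,3) by (blast, metis add_cancel_left_left)
  have r: "rtt ?c A B" using T by (simp add: rtt_defect_gl A_def B_def)
  obtain e where "e * (1 - ?c * ?c) = 1"
    using lift2_unit[OF param_neq_numeral(1-3)] by blast
  from rtt_imp_rtt_inv[OF r this]
  have 1: "factor1 A ** factor2 B ** RP (- ?c) = RP (- ?c) ** factor2 B ** factor1 A"
    by (simp only: rtt_inv_iff[OF central_lift2])
  have one: "1 \<noteq> (0 :: complex)" by simp
  have "subst_uv 1 1 1 0 ?x = ?x + 1"
    unfolding is_homD(5)[OF is_hom_subst_uv[OF one one]] subst_uv_param[OF one one] by simp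
  then have "subst_uv 1 1 1 0 (1 / ?x) = 1 / (?x + 1)"
    by (simp only: is_hom_inverse(2)[OF is_hom_subst_uv[OF one one]] is_homD(1)[OF is_hom_subst_uv[OF one one]])
  with rtt_series_subst[OF one one r[unfolded A_def B_def], of 1 0]
  have "rtt (lift2 (1 / (?x + 1))) A' B" by (simp only: A'_def B_def msubst_id)
  from rtt_transp1[OF central_lift2 this]
  have 2: "factor1 (adj A') ** RQ Minus (lift2 (1 / (?x + 1))) ** factor2 B
      = factor2 B ** RQ Minus (lift2 (1 / (?x + 1))) ** factor1 (adj A')" .
  define d where "d = ?x / (?x + 1)"
  have d: "d \<noteq> 0" using x param_neq_numeral(1) by (simp add: d_def)
  have "RQ Minus (1 / (?x + 1)) = smul d (RP (- (1 / ?x)))"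
    using RQ_Minus_eq[OF x] by (simp add: d_def minus_divide_right)
  from arg_cong[OF this, of "map_matrix lift2"]
  have RQ: "RQ Minus (lift2 (1 / (?x + 1))) = smul (lift2 d) (RP (- ?c))"
    by (simp only: map_matrix_hom_simps(1)[OF is_hom_lift2] map_matrix_RP[OF is_hom_lift2] is_homD(6)[OF is_hom_lift2])
  have 3: "factor1 (adj A') ** RP (- ?c) ** factor2 B = factor2 B ** RP (- ?c) ** factor1 (adj A')"
    using 2 unfolding RQ smul_mult_left smul_mult_right[OF central_lift2]
    by (simp only: smul_cancel_iff[OF lift2_inverse[OF d]])
  have "A ** adj A' = map_matrix in_u (T ** adj (msubst 1 1 T))"
    by (simp only: A_def A'_def map_matrix_mult[OF is_hom_in_u] map_matrix_hom_simps(2)[OF is_hom_in_u])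
  then have AadjA: "A ** adj A' = smul Q (mat 1)"
    by (simp only: RTT_mult_adj_shift[OF T] map_matrix_hom_simps(1)[OF is_hom_in_u]
        map_matrix_mat_1[OF is_hom_in_u] Q_def)
  then have AA': "factor1 A ** factor1 (adj A') = smul Q (mat 1)"
  proof -
    have "factor1 (smul Q (mat 1)) = smul Q (mat 1)"
      by (auto simp: vec_eq_iff factor1_entry mat_1_entry)
    with AadjA show ?thesis by (simp only: factor1_mult[symmetric])
  qed
  define M where "M = RP (- ?c) ** factor2 B"
  have "factor1 A ** factor1 (adj A') ** M = factor1 A ** (factor1 (adj A') ** RP (- ?c) ** factor2 B)"
    by (simp only: M_def matrix_mul_assoc)
  also have "\<dots> = factor1 A ** factor2 B ** RP (- ?c) ** factor1 (adj A')"
    unfolding 3 by (simp only: matrix_mul_assoc)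
  also have "\<dots> = M ** (factor1 A ** factor1 (adj A'))"
    unfolding 1 by (simp only: M_def matrix_mul_assoc)
  finally have "smul Q M = M ** smul Q (mat 1)"
    unfolding AA' by (simp add: smul_mult_left)
  \<comment> \<open>In this entry the term with P vanishes, because its indices in the first tensor
    factor differ.\<close>
  then have "smul Q M $ (opp k, k) $ (opp k, l) = (M ** smul Q (mat 1)) $ (opp k, k) $ (opp k, l)"
    by simp
  moreover have "M $ (opp k, k) $ (opp k, l) = B $ k $ l"
    by (cases k) (simp_all add: M_def RP_mult P_mat_mult factor2_entry)
  moreover have "(M ** smul Q (mat 1)) $ p $ q = M $ p $ q * Q" for p q
    by (cases "fst q"; cases "snd q"; cases q) (simp_all add: mat_mult_entry4 mat_1_entry)
  ultimately show ?thesis by (simp add: B_def)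
qed

lemma subalg_commutant: "subalg {x. x * z = z * x}"
proof -
  have "x * y * z = z * (x * y)" if "x * z = z * x" "y * z = z * y" for x y
    by (metis that mult.assoc)
  then show ?thesis
    unfolding subalg_def by (auto simp only: of_C_central distrib_left distrib_right mem_Collect_eq)
qed

text \<open>The previous lemma speaks of the quantum determinant at u + 1. The translation is undone
  inside the commutant of a coefficient, which is a subalgebra.\<close>

lemma RTT_qdet_commute:
  fixes T :: "'a::calgebra fps mat2"
  assumes T: "RTT T"
  shows "fps_nth (qdet T) m * fps_nth (T $ k $ l) n = fps_nth (T $ k $ l) n * fps_nth (qdet T) m"
proof -
  define q where "q = subst_affine 1 1 (qdet T)"
  let ?C = "{z. z * fps_nth (T $ k $ l) n = fps_nth (T $ k $ l) n * z}"
  have "embed_uv (map_fps fps_const q * fps_const (T $ k $ l)) = embed_uv (fps_const (T $ k $ l) * map_fps fps_const q)"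
    using RTT_qdet_in_u[OF T, of k l]
    by (simp only: is_homD(3)[OF is_hom_embed_uv] embed_uv_u embed_uv_v q_def)
  then have *: "map_fps fps_const q * fps_const (T $ k $ l) = fps_const (T $ k $ l) * map_fps fps_const q"
    by (simp only: embed_uv_inject)
  have "fps_nth q m * fps_nth (T $ k $ l) n = fps_nth (T $ k $ l) n * fps_nth q m" for m
    using arg_cong[OF *, of "\<lambda>F. fps_nth (fps_nth F m) n"] by simp
  then have "fps_in ?C q" by (simp add: fps_in_def)
  then have "fps_in ?C (qdet T)"
    unfolding q_def by (simp only: fps_in_subst_iff[OF subalg_commutant one_neq_zero])
  then show ?thesis by (simp add: fps_in_def)
qed

lemma palg_generated:
  assumes A: "subalg A" and gen: "\<And>g. palg_gen g \<in> A"
  shows "(x :: 'p::presentation palg) \<in> A"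
proof -
  note abs = is_homD[OF is_alg_homD(1)[OF is_alg_hom_abs_palg[where 'p = 'p]]]
  have "abs_palg y \<in> A" for y
  proof (induction y rule: poly_mapping_add_single_induct)
    case zero
    show ?case by (simp add: abs subalgD[OF A])
  next
    case (add f k v)
    have w: "abs_palg (Poly_Mapping.single (Word xs) v) \<in> A" for xs
    proof (induction xs)
      case Nil
      have "Poly_Mapping.single (Word []) v = (of_C v :: free_alg)"
        by (simp add: of_C_poly_mapping_def of_C_complex_def zero_free_word_def)
      then show ?case
        by (simp add: is_alg_homD(2)[OF is_alg_hom_abs_palg] subalgD[OF A])
    next
      case (Cons a xs)
      have "Poly_Mapping.single (Word (a # xs)) v = free_gen a * Poly_Mapping.single (Word xs) v"
        by (simp add: free_gen_def mult_single)
      then show ?case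
        using Cons gen[of a] by (simp add: abs palg_gen.abs_eq subalgD[OF A])
    qed
    obtain xs where "k = Word xs" by (cases k)
    with add w show ?case by (simp add: abs subalgD[OF A])
  qed
  from this[of "rep_palg x"] show ?thesis by simp
qed

lemma T_gen_nth_Suc: "fps_nth (T_gen $ i $ j) (Suc n) = palg_gen (i, j, n)"
  by (simp add: T_gen_def gen_matrix_nth)

lemma qdet_central:
  assumes "RTT (T_gen :: 'p::presentation palg fps mat2)"
  shows "fps_in {z. central z} (qdet (T_gen :: 'p palg fps mat2))"
  unfolding fps_in_def mem_Collect_eq central_def
proof (intro allI)
  fix n and x :: "'p palg"
  let ?z = "fps_nth (qdet (T_gen :: 'p palg fps mat2)) n"
  let ?C = "{x. x * ?z = ?z * x}"
  have "palg_gen g \<in> ?C" for g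
    using RTT_qdet_commute[OF assms, of n "fst g" "fst (snd g)" "Suc (snd (snd g))"]
    by (simp add: T_gen_nth_Suc)
  from palg_generated[OF subalg_commutant this] show "?z * x = x * ?z" by simp
qed

section \<open>Inverse matrices\<close>

text \<open>Block inversion by the Schur complement s = d - c a^-1 b. The entries do not commute, so
  the adjugate gives no inverse.\<close>

lemma mat2_invertible:
  fixes N :: "'a::calgebra fps mat2"
  assumes "lead N = mat 1"
  shows "\<exists>M. N ** M = mat 1 \<and> M ** N = mat 1"
proof -
  define a b c d where "a = N $ Neg $ Neg" and "b = N $ Neg $ Pos" and "c = N $ Pos $ Neg" and "d = N $ Pos $ Pos"
  have l: "fps_nth a 0 = 1" "fps_nth b 0 = 0" "fps_nth c 0 = 0" "fps_nth d 0 = 1"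
    by (simp_all add: a_def b_def c_def d_def lead_entry assms mat_1_entry)
  have A: "subalg (UNIV :: 'a set)" by (simp add: subalg_def)
  have inv: "\<exists>y. x * y = 1 \<and> y * x = 1" if "fps_nth x 0 = 1" for x :: "'a fps"
    using fps_in_inverse[OF A, of x 1] that by (auto simp: fps_in_def)
  obtain a' where a': "a * a' = 1" "a' * a = 1" using inv[OF l(1)] by blast
  define s where "s = d - c * a' * b"
  have "fps_nth s 0 = 1" by (simp add: s_def l)
  from inv[OF this] obtain s' where s': "s * s' = 1" "s' * s = 1" by blast
  have d: "d = s + c * (a' * b)" by (simp add: s_def mult.assoc)
  have canc: "a * (a' * x) = x" "a' * (a * x) = x" "s * (s' * x) = x" "s' * (s * x) = x" for x
    by (simp_all add: a' s' flip: mult.assoc)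
  define M :: "'a fps mat2" where "M = (\<chi> i j. case i of
     Neg \<Rightarrow> (case j of Neg \<Rightarrow> a' + a' * (b * (s' * (c * a'))) | Pos \<Rightarrow> - (a' * (b * s')))
   | Pos \<Rightarrow> (case j of Neg \<Rightarrow> - (s' * (c * a')) | Pos \<Rightarrow> s'))"
  have M: "M $ Neg $ Neg = a' + a' * (b * (s' * (c * a')))" "M $ Neg $ Pos = - (a' * (b * s'))"
    "M $ Pos $ Neg = - (s' * (c * a'))" "M $ Pos $ Pos = s'"
    by (simp_all add: M_def)
  have N: "N $ Neg $ Neg = a" "N $ Neg $ Pos = b" "N $ Pos $ Neg = c" "N $ Pos $ Pos = s + c * (a' * b)"
    using d by (simp_all add: a_def b_def c_def d_def)
  have "N ** M = mat 1" "M ** N = mat 1"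
    by (rule mat2_eqI; simp add: mat_mult_entry2 mat_1_entry M N distrib_left distrib_right mult.assoc canc a' s')+
  then show ?thesis by blast
qed

lemma mat_inverse_unique:
  assumes "N ** M = mat 1" "M' ** N = mat 1"
  shows "M' = (M :: 'a::ring_1 ^ 'n ^ 'n)"
  by (metis assms matrix_mul_assoc matrix_mul_lid matrix_mul_rid)

lemma matrix_inv_eqI:
  assumes "N ** M = mat 1" "M ** N = mat 1"
  shows "matrix_inv N = (M :: 'a::ring_1 ^ 'n ^ 'n)"
proof -
  have "N ** matrix_inv N = mat 1 \<and> matrix_inv N ** N = mat 1"
    unfolding matrix_inv_def by (rule someI[of _ M]) (use assms in blast)
  then show ?thesis using mat_inverse_unique[OF assms(1)] by blast
qed

lemma matrix_inv_lead_1: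
  fixes N :: "'a::calgebra fps mat2"
  assumes "lead N = mat 1"
  shows "N ** matrix_inv N = mat 1" "matrix_inv N ** N = mat 1"
  using mat2_invertible[OF assms] matrix_inv_eqI by metis+

text \<open>Constant term I guarantees a two-sided inverse, so a right inverse already determines
  \<open>matrix_inv\<close>, which is defined by choice.\<close>

lemma matrix_inv_right_unique:
  fixes N :: "'a::calgebra fps mat2"
  assumes "lead N = mat 1" "N ** M = mat 1"
  shows "matrix_inv N = M"
  by (rule mat_inverse_unique[OF assms(2) matrix_inv_lead_1(2)[OF assms(1)]])

lemma lead_T_gen [simp]: "lead T_gen = mat 1"
  by (simp add: T_gen_def)

lemma lead_msubst [simp]: "a \<noteq> 0 \<Longrightarrow> lead (msubst a b N) = lead N"
  by (simp add: lead_def vec_eq_iff)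

lemma lead_mult: "lead (A ** B) = lead A ** lead B"
  by (simp add: lead_def vec_eq_iff mat_mult_entry2)

lemma lead_mtransp: "lead (mtransp s A) = mtransp s (lead A)"
proof -
  have "fps_nth (theta s i j * x) 0 = theta s i j * fps_nth x 0" for i j and x :: "'a fps"
    by (cases s; cases i; cases j) simp_all
  then show ?thesis by (simp add: lead_def vec_eq_iff mtransp_def)
qed

lemma lead_G_mat [simp]: "lead (G_mat q) = G_mat q"
  by (cases q) (simp_all add: lead_def vec_eq_iff mat_1_entry K_mat_def unit_mat_def)

lemma mtransp_mat_1 [simp]: "mtransp s (mat 1) = mat 1"
proof -
  have "mtransp s (mat 1) $ i $ j = mat 1 $ i $ j" for i j
    by (cases s; cases i; cases j) (simp_all add: mtransp_entry mat_1_entry)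
  then show ?thesis unfolding vec_eq_iff by blast
qed

section \<open>Isomorphisms with the twisted Yangians of type A\<close>

lemma alg_hom_on_UNIV: "alg_hom_on UNIV f \<longleftrightarrow> is_alg_hom f"
proof -
  have "f 1 = 1" if "\<forall>c. f (of_C c) = of_C c"
    using that[rule_format, of 1] by simp
  then show ?thesis by (auto simp: alg_hom_on_def is_alg_hom_def is_hom_def)
qed

lemma alg_hom_sending_iff: "alg_hom_sending M N f \<longleftrightarrow> is_alg_hom f \<and> mmap f M = N"
  by (simp add: alg_hom_sending_def alg_hom_on_UNIV)

lemma is_alg_hom_on: "is_alg_hom f \<Longrightarrow> alg_hom_on A f"
  by (simp add: alg_hom_on_def is_alg_hom_def is_hom_def)

lemma mmap_comp: "mmap (\<lambda>x. f (g x)) M = mmap f (mmap g M)"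
  by (simp add: vec_eq_iff fps_eq_iff)

lemma mmap_ident [simp]: "mmap (\<lambda>x. x) M = M"
  by (simp add: vec_eq_iff fps_eq_iff)

lemma is_alg_hom_ident: "is_alg_hom (\<lambda>x. x)"
  by (simp add: is_alg_hom_def is_hom_def)

lemma palg_hom_ident:
  fixes f :: "'p::presentation palg \<Rightarrow> 'p palg"
  assumes "is_alg_hom f" "mmap f (St_gen q) = St_gen q"
  shows "f x = x"
  using palg_hom_unique[OF assms(1) is_alg_hom_ident, of q] assms(2) by (metis mmap_ident)

lemma palg_hom_inverse:
  fixes f :: "'p::presentation palg \<Rightarrow> 'r::presentation palg"
  assumes f: "is_alg_hom f" and g: "is_alg_hom g"
    and "mmap f (mmap g (St_gen q)) = St_gen q" "mmap g (mmap f (St_gen q')) = St_gen q'"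
  shows "f (g y) = y" "g (f x) = x"
proof -
  show "f (g y) = y"
    using palg_hom_ident[OF is_alg_hom_comp[OF f g], of q y] assms(3) by (simp add: mmap_comp)
  show "g (f x) = x"
    using palg_hom_ident[OF is_alg_hom_comp[OF g f], of q' x] assms(4) by (simp add: mmap_comp)
qed

lemmas palg_hom_inverse_T = palg_hom_inverse[where q = SP2_SP2 and q' = SP2_SP2, folded T_gen_eq]

lemma scale_arith: "1/2 \<noteq> (0::complex)" "2 \<noteq> (0::complex)" "-1 \<noteq> (0::complex)"
  by simp_all

lemma X_sp2_iso_Y2:
  "\<exists>(f :: X_sp2 \<Rightarrow> Y2) (g :: Y2 \<Rightarrow> X_sp2). is_alg_hom f \<and> is_alg_hom g \<and>
    mmap f T_gen = msubst (1/2) 0 T_gen \<and> (\<forall>x. g (f x) = x) \<and> (\<forall>y. f (g y) = y)"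
proof -
  obtain f :: "X_sp2 \<Rightarrow> Y2" where f: "is_alg_hom f" "mmap f T_gen = msubst (1/2) 0 T_gen"
    using X_sp2_hom[OF _ RTT_sp_of_RTT[OF Y2_RTT]] by auto
  obtain g :: "Y2 \<Rightarrow> X_sp2" where g: "is_alg_hom g" "mmap g T_gen = msubst 2 0 T_gen"
    using Y2_hom[OF _ RTT_of_RTT_sp[OF X_sp2_RTT]] by auto
  have "mmap f (mmap g T_gen) = T_gen" "mmap g (mmap f T_gen) = T_gen"
    by (simp_all add: f g mmap_simps(6) msubst_simps)
  with palg_hom_inverse_T[OF f(1) g(1)] f g show ?thesis by blast
qed

lemma subst_affine_eq_1_iff: "a \<noteq> 0 \<Longrightarrow> subst_affine a b f = 1 \<longleftrightarrow> f = 1"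
proof
  assume a: "a \<noteq> 0" and "subst_affine a b f = 1"
  then have "subst_affine (1/a) (- b / a) (subst_affine a b f) = 1" by simp
  then show "f = 1" using subst_affine_comp[of "1/a" a "- b / a" b f] a by simp
qed simp

lemma Y_sp2_iso_SY2:
  "\<exists>(f :: Y_sp2 \<Rightarrow> SY2) (g :: SY2 \<Rightarrow> Y_sp2). is_alg_hom f \<and> is_alg_hom g \<and>
    mmap f T_gen = msubst (1/2) 0 T_gen \<and> (\<forall>x. g (f x) = x) \<and> (\<forall>y. f (g y) = y)"
proof -
  let ?T = "T_gen :: SY2 fps mat2"
  have "?T ** adj (msubst 1 1 ?T) = mat 1"
    using RTT_mult_adj_shift[OF SY2_RTT] by (simp add: SY2_qdet)
  from arg_cong[OF this, of "msubst (1/2) 0"]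
  have "msubst (1/2) 0 ?T ** adj (msubst 1 2 (msubst (1/2) 0 ?T)) = mat 1"
    by (simp add: msubst_simps)
  then obtain f :: "Y_sp2 \<Rightarrow> SY2" where f: "is_alg_hom f" "mmap f T_gen = msubst (1/2) 0 T_gen"
    using Y_sp2_hom[OF _ RTT_sp_of_RTT[OF SY2_RTT]] by auto
  let ?T = "T_gen :: Y_sp2 fps mat2"
  note rtt = RTT_of_RTT_sp[OF Y_sp2_RTT]
  \<comment> \<open>The unit relation of Y(sp_2) at 2u; by \<open>RTT_mult_adj_shift\<close> its
    left side is the quantum determinant at u + 1.\<close>
  have "msubst 2 0 ?T ** adj (msubst 1 1 (msubst 2 0 ?T)) = mat 1"
    using arg_cong[OF Y_sp2_unit, of "msubst 2 0"] by (simp add: msubst_simps)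
  then have "smul (subst_affine 1 1 (qdet (msubst 2 0 ?T))) (mat 1) = (mat 1 :: _ mat2)"
    unfolding RTT_mult_adj_shift[OF rtt] .
  from arg_cong[OF this, of "\<lambda>M. M $ Neg $ Neg"]
  have "subst_affine 1 1 (qdet (msubst 2 0 ?T)) = 1" by (simp add: mat_1_entry)
  then have "qdet (msubst 2 0 ?T) = 1" by (simp add: subst_affine_eq_1_iff)
  then obtain g :: "SY2 \<Rightarrow> Y_sp2" where g: "is_alg_hom g" "mmap g T_gen = msubst 2 0 T_gen"
    using SY2_hom[OF _ rtt] by auto
  have "mmap f (mmap g T_gen) = T_gen" "mmap g (mmap f T_gen) = T_gen"
    by (simp_all add: f g mmap_simps(6) msubst_simps)
  with palg_hom_inverse_T[OF f(1) g(1)] f g show ?thesis by blast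
qed

lemma Xt_iso_Yt:
  assumes p: "relators TYPE('p::presentation) = Xt_relators q"
    and r: "relators TYPE('r::presentation) = Yt_relators (pair_sign q)"
  shows "\<exists>(f :: 'p palg \<Rightarrow> 'r palg) (g :: 'r palg \<Rightarrow> 'p palg). is_alg_hom f \<and> is_alg_hom g \<and>
    mmap f (St_gen q) = msubst (1/2) (-1/2) T_gen ** G_mat q \<and> (\<forall>x. g (f x) = x) \<and> (\<forall>y. f (g y) = y)"
proof -
  obtain f :: "'p palg \<Rightarrow> 'r palg" where f: "is_alg_hom f" "mmap f (St_gen q) = msubst (1/2) (-1/2) T_gen ** G_mat q"
    using Xt_hom[OF p _ REFL_sp_of_REFL_gl[OF Yt_REFL[OF r]]] by (auto simp: lead_mult)
  have "lead (msubst 2 1 (St_gen q :: 'p palg fps mat2) ** G_mat q) = mat 1"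
    by (simp add: lead_mult St_gen_def)
  then obtain g :: "'r palg \<Rightarrow> 'p palg" where g: "is_alg_hom g" "mmap g T_gen = msubst 2 1 (St_gen q) ** G_mat q"
    using Yt_hom[OF r _ REFL_gl_of_REFL_sp[OF Xt_REFL[OF p]]] by blast
  have "mmap f (mmap g T_gen) = T_gen" "mmap g (mmap f (St_gen q)) = St_gen q"
    by (simp_all add: f g mmap_simps msubst_simps flip: matrix_mul_assoc)
  with palg_hom_inverse[OF f(1) g(1), of SP2_SP2, folded T_gen_eq] f g show ?thesis by blast
qed

subsection \<open>Subalgebras generated by the entries of a matrix\<close>

abbreviation entry_alg :: "'a::calgebra fps mat2 \<Rightarrow> 'a set" where
  "entry_alg M \<equiv> subalgebra_gen (series_coeffs M)"

definition mat_in :: "'a::calgebra set \<Rightarrow> 'a fps mat2 \<Rightarrow> bool" where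
  "mat_in A M \<longleftrightarrow> (\<forall>i j. fps_in A (M $ i $ j))"

lemma mat_inD: "mat_in A M \<Longrightarrow> fps_in A (M $ i $ j)"
  by (simp add: mat_in_def)

lemma mat_in_iff: "mat_in A M \<longleftrightarrow> series_coeffs M \<subseteq> A"
  unfolding mat_in_def fps_in_def series_coeffs_def by blast

lemma mat_in_entry_alg: "mat_in (entry_alg M) M"
  unfolding mat_in_iff by (blast intro: subalgebra_gen.gen)

lemma entry_alg_subset: "subalg A \<Longrightarrow> mat_in A M \<Longrightarrow> entry_alg M \<subseteq> A"
  by (simp add: mat_in_iff subalgebra_gen_least)

lemma entry_alg_eqI: "mat_in (entry_alg M) N \<Longrightarrow> mat_in (entry_alg N) M \<Longrightarrow> entry_alg M = entry_alg N"
  by (simp add: entry_alg_subset subalg_subalgebra_gen subset_antisym)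

lemma mat_in_intros:
  assumes A: "subalg A"
  shows "mat_in A M \<Longrightarrow> mat_in A N \<Longrightarrow> mat_in A (M ** N)"
    "a \<noteq> 0 \<Longrightarrow> mat_in A M \<Longrightarrow> mat_in A (msubst a b M)"
    "mat_in A M \<Longrightarrow> mat_in A (mtransp s M)" "mat_in A (G_mat q)"
    "fps_in A f \<Longrightarrow> mat_in A M \<Longrightarrow> mat_in A (smul f M)"
    "mat_in A M \<Longrightarrow> mat_in A N \<Longrightarrow> mat_in A (M + N)"
    "mat_in A M \<Longrightarrow> mat_in A N \<Longrightarrow> mat_in A (M - N)"
proof -
  note c = fps_in_intros[OF A]
  show "mat_in A M \<Longrightarrow> mat_in A N \<Longrightarrow> mat_in A (M ** N)"
    by (simp add: mat_in_def mat_mult_entry2 c)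
  show "a \<noteq> 0 \<Longrightarrow> mat_in A M \<Longrightarrow> mat_in A (msubst a b M)"
    by (simp add: mat_in_def c)
  have "fps_in A (theta s i j * x)" if "fps_in A x" for i j x
    using that by (cases s; cases i; cases j) (simp_all add: c)
  then show "mat_in A M \<Longrightarrow> mat_in A (mtransp s M)"
    by (simp add: mat_in_def mtransp_entry)
  have "fps_in A (sgn_idx i)" for i by (cases i) (simp_all add: c)
  then show "mat_in A (G_mat q)"
    by (cases q) (simp_all add: mat_in_def K_mat_entry mat_1_entry c)
  show "fps_in A f \<Longrightarrow> mat_in A M \<Longrightarrow> mat_in A (smul f M)"
    "mat_in A M \<Longrightarrow> mat_in A N \<Longrightarrow> mat_in A (M + N)"
    "mat_in A M \<Longrightarrow> mat_in A N \<Longrightarrow> mat_in A (M - N)"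
    by (simp_all add: mat_in_def c)
qed

lemmas mat_in_entry_alg_intros = mat_in_intros[OF subalg_subalgebra_gen]

lemma subst_affine_inverse:
  "a \<noteq> 0 \<Longrightarrow> subst_affine (1/a) (- b / a) (subst_affine a b f) = f"
  using subst_affine_comp[of "1/a" a "- b / a" b f] by simp

text \<open>An affine substitution expresses each coefficient as a finite linear combination of the
  old ones, and it is invertible.\<close>

lemma entry_alg_msubst:
  assumes "a \<noteq> 0"
  shows "entry_alg (msubst a b M) = entry_alg M"
proof (rule entry_alg_eqI)
  have "msubst (1/a) (- b / a) (msubst a b M) = M"
    by (simp only: vec_eq_iff nth_map_matrix subst_affine_inverse[OF assms]) simp
  then show "mat_in (entry_alg (msubst a b M)) M"
    using mat_in_entry_alg_intros(2)[OF _ mat_in_entry_alg, of "1/a" "msubst a b M" "- b / a"] assms by simp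
  show "mat_in (entry_alg M) (msubst a b M)"
    using assms by (intro mat_in_entry_alg_intros mat_in_entry_alg)
qed

lemma entry_alg_mult_G: "entry_alg (M ** G_mat q) = entry_alg M"
proof (rule entry_alg_eqI)
  have "mat_in (entry_alg (M ** G_mat q)) (M ** G_mat q ** G_mat q)"
    by (intro mat_in_entry_alg_intros mat_in_entry_alg)
  then show "mat_in (entry_alg (M ** G_mat q)) M" by (simp flip: matrix_mul_assoc)
  show "mat_in (entry_alg M) (M ** G_mat q)"
    by (intro mat_in_entry_alg_intros mat_in_entry_alg)
qed

lemma hom_image_entry_alg:
  assumes f: "is_alg_hom f"
  shows "f ` entry_alg M = entry_alg (mmap f M)"
proof
  note h = is_homD[OF is_alg_homD(1)[OF f]]
  have "subalg (f -` entry_alg (mmap f M))"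
    using subalgD[OF subalg_subalgebra_gen[of "series_coeffs (mmap f M)"]]
    by (auto simp: subalg_def h is_alg_homD(2)[OF f])
  moreover have "mat_in (f -` entry_alg (mmap f M)) M"
    using mat_in_entry_alg[of "mmap f M"] by (simp add: mat_in_def fps_in_def)
  ultimately show "f ` entry_alg M \<subseteq> entry_alg (mmap f M)"
    using entry_alg_subset by blast
  have "subalg (f ` entry_alg M)"
    unfolding subalg_def
  proof (intro conjI ballI subsetI)
    fix x :: 'b assume "x \<in> range of_C"
    then show "x \<in> f ` entry_alg M"
      using is_alg_homD(2)[OF f] subalgebra_gen.scalar by (metis imageE imageI)
  next
    fix x y assume "x \<in> f ` entry_alg M" "y \<in> f ` entry_alg M"
    then obtain x' y' where "x = f x'" "y = f y'" "x' \<in> entry_alg M" "y' \<in> entry_alg M" by blast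
    then show "x + y \<in> f ` entry_alg M" "x * y \<in> f ` entry_alg M"
      by (metis h(2,3) imageI subalgebra_gen.add subalgebra_gen.mult)+
  qed
  moreover have "mat_in (f ` entry_alg M) (mmap f M)"
    using mat_in_entry_alg[of M] by (simp add: mat_in_def fps_in_def)
  ultimately show "entry_alg (mmap f M) \<subseteq> f ` entry_alg M"
    by (rule entry_alg_subset)
qed

lemma mtransp_G_mat: "G_mat q ** adj A = mtransp (pair_sign q) A ** G_mat q"
proof (cases q)
  case SP2_GL1
  have "(K_mat ** adj A) $ i $ j = (mtransp Plus A ** K_mat) $ i $ j" for i j
    by (cases i; cases j) (simp_all add: mat_mult_entry2 K_mat_entry mtransp_entry)
  then show ?thesis unfolding SP2_GL1 vec_eq_iff by simp
qed simp

text \<open>The built-in arguments u - 1 and -u + 1 are opposite, and halving them gives (u-1)/2 and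
  its negative: the type A product at (u-1)/2, once G has been moved through the
  transposition.\<close>

lemma S_sp_eq:
  "S_sp q (msubst (1/2) 0 T) = msubst (1/2) (-1/2) (S_gl (pair_sign q) T) ** G_mat q"
  by (simp add: S_sp_def S_gl_def msubst_simps mtransp_G_mat flip: matrix_mul_assoc)

lemma mmap_S:
  assumes "is_alg_hom f"
  shows "mmap f (S_sp q T) = S_sp q (mmap f T)" "mmap f (S_gl s T) = S_gl s (mmap f T)"
  by (simp_all add: S_sp_def S_gl_def mmap_simps[OF assms])

lemma alg_iso_entry_alg:
  assumes f: "is_alg_hom f" and "\<And>x. g (f x) = x"
  shows "alg_iso (entry_alg M) (entry_alg (mmap f M)) f"
proof -
  have "inj f" by (rule inj_on_inverseI) (rule assms)
  then show ?thesis
    by (auto simp: alg_iso_def is_alg_hom_on[OF f] bij_betw_def hom_image_entry_alg[OF f] intro: inj_on_subset)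
qed

lemma lead_S_gl: "lead T = mat 1 \<Longrightarrow> lead (S_gl s T) = mat 1"
  by (simp add: S_gl_def lead_mult lead_mtransp)

section \<open>The central series of the extended algebras\<close>

text \<open>The sign with which the transposition of type \<open>pair_sign q\<close> acts on G: it
  fixes I and negates K.\<close>

fun pair_eps :: "sym_pair \<Rightarrow> 'a::ring_1" where
  "pair_eps SP2_SP2 = 1"
| "pair_eps SP2_GL1 = - 1"

lemma central_pair_eps: "central (pair_eps q)"
  by (cases q) (simp_all add: central_def)

lemma Q_mat_G:
  "factor1 (G_mat q) ** Q_mat Minus = Q_mat (pair_sign q) ** factor1 (G_mat q)"
  "Q_mat (pair_sign q) ** factor1 (G_mat q) = smul (pair_eps q) (Q_mat (pair_sign q) ** factor2 (G_mat q))"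
proof -
  have "factor1 K_mat ** Q_mat Minus = Q_mat Plus ** factor1 K_mat"
    "Q_mat Plus ** factor1 K_mat = smul (- 1) (Q_mat Plus ** factor2 K_mat)"
    by (rule mat4_eqI, rename_tac i k j l, case_tac i; case_tac k; case_tac j; case_tac l,
      simp_all add: mat_mult_entry4 Q_mat_entry factor1_entry factor2_entry K_mat_entry)+
  then show "factor1 (G_mat q) ** Q_mat Minus = Q_mat (pair_sign q) ** factor1 (G_mat q)"
    "Q_mat (pair_sign q) ** factor1 (G_mat q) = smul (pair_eps q) (Q_mat (pair_sign q) ** factor2 (G_mat q))"
    by (cases q; simp add: factor_1)+
qed

lemma factor_G_sq: "factor2 (G_mat q) ** factor2 (G_mat q) = mat 1" "factor1 (G_mat q) ** factor1 (G_mat q) = mat 1"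
  by (simp_all add: factor_1 flip: factor1_mult factor2_mult)

text \<open>Models S = X G with inverse G Y. Against Q the factor \<open>G_1\<close> is traded for
  \<open>G_2\<close> at the cost of a sign; then \<open>G_1 G_2\<close> passes R, and
  \<open>G_2\<close> cancels the one in front of \<open>Y\<close>.\<close>

lemma Q_twist:
  "factor1 (G_mat q) ** (Q_mat Minus ** factor1 (X ** G_mat q) ** RP r ** factor2 (G_mat q ** Y))
   = smul (pair_eps q) (Q_mat (pair_sign q) ** factor1 X ** RP r ** factor2 Y) ** factor1 (G_mat q)"
proof -
  let ?G1 = "factor1 (G_mat q)" and ?G2 = "factor2 (G_mat q)" and ?Q = "Q_mat (pair_sign q)"
  have "?G1 ** (Q_mat Minus ** factor1 (X ** G_mat q) ** RP r ** factor2 (G_mat q ** Y))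
      = (?G1 ** Q_mat Minus) ** factor1 X ** ?G1 ** RP r ** ?G2 ** factor2 Y"
    by (simp only: factor1_mult factor2_mult matrix_mul_assoc)
  also have "\<dots> = smul (pair_eps q) (?Q ** (?G2 ** factor1 X) ** ?G1 ** RP r ** ?G2 ** factor2 Y)"
    unfolding Q_mat_G smul_mult_left by (simp only: matrix_mul_assoc)
  also have "?Q ** (?G2 ** factor1 X) ** ?G1 ** RP r ** ?G2 ** factor2 Y
      = ?Q ** factor1 X ** (?G2 ** ?G1) ** RP r ** ?G2 ** factor2 Y"
    unfolding factor_G_commute(2)[of q X] by (simp only: matrix_mul_assoc)
  also have "\<dots> = ?Q ** factor1 X ** (?G1 ** ?G2 ** RP r) ** ?G2 ** factor2 Y"
    unfolding factor_G_commute(1)[symmetric, of "G_mat q" q] by (simp only: matrix_mul_assoc)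
  also have "\<dots> = ?Q ** factor1 X ** RP r ** ?G1 ** (?G2 ** ?G2) ** factor2 Y"
    unfolding factor_G_RP by (simp only: matrix_mul_assoc)
  also have "\<dots> = ?Q ** factor1 X ** RP r ** (?G1 ** factor2 Y)"
    unfolding factor_G_sq by (simp only: matrix_mul_assoc matrix_mul_rid)
  also have "\<dots> = ?Q ** factor1 X ** RP r ** factor2 Y ** ?G1"
    unfolding factor_G_commute(1) by (simp only: matrix_mul_assoc)
  finally show ?thesis by (simp only: smul_mult_left)
qed

lemma factor_G_smul:
  fixes M :: "'a::ring_1 mat4"
  shows "factor1 (G_mat q) ** smul x M = smul x (factor1 (G_mat q) ** M)"
proof (cases q)
  case SP2_GL1
  have s: "sgn_idx i * (x * y) = x * (sgn_idx i * y)" for i and y :: 'a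
    by (cases i) simp_all
  have "(factor1 K_mat ** smul x M) $ (i, k) $ p = smul x (factor1 K_mat ** M) $ (i, k) $ p" for i k p
    by (cases i; cases k) (simp_all add: mat_mult_entry4 factor1_entry K_mat_entry)
  then show ?thesis unfolding SP2_GL1 vec_eq_iff by simp
qed (simp add: factor_1)

lemma map_matrix_RP_lift1: "map_matrix lift1 (RP x) = RP (lift1 x)"
  by (rule map_matrix_RP[OF is_hom_lift1])

lemma uu_eq: "uu = fls_X_inv" "subst_fls a b uu = of_C a * uu + of_C b" if "a \<noteq> 0"
  using that by (simp_all add: uu_def subst_fls_X_inv)

lemma uu_neq: "uu \<noteq> of_C c"
proof
  assume "uu = of_C c"
  then have "fls_nth uu (-1) = fls_nth (of_C c :: complex fls) (-1)" by simp
  then show False by (simp add: uu_def of_C_fls_def)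
qed

lemma uu_neq_numeral: "uu \<noteq> 0" "uu \<noteq> 1" "uu \<noteq> 2" "2 * uu \<noteq> 3"
proof -
  show "uu \<noteq> 0" "uu \<noteq> 1" "uu \<noteq> 2" using uu_neq[of 0] uu_neq[of 1] uu_neq[of 2] by simp_all
  show "2 * uu \<noteq> 3"
  proof
    assume "2 * uu = 3"
    moreover have "2 * of_C (3/2) = (3 :: complex fls)"
      using of_C_mult[of 2 "3/2", where 'a = "complex fls"] by simp
    ultimately have "2 * uu = 2 * of_C (3/2)" by simp
    then show False using uu_neq[of "3/2"] by simp
  qed
qed

lemma lift1_inverse: "x \<noteq> 0 \<Longrightarrow> lift1 (inverse x) * lift1 x = 1"
  by (simp add: is_homD(1)[OF is_hom_lift1] flip: is_homD(3)[OF is_hom_lift1])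

text \<open>The scalar (x-1)/(x-2) of \<open>R_sp_eq\<close> at x = 2u - 2.\<close>

definition p_factor :: "complex fls" where "p_factor = (2 * uu - 3) / (2 * uu - 4)"

fun p_ol_subst :: "tsign \<Rightarrow> complex fls" where
  "p_ol_subst Plus = 1 - 1 / (uu - 1)"
| "p_ol_subst Minus = 1 + 1 / (uu - 1)"

text \<open>The symplectic normalisation splits into the sign of G, the scalar of R and the type A
  normalisation at (u-1)/2. Hence the two central series correspond without any extra
  factor.\<close>

lemma p_series_eq: "p_series q = pair_eps q * p_factor * p_ol_subst (pair_sign q)"
  and p_series_nonzero: "p_series q \<noteq> 0"
proof -
  have n: "uu - 1 \<noteq> 0" "2 * uu - 2 = 2 * (uu - 1)" "2 * uu - 4 = 2 * (uu - 2)" "uu - 2 \<noteq> 0" "2 * uu - 3 \<noteq> 0"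
    using uu_neq_numeral by (simp_all add: algebra_simps)
  have 1: "1 + 1 / (2 * a) + 2 / (2 * b) = c / (2 * b) * (1 + 1 / a)"
    "- 1 + 1 / (2 * a) = - 1 * (c / (2 * b)) * (1 - 1 / a)"
    if "a \<noteq> 0" "b \<noteq> 0" "b = a - 1" "c = 2 * a - 1" for a b c :: "complex fls"
    using that by (simp_all add: divide_simps) (simp_all add: algebra_simps)
  have ab: "uu - 2 = uu - 1 - 1" "2 * uu - 3 = 2 * (uu - 1) - 1" by (simp_all add: algebra_simps)
  from 1[OF n(1,4) ab]
  show eq: "p_series q = pair_eps q * p_factor * p_ol_subst (pair_sign q)"
    unfolding p_factor_def by (cases q) (simp_all only: p_series.simps pair_eps.simps p_ol_subst.simps pair_sign.simps n mult_1_left)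
  have "1 - 1 / (uu - 1) \<noteq> 0" "1 + 1 / (uu - 1) \<noteq> 0"
    using n uu_neq_numeral by (simp_all add: divide_simps)
  then have "p_ol_subst (pair_sign q) \<noteq> 0" by (cases q) simp_all
  moreover have "p_factor \<noteq> 0" using n by (simp add: p_factor_def)
  moreover have "pair_eps q \<noteq> (0 :: complex fls)" by (cases q) simp_all
  ultimately show "p_series q \<noteq> 0" unfolding eq by simp
qed

lemma subst_fls_lift1: "subst_fls a b (lift1 x) = lift1 (subst_fls a b x)"
  by (rule map_fls_subst_fls[OF is_alg_hom_of_C, symmetric])

lemma subst_two_uu: "subst_fls (1/2) (-1/2) (2 * uu) = uu - 1"
proof -
  have "2 * of_C (1/2) = (1 :: complex fls)" "2 * of_C (-1/2) = (- 1 :: complex fls)"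
    using of_C_mult[of 2 "1/2", where 'a = "complex fls"] of_C_mult[of 2 "-1/2", where 'a = "complex fls"]
    by (simp_all add: of_C_uminus)
  then have "2 * (of_C (1/2) * uu + of_C (-1/2)) = uu - 1"
    by (simp only: distrib_left mult.assoc[symmetric]) simp
  then show ?thesis
    by (simp only: is_homD(3)[OF is_hom_subst_fls[OF scale_arith(1)]]
        is_hom_inverse(5)[OF is_hom_subst_fls[OF scale_arith(1)]] uu_eq(2)[OF scale_arith(1)])
qed

lemma p_ol_subst_eq: "subst_fls (1/2) (-1/2) (p_ol s) = p_ol_subst s"
  by (cases s) (simp_all only: p_ol.simps p_ol_subst.simps subst_two_uu
      is_homD(1,2,5)[OF is_hom_subst_fls[OF scale_arith(1)]]
      is_hom_inverse(2)[OF is_hom_subst_fls[OF scale_arith(1)]])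

abbreviation mfls :: "'a::zero fps mat2 \<Rightarrow> 'a fls mat2" where "mfls \<equiv> map_matrix fps_to_fls"

lemma mfls_mult: "mfls (A ** B :: 'a::ring_1 fps mat2) = mfls A ** mfls B"
  by (rule map_matrix_mult[OF is_hom_fps_to_fls])

lemma mfls_G [simp]: "mfls (G_mat q) = G_mat q"
  by (rule map_matrix_hom_simps(5)[OF is_hom_fps_to_fls])

lemma is_c_ol_subst:
  assumes "is_c_ol s S c" "lead S = mat 1"
  defines "S' \<equiv> msubst (1/2) (-1/2) S"
  shows "Q_mat s ** factor1 (mfls S') ** RP (lift1 (1 / (uu - 1))) ** factor2 (mfls (matrix_inv (msubst (-1) 2 S')))
     = smul (lift1 (p_ol_subst s) * fps_to_fls (subst_affine (1/2) (-1/2) c)) (Q_mat s)"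
proof -
  note h = is_hom_subst_fls[OF scale_arith(1), of "-1/2"]
  let ?h = "subst_fls (1/2) (-1/2)"
  have m: "map_matrix ?h (mfls M) = mfls (msubst (1/2) (-1/2) M)" for M :: "'a fps mat2"
    by (simp only: map_matrix_map_matrix fps_to_fls_subst_affine[OF scale_arith(1)])
  let ?W = "matrix_inv (msubst (-1) 0 S)"
  have "msubst (-1) 0 S ** ?W = mat 1"
    by (rule matrix_inv_lead_1) (simp add: assms(2))
  then have "msubst (1/2) (-1/2) (msubst (-1) 0 S) ** msubst (1/2) (-1/2) ?W = mat 1"
    by (metis msubst_simps(1,3) scale_arith(1))
  \<comment> \<open>-(u-1)/2 = ((2-u)-1)/2, so the argument -u of type A becomes the argument 2 - u
    of the symplectic side.\<close>
  moreover have "msubst (1/2) (-1/2) (msubst (-1) 0 S) = msubst (-1) 2 S'"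
    by (simp add: S'_def msubst_simps)
  ultimately have W: "msubst (1/2) (-1/2) ?W = matrix_inv (msubst (-1) 2 S')"
    by (intro matrix_inv_right_unique[symmetric]) (simp_all add: S'_def assms(2))
  have r: "?h (1 / (2 * uu)) = 1 / (uu - 1)"
    by (simp only: is_hom_inverse(2)[OF is_hom_subst_fls[OF scale_arith(1)]] subst_two_uu
        is_homD(1)[OF is_hom_subst_fls[OF scale_arith(1)]])
  have "Q_mat s ** factor1 (mfls S) ** RP (lift1 (1 / (2 * uu))) ** factor2 (mfls ?W)
      = smul (lift1 (p_ol s) * fps_to_fls c) (Q_mat s)"
    using assms(1) unfolding is_c_ol_def R_gl_eq map_matrix_RP_lift1 .
  from arg_cong[OF this, of "map_matrix ?h"] show ?thesis
    unfolding map_matrix_mult[OF h] map_matrix_factor[OF h] map_matrix_RP[OF h]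
      map_matrix_hom_simps[OF h] m r W is_homD(3)[OF h] subst_fls_lift1 p_ol_subst_eq
      fps_to_fls_subst_affine[OF scale_arith(1), symmetric] S'_def[symmetric] .
qed

lemma is_c_sp_hom:
  assumes c: "is_c_sp q S c" and f: "is_alg_hom f" and S: "mmap f S = S' ** G_mat q"
    and l: "lead S = G_mat q" "lead S' = mat 1"
  shows "Q_mat Minus ** factor1 (mfls S' ** G_mat q) ** RP (lift1 (1 / (uu - 1)))
      ** factor2 (G_mat q ** mfls (matrix_inv (msubst (-1) 2 S')))
     = smul (lift1 (p_series q / p_factor) * fps_to_fls (map_fps f c)) (Q_mat Minus)"
proof -
  have h: "is_hom (map_fls f)" by (intro is_hom_map_fls is_alg_homD[OF f])
  have f0: "f 0 = 0" by (rule is_homD(4)[OF is_alg_homD(1)[OF f]])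
  have m: "map_matrix (map_fls f) (mfls M) = mfls (mmap f M)" for M
    by (simp add: vec_eq_iff map_fls_fps_to_fls[of f, OF f0])
  \<comment> \<open>S(2-u) starts with G; the factor G normalises the constant term to I, where
    inverses are available.\<close>
  have l1: "lead (msubst (-1) 2 S ** G_mat q) = mat 1" by (simp add: lead_mult l)
  define V where "V = matrix_inv (msubst (-1) 2 S ** G_mat q)"
  note V = matrix_inv_lead_1[OF l1, folded V_def]
  have "msubst (-1) 2 S ** (G_mat q ** V) = mat 1" using V(1) by (simp only: matrix_mul_assoc)
  moreover have "G_mat q ** V ** msubst (-1) 2 S = mat 1"
  proof -
    have "G_mat q ** V ** msubst (-1) 2 S = G_mat q ** (V ** (msubst (-1) 2 S ** G_mat q)) ** G_mat q"
      by (simp flip: matrix_mul_assoc)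
    then show ?thesis by (simp add: V(2))
  qed
  ultimately have inv: "matrix_inv (msubst (-1) 2 S) = G_mat q ** V" by (rule matrix_inv_eqI)
  have "mmap f (msubst (-1) 2 S ** G_mat q) ** mmap f V = mat 1"
    using arg_cong[OF V(1), of "mmap f"] by (simp only: mmap_simps[OF f])
  moreover have "mmap f (msubst (-1) 2 S ** G_mat q) = msubst (-1) 2 S'"
    by (simp add: mmap_simps[OF f] S msubst_simps flip: matrix_mul_assoc)
  ultimately have "msubst (-1) 2 S' ** mmap f V = mat 1" by simp
  then have fV: "mmap f V = matrix_inv (msubst (-1) 2 S')"
    by (intro matrix_inv_right_unique[symmetric]) (simp_all add: l)
  have two: "2 * uu - 2 \<noteq> 0" "2 * uu - 2 \<noteq> 2" using uu_neq_numeral by (auto simp: algebra_simps)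
  have pf: "p_factor \<noteq> 0" using uu_neq_numeral by (simp add: p_factor_def)
  have e: "(2 * uu - 2 - 1) / (2 * uu - 2 - 2) = p_factor" "2 / (2 * uu - 2) = 1 / (uu - 1)"
    using uu_neq_numeral by (simp_all add: p_factor_def divide_simps)
  have "R_sp (2 * uu - 2) = smul p_factor (RP (1 / (uu - 1)))"
    unfolding R_sp_eq[OF two] e ..
  then have R: "map_matrix lift1 (R_sp (2 * uu - 2)) = smul (lift1 p_factor) (RP (lift1 (1 / (uu - 1)) :: 'b fls))"
    by (simp only: map_matrix_hom_simps(1)[OF is_hom_lift1] map_matrix_RP_lift1)
  have R': "map_matrix (map_fls f) (map_matrix lift1 M) = map_matrix lift1 M" for M :: "complex fls mat4"
    by (simp only: map_matrix_map_matrix map_fls_lift1[OF f])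
  have "smul (lift1 p_factor) (Q_mat Minus ** factor1 (mfls S' ** G_mat q) ** RP (lift1 (1 / (uu - 1)))
      ** factor2 (G_mat q ** mfls (matrix_inv (msubst (-1) 2 S'))))
     = smul (lift1 (p_series q) * fps_to_fls (map_fps f c)) (Q_mat Minus)"
    using arg_cong[OF c[unfolded is_c_sp_def inv], of "map_matrix (map_fls f)"]
    unfolding map_matrix_mult[OF h] map_matrix_factor[OF h] R' R m mmap_simps[OF f] S fV mfls_mult mfls_G
      map_matrix_hom_simps[OF h] is_homD(3)[OF h] map_fls_lift1[OF f] map_fls_fps_to_fls[of f, OF f0]
      smul_mult_left smul_mult_right[OF central_lift1] .
  also have "p_series q = p_factor * (p_series q / p_factor)" using pf by simp
  then have "smul (lift1 (p_series q) * fps_to_fls (map_fps f c)) (Q_mat Minus :: 'b fls mat4)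
      = smul (lift1 p_factor) (smul (lift1 (p_series q / p_factor) * fps_to_fls (map_fps f c)) (Q_mat Minus))"
    by (metis is_homD(3)[OF is_hom_lift1] smul_smul mult.assoc)
  finally show ?thesis by (rule smul_cancel[OF lift1_inverse[OF pf]])
qed

lemma c_sp_c_ol:
  fixes f :: "'a::calgebra \<Rightarrow> 'b::calgebra"
  assumes c: "is_c_sp q S c" and c': "is_c_ol (pair_sign q) T c'" and f: "is_alg_hom f"
    and S: "mmap f S = msubst (1/2) (-1/2) T ** G_mat q" and l: "lead S = G_mat q" "lead T = mat 1"
  shows "map_fps f c = subst_affine (1/2) (-1/2) c'"
proof -
  define S' where "S' = msubst (1/2) (-1/2) T"
  let ?Q = "Q_mat (pair_sign q) :: 'b fls mat4"
  let ?G = "factor1 (G_mat q) :: 'b fls mat4"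
  let ?W = "mfls (matrix_inv (msubst (-1) 2 S'))"
  let ?r = "lift1 (1 / (uu - 1)) :: 'b fls"
  define p where "p = p_series q / p_factor"
  define y where "y = (lift1 p * fps_to_fls (map_fps f c) :: 'b fls)"
  define y' where "y' = (lift1 (p_ol_subst (pair_sign q)) * fps_to_fls (subst_affine (1/2) (-1/2) c') :: 'b fls)"
  have pf: "p_factor \<noteq> 0" using uu_neq_numeral by (simp add: p_factor_def)
  have p: "p = pair_eps q * p_ol_subst (pair_sign q)" "p \<noteq> 0"
    using pf p_series_nonzero[of q] by (simp_all add: p_def) (simp add: p_series_eq)
  have "lead S' = mat 1" by (simp add: S'_def l)
  from is_c_sp_hom[OF c f S[folded S'_def] l(1) this]
  have sp: "Q_mat Minus ** factor1 (mfls S' ** G_mat q) ** RP ?r ** factor2 (G_mat q ** ?W) = smul y (Q_mat Minus)"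
    by (simp only: y_def p_def)
  have ol: "?Q ** factor1 (mfls S') ** RP ?r ** factor2 ?W = smul y' ?Q"
    using is_c_ol_subst[OF c' l(2)] by (simp only: y'_def S'_def)
  have "smul (pair_eps q) (smul y' ?Q) ** ?G = ?G ** smul y (Q_mat Minus)"
    using Q_twist[of q "mfls S'" ?r ?W] unfolding sp ol by (rule sym)
  also have "\<dots> = smul y ?Q ** ?G"
    by (simp only: factor_G_smul Q_mat_G(1) smul_mult_left)
  finally have "smul (pair_eps q) (smul y' ?Q) = smul y ?Q"
    by (simp only: matrix_cancel_right[OF factor_G_sq(2)])
  \<comment> \<open>An entry at which Q equals 1 for both signs.\<close>
  then have "smul (pair_eps q) (smul y' ?Q) $ (Neg, Pos) $ (Neg, Pos) = smul y ?Q $ (Neg, Pos) $ (Neg, Pos)"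
    by simp
  then have "pair_eps q * y' = y"
    by (cases q) (simp_all add: Q_mat_entry)
  moreover have "pair_eps q = (lift1 (pair_eps q) :: 'b fls)"
    by (cases q) (simp_all add: is_homD[OF is_hom_lift1])
  ultimately have "lift1 p * fps_to_fls (subst_affine (1/2) (-1/2) c') = lift1 p * fps_to_fls (map_fps f c)"
    by (simp only: y_def y'_def p(1) is_homD(3)[OF is_hom_lift1] mult.assoc)
  then have "lift1 (inverse p) * lift1 p * fps_to_fls (subst_affine (1/2) (-1/2) c')
      = lift1 (inverse p) * lift1 p * fps_to_fls (map_fps f c)"
    by (simp only: mult.assoc)
  then have "fps_to_fls (subst_affine (1/2) (-1/2) c') = fps_to_fls (map_fps f c)"
    by (simp only: lift1_inverse[OF p(2)] mult_1_left)
  then show ?thesis by simp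
qed

section \<open>Ideals generated by the coefficients of a series\<close>

lemma ideal_gen_sum: "(\<And>i. i \<in> I \<Longrightarrow> f i \<in> ideal_gen R) \<Longrightarrow> sum f I \<in> ideal_gen R"
  by (induction I rule: infinite_finite_induct) (auto intro: ideal_gen.zero ideal_gen_plus)

lemma ideal_gen_base: "r \<in> R \<Longrightarrow> r \<in> ideal_gen R"
  using ideal_gen.add[OF ideal_gen.zero, of r R 1 1] by simp

lemma ideal_gen_least:
  assumes "R \<subseteq> ideal_gen R'"
  shows "ideal_gen R \<subseteq> ideal_gen R'"
proof
  fix x assume "x \<in> ideal_gen R"
  then show "x \<in> ideal_gen R'"
  proof induction
    case (add x r a b)
    then show ?case
      using assms by (blast intro: ideal_gen_plus ideal_gen_mult_left ideal_gen_mult_right)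
  qed (rule ideal_gen.zero)
qed

text \<open>Substituted coefficients are linear combinations of the original ones, and the
  substitution can be inverted.\<close>

lemma ideal_gen_subst_affine:
  fixes f :: "'a::calgebra fps"
  assumes a: "a \<noteq> 0"
  shows "ideal_gen {fps_nth (subst_affine a b f) n | n. True} = ideal_gen {fps_nth f n | n. True}"
proof -
  have sub: "ideal_gen {fps_nth (subst_affine a b f) n | n. True} \<subseteq> ideal_gen {fps_nth f n | n. True}"
    if "a \<noteq> 0" for a b and f :: "'a fps"
  proof (rule ideal_gen_least)
    have "fps_nth (subst_affine a b f) n \<in> ideal_gen {fps_nth f n | n. True}" for n
      unfolding subst_affine_nth[OF that]
      by (intro ideal_gen_sum ideal_gen_mult_right ideal_gen_base) blast
    then show "{fps_nth (subst_affine a b f) n | n. True} \<subseteq> ideal_gen {fps_nth f n | n. True}" by blast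
  qed
  show ?thesis
    using sub[OF a, of b f] sub[of "1/a" "- b / a" "subst_affine a b f"] a
    unfolding subst_affine_inverse[OF a] by auto
qed

text \<open>Surjectivity is what lifts the multipliers \<open>a\<close> and \<open>b\<close> of a
  generator.\<close>

lemma hom_image_ideal_gen:
  assumes f: "is_hom f" "surj f"
  shows "f ` ideal_gen R = ideal_gen (f ` R)"
proof
  note h = is_homD[OF f(1)]
  show "f ` ideal_gen R \<subseteq> ideal_gen (f ` R)"
  proof
    fix y assume "y \<in> f ` ideal_gen R"
    then obtain x where "x \<in> ideal_gen R" "y = f x" by blast
    then show "y \<in> ideal_gen (f ` R)"
      by (induction arbitrary: y) (auto simp: h intro: ideal_gen.intros)
  qed
  show "ideal_gen (f ` R) \<subseteq> f ` ideal_gen R"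
  proof
    fix y assume "y \<in> ideal_gen (f ` R)"
    then show "y \<in> f ` ideal_gen R"
    proof induction
      case zero
      show ?case by (metis h(4) ideal_gen.zero imageI)
    next
      case (add y s a b)
      then obtain x r where x: "y = f x" "x \<in> ideal_gen R" "s = f r" "r \<in> R" by blast
      obtain a' b' where "a = f a'" "b = f b'" using f(2) by (metis surjD)
      then have "y + a * s * b = f (x + a' * r * b')" by (simp add: h x)
      then show ?case using ideal_gen.add[OF x(2,4)] by blast
    qed
  qed
qed

lemma hom_image_ideal_c:
  assumes f: "is_alg_hom f" "surj f" and c: "map_fps f c = subst_affine a b c'" and a: "a \<noteq> 0"
  shows "f ` ideal_c c = ideal_c c'"
proof -
  note h = is_alg_homD(1)[OF f(1)]
  have "f ` {fps_nth (c - 1) n | n. True} = {fps_nth (map_fps f (c - 1)) n | n. True}"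
    by (auto simp only: map_fps_nth)
  also have "map_fps f (c - 1) = subst_affine a b (c' - 1)"
    by (simp add: is_homD[OF is_hom_map_fps[OF h]] is_homD[OF is_hom_subst_affine[OF a]] c)
  finally show ?thesis
    unfolding ideal_c_def hom_image_ideal_gen[OF h f(2)] by (simp only: ideal_gen_subst_affine[OF a])
qed

text \<open>Both pairs at once. \<psi> and \<omega> come from isomorphisms of the full Yangians; the
  two commuting squares express that they are induced by \<phi> on the extended algebras.\<close>

theorem twisted_isomorphisms:
  assumes p: "relators TYPE('p::presentation) = Xt_relators q"
    and r: "relators TYPE('r::presentation) = Yt_relators (pair_sign q)"
  shows "\<exists>(\<phi> :: 'p palg \<Rightarrow> 'r palg) (\<pi> :: 'p palg \<Rightarrow> X_sp2) (\<pi>' :: 'r palg \<Rightarrow> Y2)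
       (\<rho> :: X_sp2 \<Rightarrow> Y_sp2) (\<rho>' :: Y2 \<Rightarrow> SY2) (\<psi> :: X_sp2 \<Rightarrow> Y2) (\<omega> :: Y_sp2 \<Rightarrow> SY2).
       alg_hom_sending (St_gen q) (msubst (1/2) (-1/2) T_gen ** G_mat q) \<phi> \<and> alg_iso UNIV UNIV \<phi> \<and>
       alg_hom_sending (St_gen q) (S_sp q T_gen) \<pi> \<and>
       alg_hom_sending T_gen (S_gl (pair_sign q) T_gen) \<pi>' \<and>
       alg_hom_sending T_gen T_gen \<rho> \<and>
       alg_hom_sending T_gen T_gen \<rho>' \<and>
       (\<forall>c c'. is_c_sp q (St_gen q) c \<and> is_c_ol (pair_sign q) T_gen c' \<longrightarrow>
          \<phi> ` ideal_c c = ideal_c c') \<and>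
       alg_iso (X_tw q) (Y_ol (pair_sign q)) \<psi> \<and> (\<forall>x. \<psi> (\<pi> x) = \<pi>' (\<phi> x)) \<and>
       alg_iso (Y_tw q) (SY_ol (pair_sign q)) \<omega> \<and> (\<forall>x \<in> X_tw q. \<omega> (\<rho> x) = \<rho>' (\<psi> x))"
proof -
  let ?s = "pair_sign q"
  obtain \<phi> :: "'p palg \<Rightarrow> 'r palg" and \<phi>' where \<phi>: "is_alg_hom \<phi>" "is_alg_hom \<phi>'"
    "mmap \<phi> (St_gen q) = msubst (1/2) (-1/2) T_gen ** G_mat q" "\<And>x. \<phi>' (\<phi> x) = x" "\<And>y. \<phi> (\<phi>' y) = y"
    using Xt_iso_Yt[OF p r] by blast
  obtain \<psi> :: "X_sp2 \<Rightarrow> Y2" and \<psi>' where \<psi>: "is_alg_hom \<psi>" "is_alg_hom \<psi>'"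
    "mmap \<psi> T_gen = msubst (1/2) 0 T_gen" "\<And>x. \<psi>' (\<psi> x) = x" "\<And>y. \<psi> (\<psi>' y) = y"
    using X_sp2_iso_Y2 by blast
  obtain \<omega> :: "Y_sp2 \<Rightarrow> SY2" and \<omega>' where \<omega>: "is_alg_hom \<omega>"
    "mmap \<omega> T_gen = msubst (1/2) 0 T_gen" "\<And>x. \<omega>' (\<omega> x) = x"
    using Y_sp2_iso_SY2 by blast
  obtain \<pi>' :: "'r palg \<Rightarrow> Y2" where \<pi>': "is_alg_hom \<pi>'" "mmap \<pi>' T_gen = S_gl ?s T_gen"
    using Yt_hom[OF r _ REFL_gl_S_gl[OF Y2_RTT]] lead_S_gl[OF lead_T_gen] by blast
  obtain \<rho> :: "X_sp2 \<Rightarrow> Y_sp2" where \<rho>: "is_alg_hom \<rho>" "mmap \<rho> T_gen = T_gen"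
    using X_sp2_hom[OF lead_T_gen Y_sp2_RTT] by blast
  obtain \<rho>' :: "Y2 \<Rightarrow> SY2" where \<rho>': "is_alg_hom \<rho>'" "mmap \<rho>' T_gen = T_gen"
    using Y2_hom[OF lead_T_gen SY2_RTT] by blast
  \<comment> \<open>Defined through the square, so its commutativity is immediate; what remains is
    the value on the generator matrix.\<close>
  define \<pi> where "\<pi> = (\<lambda>x. \<psi>' (\<pi>' (\<phi> x)))"
  have \<pi>_hom: "is_alg_hom \<pi>"
    unfolding \<pi>_def by (rule is_alg_hom_comp[OF \<psi>(2) is_alg_hom_comp[OF \<pi>'(1) \<phi>(1)]])
  have S: "S_sp q (mmap \<psi> T_gen) = msubst (1/2) (-1/2) (S_gl ?s T_gen) ** G_mat q"
    unfolding \<psi>(3) by (rule S_sp_eq)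
  have "mmap \<pi>' (mmap \<phi> (St_gen q)) = mmap \<psi> (S_sp q T_gen)"
    unfolding \<phi>(3) mmap_S[OF \<psi>(1)] S by (simp add: mmap_simps[OF \<pi>'(1)] \<pi>'(2))
  moreover have "mmap \<pi> M = mmap \<psi>' (mmap \<pi>' (mmap \<phi> M))" for M
    by (simp add: vec_eq_iff fps_eq_iff \<pi>_def)
  moreover have "mmap \<psi>' (mmap \<psi> M) = M" for M
    by (simp add: vec_eq_iff fps_eq_iff \<psi>)
  ultimately have \<pi>: "mmap \<pi> (St_gen q) = S_sp q T_gen" by simp
  have "bij \<phi>" by (rule bij_betw_byWitness[of _ \<phi>']) (auto simp: \<phi>)
  then have \<phi>_iso: "alg_iso UNIV UNIV \<phi>" and surj: "surj \<phi>"
    by (simp_all add: alg_iso_def alg_hom_on_UNIV \<phi> bij_is_surj)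
  have ideal: "\<phi> ` ideal_c c = ideal_c c'"
    if "is_c_sp q (St_gen q) c" "is_c_ol ?s T_gen c'" for c c'
  proof (rule hom_image_ideal_c[OF \<phi>(1) surj _ scale_arith(1)])
    have "lead (St_gen q :: 'p palg fps mat2) = G_mat q" by (simp add: St_gen_def)
    from c_sp_c_ol[OF that \<phi>(1,3) this lead_T_gen] show "map_fps \<phi> c = subst_affine (1/2) (-1/2) c'" .
  qed
  have "entry_alg (mmap \<psi> (S_sp q T_gen)) = entry_alg (S_gl ?s T_gen)"
    unfolding mmap_S[OF \<psi>(1)] S by (simp add: entry_alg_mult_G entry_alg_msubst)
  then have \<psi>_iso: "alg_iso (X_tw q) (Y_ol ?s) \<psi>"
    using alg_iso_entry_alg[OF \<psi>(1,4), of "S_sp q T_gen"] by (simp add: X_tw_def Y_ol_def)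
  have "entry_alg (mmap \<omega> (S_sp q T_gen)) = entry_alg (S_gl ?s T_gen)"
    unfolding mmap_S[OF \<omega>(1)] \<omega>(2) S_sp_eq by (simp add: entry_alg_mult_G entry_alg_msubst)
  then have \<omega>_iso: "alg_iso (Y_tw q) (SY_ol ?s) \<omega>"
    using alg_iso_entry_alg[OF \<omega>(1,3), of "S_sp q T_gen"] by (simp add: Y_tw_def SY_ol_def)
  \<comment> \<open>A homomorphism from X(sp_2) is determined by the image of T(u), so the square is
    checked there.\<close>
  have "mmap \<omega> (mmap \<rho> T_gen) = mmap \<rho>' (mmap \<psi> T_gen)"
    by (simp add: \<rho> \<rho>' \<omega> \<psi> mmap_simps[OF \<rho>'(1)])
  then have "mmap (\<lambda>x. \<omega> (\<rho> x)) T_gen = mmap (\<lambda>x. \<rho>' (\<psi> x)) T_gen"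
    by (simp only: mmap_comp[of \<omega> \<rho>] mmap_comp[of \<rho>' \<psi>])
  then have "(\<lambda>x. \<omega> (\<rho> x)) = (\<lambda>x. \<rho>' (\<psi> x))"
    unfolding T_gen_eq
    by (rule palg_hom_unique[OF is_alg_hom_comp[OF \<omega>(1) \<rho>(1)] is_alg_hom_comp[OF \<rho>'(1) \<psi>(1)]])
  then have \<omega>\<rho>: "\<omega> (\<rho> x) = \<rho>' (\<psi> x)" for x by (rule fun_cong)
  have \<psi>\<pi>: "\<psi> (\<pi> x) = \<pi>' (\<phi> x)" for x by (simp add: \<pi>_def \<psi>)
  show ?thesis
    unfolding alg_hom_sending_iff
    by (intro exI[of _ \<phi>] exI[of _ \<pi>] exI[of _ \<pi>'] exI[of _ \<rho>] exI[of _ \<rho>'] exI[of _ \<psi>] exI[of _ \<omega>]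
        conjI allI ballI impI \<phi>(1,3) \<phi>_iso \<pi>_hom \<pi> \<pi>' \<rho> \<rho>' \<psi>_iso \<omega>_iso \<omega>\<rho> \<psi>\<pi>)
      (erule conjE, rule ideal)
qed

section \<open>Reflection algebras\<close>

text \<open>\<open>S_gl\<close> multiplied on the right by G, which generates the same subalgebra.
  Both signs thus take the form T G adj(T), parallel to \<open>B_mat\<close>.\<close>

abbreviation S_mat :: "sym_pair \<Rightarrow> 'a::calgebra fps mat2 \<Rightarrow> 'a fps mat2" where
  "S_mat q T \<equiv> T ** G_mat q ** adj (msubst (-1) 0 T)"

abbreviation B_mat :: "sym_pair \<Rightarrow> 'a::calgebra fps mat2 \<Rightarrow> 'a fps mat2" where
  "B_mat q T \<equiv> T ** G_mat q ** matrix_inv (msubst (-1) 0 T)"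

text \<open>The value of \<open>B_mat q T\<close> when \<open>T\<close> has quantum determinant 1.\<close>

abbreviation B1_mat :: "sym_pair \<Rightarrow> 'a::calgebra fps mat2 \<Rightarrow> 'a fps mat2" where
  "B1_mat q T \<equiv> T ** G_mat q ** adj (msubst (-1) 1 T)"

lemma entry_alg_S_gl: "entry_alg (S_gl (pair_sign q) T) = entry_alg (S_mat q T)"
proof -
  have "S_gl (pair_sign q) T ** G_mat q = S_mat q T"
    by (simp add: S_gl_def mtransp_G_mat flip: matrix_mul_assoc)
  then show ?thesis by (metis entry_alg_mult_G)
qed

lemma entry_alg_uminus: "entry_alg (- M :: 'a::calgebra fps mat2) = entry_alg M"
proof -
  have *: "mat_in (entry_alg N) (- N)" for N :: "'a fps mat2"
    using mat_in_entry_alg[of N] by (simp add: mat_in_def fps_in_intros(8)[OF subalg_subalgebra_gen])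
  show ?thesis using *[of M] *[of "- M"] by (intro entry_alg_eqI) simp_all
qed

lemma entry_alg_B_gl:
  "entry_alg (B_gl 0 T) = entry_alg (B_mat SP2_SP2 T)"
  "entry_alg (B_gl 1 T) = entry_alg (B_mat SP2_GL1 T)"
proof -
  have "unit_mat Neg Neg + map_matrix ((*) ((-1) ^ 0)) (unit_mat Pos Pos) = (mat 1 :: 'a fps mat2)"
    by (simp add: vec_eq_iff all_idx unit_mat_def mat_1_entry)
  then have "B_gl 0 T = B_mat SP2_SP2 T" by (simp add: B_gl_def)
  then show "entry_alg (B_gl 0 T) = entry_alg (B_mat SP2_SP2 T)" by simp
  \<comment> \<open>The matrix of the reflection algebra with q = 1 is -K, and a sign does not
    affect the subalgebra generated.\<close>
  have "unit_mat Neg Neg + map_matrix ((*) ((-1) ^ 1)) (unit_mat Pos Pos) = (- K_mat :: 'a fps mat2)"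
    by (simp add: vec_eq_iff all_idx unit_mat_def K_mat_entry)
  moreover have "A ** (- B) ** C = - (A ** B ** C)" for A B C :: "'a fps mat2"
    by (simp add: vec_eq_iff mat_mult_entry2 algebra_simps)
  ultimately have "B_gl 1 T = - B_mat SP2_GL1 T" by (simp add: B_gl_def)
  then show "entry_alg (B_gl 1 T) = entry_alg (B_mat SP2_GL1 T)" by (simp add: entry_alg_uminus)
qed

lemma qdet_msubst: "qdet (msubst 1 b T) = subst_affine 1 b (qdet T)"
  by (simp add: qdet_def is_homD[OF is_hom_subst_affine] subst_affine_comp add.commute)

text \<open>For quantum determinant 1 the inverse of T(u) is adj T(u+1); then u is replaced by
  -u.\<close>

lemma matrix_inv_qdet_1:
  assumes "RTT T" "qdet T = 1" "lead T = mat 1"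
  shows "matrix_inv (msubst (-1) 0 T) = adj (msubst (-1) 1 T)"
proof (rule matrix_inv_right_unique)
  have "T ** adj (msubst 1 1 T) = mat 1" using RTT_mult_adj_shift[OF assms(1)] by (simp add: assms(2))
  from arg_cong[OF this, of "msubst (-1) 0"]
  show "msubst (-1) 0 T ** adj (msubst (-1) 1 T) = mat 1" by (simp add: msubst_simps)
qed (simp add: assms(3))

text \<open>In S the arguments u and -u add up to 0, in B1 the arguments u and 1 - u add up to 1.
  Translating T by 1/2 in both places converts one sum into the other.\<close>

lemma msubst_S_B1:
  "S_mat q (msubst 1 (1/2) T) = msubst 1 (1/2) (B1_mat q T)"
  "B1_mat q (msubst 1 (-1/2) T) = msubst 1 (-1/2) (S_mat q T)"
  by (simp_all add: msubst_simps)

lemma mmap_S_B1: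
  assumes "is_alg_hom f"
  shows "mmap f (S_mat q T) = S_mat q (mmap f T)" "mmap f (B1_mat q T) = B1_mat q (mmap f T)"
  by (simp_all add: mmap_simps[OF assms])

lemma alg_iso_trans:
  assumes "alg_iso A B f" "alg_iso B C g"
  shows "alg_iso A C (\<lambda>x. g (f x))"
proof -
  have "f x \<in> B" if "x \<in> A" for x using assms(1) that by (auto simp: alg_iso_def bij_betw_def)
  moreover have "bij_betw (\<lambda>x. g (f x)) A C"
    using bij_betw_trans[of f A B g C] assms by (simp add: alg_iso_def comp_def)
  ultimately show ?thesis using assms by (simp add: alg_iso_def alg_hom_on_def)
qed

text \<open>With quantum determinant 1 there is no central factor to recode: translation by 1/2 is
  an automorphism and already carries S to a translate of B.\<close>

lemma SY_iso_SB:
  "\<exists>f :: SY2 \<Rightarrow> SY2. alg_iso (entry_alg (S_mat q T_gen)) (entry_alg (B_mat q T_gen)) f"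
proof -
  let ?T = "T_gen :: SY2 fps mat2"
  have ex: "\<exists>f :: SY2 \<Rightarrow> SY2. is_alg_hom f \<and> mmap f T_gen = msubst 1 b ?T" for b
    by (rule SY2_hom) (simp_all add: RTT_translate SY2_RTT qdet_msubst SY2_qdet)
  obtain f :: "SY2 \<Rightarrow> SY2" where f: "is_alg_hom f" "mmap f T_gen = msubst 1 (1/2) ?T" using ex by blast
  obtain g :: "SY2 \<Rightarrow> SY2" where g: "is_alg_hom g" "mmap g T_gen = msubst 1 (-1/2) ?T" using ex by blast
  have "mmap g (mmap f T_gen) = T_gen" "mmap f (mmap g T_gen) = T_gen"
    by (simp_all add: f g mmap_simps(6) msubst_simps)
  from palg_hom_inverse_T(2)[OF f(1) g(1) this(2,1)] have "g (f x) = x" for x .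
  from alg_iso_entry_alg[OF f(1) this, of "S_mat q ?T"]
  have "alg_iso (entry_alg (S_mat q ?T)) (entry_alg (msubst 1 (1/2) (B1_mat q ?T))) f"
    by (simp only: mmap_S_B1[OF f(1)] f(2) msubst_S_B1)
  then show ?thesis
    by (auto simp only: matrix_inv_qdet_1[OF SY2_RTT SY2_qdet lead_T_gen] entry_alg_msubst one_neq_zero not_False_eq_True)
qed

subsection \<open>Splitting off the center\<close>

abbreviation cfps_in :: "'a::calgebra fps \<Rightarrow> bool" where "cfps_in f \<equiv> fps_in {z. central z} f"

lemma cfps_in_central: "cfps_in f \<Longrightarrow> central f"
  by (simp add: central_def central_fps_commute)

lemma cfps_in_in_u_v:
  assumes "cfps_in f"
  shows "central (in_u f)" "central (in_v f)"
proof -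
  have 0: "central (0 :: 'b::ring_1)" by (simp add: central_def)
  show "central (in_u f)" "central (in_v f)"
    using fps_inD[OF assms] by (auto intro!: central_fls simp: in_u_nth in_v_nth 0)
qed

lemma rtt_smul:
  assumes "central a" "central b" "rtt c A B"
  shows "rtt c (smul a A) (smul b B)"
  unfolding rtt_def
proof (intro allI)
  fix i j k l
  have 1: "a * x * (b * y) = a * b * (x * y)" for x y
    using centralD3[OF assms(2), of x y] by (simp only: mult.assoc)
  have 2: "b * y * (a * x) = a * b * (y * x)" for x y
    using centralD3[OF assms(1), of y x] centralD3[OF assms(1), of b "y * x"] by (simp only: mult.assoc)
  have 3: "c * (a * b * x) = a * b * (c * x)" for x
    by (rule centralD3[OF central_arith(2)[OF assms(1,2)]])
  show "smul a A $ i $ j * smul b B $ k $ l - smul b B $ k $ l * smul a A $ i $ j =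
     c * (smul a A $ k $ j * smul b B $ i $ l - smul b B $ k $ j * smul a A $ i $ l)"
    by (simp only: nth_map_matrix 1 2 right_diff_distrib[symmetric] 3 rttD[OF assms(3), of i j k l])
qed

lemma RTT_smul:
  assumes "cfps_in g" "RTT T"
  shows "RTT (smul g T)"
  using rtt_smul[OF cfps_in_in_u_v[OF assms(1)] assms(2)[unfolded rtt_defect_gl]]
  by (simp add: rtt_defect_gl map_matrix_hom_simps(1)[OF is_hom_in_u] map_matrix_hom_simps(1)[OF is_hom_in_v])

lemma qdet_smul:
  assumes g: "cfps_in g"
  shows "qdet (smul g T) = shift_sq (-1) g * qdet T"
proof -
  let ?s = "subst_affine 1 (-1)"
  have c: "central g" "central (?s g)"
    using g by (auto intro!: cfps_in_central fps_in_intros subalg_central)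
  have "?s (g * x) * (g * y) = g * ?s g * (?s x * y)" for x y
    using centralD3[OF c(1), of "?s x" y] centralD3[OF c(1), of "?s g" "?s x * y"]
    by (simp only: mult.assoc is_homD(3)[OF is_hom_subst_affine[OF one_neq_zero]])
  then show ?thesis by (simp add: qdet_def right_diff_distrib)
qed

lemma adj_smul: "adj (smul f M) = smul f (adj M)"
  by (rule mat2_eqI) simp_all

lemma lead_smul: "fps_nth g 0 = 1 \<Longrightarrow> lead (smul g M) = lead M"
  by (simp add: lead_def vec_eq_iff)

lemma mmap_smul: "is_alg_hom f \<Longrightarrow> mmap f (smul g M) = smul (map_fps f g) (mmap f M)"
  by (rule map_matrix_hom_simps(1)[OF is_hom_map_fps[OF is_alg_homD(1)]])

lemma map_fps_shift_sq:
  "is_alg_hom f \<Longrightarrow> map_fps f (shift_sq b g) = shift_sq b (map_fps f g)"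
  by (simp add: is_homD[OF is_hom_map_fps] is_alg_homD map_fps_subst_affine)

definition normalised :: "Y2 fps \<Rightarrow> Y2 fps \<Rightarrow> Y2 fps mat2 \<Rightarrow> bool" where
  "normalised d d' T \<longleftrightarrow> cfps_in d \<and> cfps_in d' \<and> d * d' = 1 \<and> d' * d = 1 \<and> fps_nth d 0 = 1 \<and>
     T_gen = smul d T \<and> RTT T \<and> lead T = mat 1 \<and> qdet T = 1 \<and> shift_sq (-1) d = qdet T_gen"

lemma normalised_exists: "\<exists>d d' T. normalised d d' T"
proof -
  have q0: "fps_nth (qdet (T_gen :: Y2 fps mat2)) 0 = 1"
    by (simp add: qdet_def lead_entry mat_1_entry)
  obtain d :: "Y2 fps" where d: "cfps_in d" "fps_nth d 0 = 1" "shift_sq (-1) d = qdet T_gen"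
    using shift_sq_exists[OF subalg_central qdet_central[OF Y2_RTT] q0] by blast
  obtain d' where d': "cfps_in d'" "d * d' = 1" "d' * d = 1"
    using fps_in_inverse[OF subalg_central d(1), of 1] d(2) by auto
  have "fps_nth (d * d') 0 = 1" by (simp add: d'(2))
  then have d'0: "fps_nth d' 0 = 1" by (simp add: d(2))
  define T :: "Y2 fps mat2" where "T = smul d' T_gen"
  have T: "RTT T" "lead T = mat 1" "T_gen = smul d T"
    by (simp_all add: T_def RTT_smul[OF d'(1) Y2_RTT] lead_smul[OF d'0] smul_smul d'(2))
  \<comment> \<open>Scaling by \<open>d\<close> multiplies the quantum determinant by d(u) d(u-1),
    which is the quantum determinant of the generators and a unit, so that of \<open>T\<close> is
    1.\<close>
  have "shift_sq (-1) d * qdet T = shift_sq (-1) d"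
    unfolding d(3) by (metis T(3) qdet_smul[OF d(1)] d(3))
  moreover obtain e where "e * shift_sq (-1) d = 1"
    using fps_in_inverse[OF subalg_central, of "shift_sq (-1) d" 1] qdet_central[OF Y2_RTT] q0
    by (auto simp: d(3))
  ultimately have "qdet T = 1" by (metis mult.assoc mult_1_left)
  with d d' T show ?thesis unfolding normalised_def by blast
qed

text \<open>D(u) T'(u+b) solves the RTT relation. That d and T' go to the two factors separately
  follows by comparing quantum determinants, since the root d is unique.\<close>

lemma normalised_hom:
  assumes n: "normalised d d' T" and D: "cfps_in D" "fps_nth D 0 = 1"
  shows "\<exists>f :: Y2 \<Rightarrow> Y2. is_alg_hom f \<and> map_fps f d = D \<and> mmap f T = msubst 1 b T"
proof -
  from n have d: "cfps_in d" "d' * d = 1" "fps_nth d 0 = 1" "T_gen = smul d T" "RTT T" "lead T = mat 1" "qdet T = 1"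
    "shift_sq (-1) d = qdet T_gen" by (simp_all add: normalised_def)
  let ?N = "smul D (msubst 1 b T)"
  have "\<exists>f :: Y2 \<Rightarrow> Y2. is_alg_hom f \<and> mmap f T_gen = ?N"
    by (rule Y2_hom) (simp_all add: lead_smul D d RTT_smul RTT_translate)
  then obtain f :: "Y2 \<Rightarrow> Y2" where f: "is_alg_hom f" "mmap f T_gen = ?N" by blast
  have f1: "f 1 = 1" by (rule is_homD(1)[OF is_alg_homD(1)[OF f(1)]])
  note hf = is_homD[OF is_hom_map_fps[OF is_alg_homD(1)[OF f(1)]]]
  have "shift_sq (-1) (map_fps f d) = map_fps f (qdet T_gen)"
    by (simp only: map_fps_shift_sq[OF f(1), symmetric] d(8))
  also have "\<dots> = shift_sq (-1) D"
    by (simp only: map_fps_qdet[OF f(1)] f(2) qdet_smul[OF D(1)] qdet_msubst d(7)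
        is_homD(1)[OF is_hom_subst_affine[OF one_neq_zero]] mult_1_right)
  finally have fd: "map_fps f d = D"
    by (rule shift_sq_unique) (simp_all add: d D f1)
  have "T = smul d' T_gen" by (simp add: d(4) smul_smul d(2))
  then have "mmap f T = smul (map_fps f d') ?N" by (metis f mmap_smul)
  also have "\<dots> = smul (map_fps f (d' * d)) (msubst 1 b T)"
    by (simp add: smul_smul hf fd)
  also have "\<dots> = msubst 1 b T" by (simp add: d(2) hf)
  finally show ?thesis using f(1) fd by blast
qed

lemma S_mat_smul:
  assumes "cfps_in d"
  shows "S_mat q (smul d T) = smul (d * subst_affine (-1) 0 d) (S_mat q T)"
proof -
  have c: "central (subst_affine (-1) 0 d)"
    using assms by (auto intro!: cfps_in_central fps_in_intros subalg_central)
  show ?thesis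
    by (simp add: msubst_simps adj_smul smul_mult_left smul_mult_right[OF c] smul_smul
        centralD[OF c, of d])
qed

lemma subst_neg_X: "subst_affine (-1) 0 fps_X = - (fps_X :: 'a::calgebra fps)"
proof -
  have "- subst_affine (-1) 0 fps_X = (fps_X :: 'a fps)"
    using subst_affine_X[of "-1" 0, where 'a = 'a] by (simp flip: cfps_arith(3))
  then show ?thesis by (metis minus_minus)
qed

text \<open>
  The \<open>(-1,-1)\<close> entry of the symmetry relation of twisted Yangians, which expresses \<open>S(-u)\<^sup>t\<close>
  through \<open>S(u)\<close> and \<open>S(u)\<^sup>t\<close>.
\<close>

lemma S_mat_symmetry:
  fixes T :: "'a::calgebra fps mat2"
  assumes "RTT T"
  shows "(cfps 2 + pair_eps q * fps_X) * msubst (-1) 0 (S_mat q T) $ Pos $ Pos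
    = pair_eps q * (cfps 2 * S_mat q T $ Neg $ Neg + fps_X * S_mat q T $ Pos $ Pos)"
proof -
  let ?n = "subst_affine (-1) 0 :: 'a fps \<Rightarrow> _"
  note h = is_homD[OF is_hom_subst_affine[OF scale_arith(3)]]
  \<comment> \<open>At v = -u the factor (u - v)/u of \<open>RTT_eval\<close> is the constant
    2.\<close>
  have rel: "cfps 2 * (T $ i $ j * ?n (T $ k $ l)) = cfps 2 * (?n (T $ k $ l) * T $ i $ j)
     + fps_X * (T $ k $ j * ?n (T $ i $ l) - ?n (T $ k $ j) * T $ i $ l)" for i j k l
    using RTT_eval[OF assms scale_arith(3), of 0 i j k l] by (simp add: algebra_simps)
  have inv: "?n (?n x) = x" for x by (simp add: subst_affine_comp)
  have "msubst (-1) 0 (S_mat q T) = msubst (-1) 0 T ** G_mat q ** adj T"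
    by (simp add: msubst_simps)
  then have 0: "msubst (-1) 0 (S_mat q T) $ Pos $ Pos = (msubst (-1) 0 T ** G_mat q ** adj T) $ Pos $ Pos"
    by simp
  note simps = mat_mult_entry2 K_mat_entry mat_1_entry algebra_simps
  show ?thesis
    unfolding 0
  proof (cases q)
    case SP2_SP2
    then show "(cfps 2 + pair_eps q * fps_X) * (msubst (-1) 0 T ** G_mat q ** adj T) $ Pos $ Pos
      = pair_eps q * (cfps 2 * S_mat q T $ Neg $ Neg + fps_X * S_mat q T $ Pos $ Pos)"
      using arg_cong2[OF rel[of Neg Neg Pos Pos] rel[of Neg Pos Pos Neg, symmetric], of "(+)"]
      by (simp add: simps)
  next
    case SP2_GL1
    then show "(cfps 2 + pair_eps q * fps_X) * (msubst (-1) 0 T ** G_mat q ** adj T) $ Pos $ Pos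
      = pair_eps q * (cfps 2 * S_mat q T $ Neg $ Neg + fps_X * S_mat q T $ Pos $ Pos)"
      using rel[of Neg Neg Pos Pos] rel[of Neg Pos Pos Neg] by (simp add: simps)
  qed
qed

lemma mat_in_smul_cancel:
  assumes A: "subalg A" and "mat_in A (smul f M)" "fps_in A f" "fps_nth f 0 = 1"
  shows "mat_in A M"
proof -
  obtain g where g: "fps_in A g" "g * f = 1"
    using fps_in_inverse[OF A assms(3), of 1] assms(4) by auto
  have "mat_in A (smul g (smul f M))" by (rule mat_in_intros(5)[OF A g(1) assms(2)])
  then show ?thesis by (simp add: smul_smul g(2))
qed

text \<open>adj T(-u) inverts T(-u-1) and adj T(u+1) inverts T(u), while G squares to I. Hence S(u)
  S(-u-1) = I, and with the factor H only a product of two values of H is left.\<close>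

lemma S_mat_center:
  assumes T: "RTT T" "lead T = mat 1" "qdet T = 1"
    and H: "cfps_in H" "fps_nth H 0 = 1" "subst_affine (-1) 0 H = H"
  shows "fps_in (entry_alg (smul H (S_mat q T))) H"
proof -
  let ?A = "entry_alg (smul H (S_mat q T))"
  let ?m = "msubst (-1) (-1)"
  have 1: "T ** adj (msubst 1 1 T) = mat 1"
    using RTT_mult_adj_shift[OF T(1)] by (simp add: T(3))
  have 2: "?m T ** adj (msubst (-1) 0 T) = mat 1"
    using arg_cong[OF 1, of ?m] by (simp add: msubst_simps)
  have "matrix_inv (?m T) ** ?m T = mat 1" by (rule matrix_inv_lead_1) (simp add: T(2))
  moreover have "matrix_inv (?m T) = adj (msubst (-1) 0 T)"
    by (rule matrix_inv_right_unique) (simp_all add: T(2) 2)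
  ultimately have 3: "adj (msubst (-1) 0 T) ** ?m T = mat 1" by simp
  have mS: "?m (S_mat q T) = ?m T ** G_mat q ** adj (msubst 1 1 T)" by (simp add: msubst_simps)
  have "S_mat q T ** ?m (S_mat q T) =
      T ** (G_mat q ** (adj (msubst (-1) 0 T) ** ?m T) ** G_mat q) ** adj (msubst 1 1 T)"
    unfolding mS by (simp only: matrix_mul_assoc)
  then have S: "S_mat q T ** ?m (S_mat q T) = mat 1"
    unfolding 3 by (simp add: 1)
  \<comment> \<open>Evenness turns H(-u-1) into H(u+1), as \<open>shift_sq\<close> requires.\<close>
  have "subst_affine (-1) (-1) H = subst_affine 1 1 (subst_affine (-1) 0 H)"
    by (simp add: subst_affine_comp)
  then have H': "subst_affine (-1) (-1) H = subst_affine 1 1 H" by (simp add: H(3))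
  have c: "central (subst_affine 1 1 H)"
    using H(1) by (auto intro!: cfps_in_central fps_in_intros subalg_central)
  have "smul H (S_mat q T) ** ?m (smul H (S_mat q T)) = smul H (smul (subst_affine 1 1 H) (S_mat q T ** ?m (S_mat q T)))"
    unfolding msubst_simps(5)[OF scale_arith(3)] H' smul_mult_left smul_mult_right[OF c] smul_smul
      centralD[OF c, of H] ..
  also have "\<dots> = smul (shift_sq 1 H) (mat 1)" by (simp only: S smul_smul)
  finally have "mat_in ?A (smul (shift_sq 1 H) (mat 1))"
    by (metis mat_in_entry_alg_intros(1,2) mat_in_entry_alg scale_arith(3))
  from mat_inD[OF this, of Neg Neg] have "fps_in ?A (shift_sq 1 H)" by (simp add: mat_1_entry)
  from shift_sq_in[OF subalg_subalgebra_gen this H(2)] show ?thesis .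
qed

text \<open>After translation by 1/2 the matrix becomes e(u+1/2) times a matrix \<Sigma> obeying the
  symmetry relation, which ties an entry at -u to entries at u. Dividing the two sides isolates a
  product of two translates of e.\<close>

lemma B1_mat_center:
  fixes T :: "'a::calgebra fps mat2"
  assumes T: "RTT T" "lead T = mat 1"
    and e: "cfps_in e" "fps_nth e 0 = 1" "e * subst_affine (-1) 0 e = 1"
  shows "fps_in (entry_alg (smul e (B1_mat q T))) e"
proof -
  let ?A = "entry_alg (smul e (B1_mat q T))"
  note A = subalg_subalgebra_gen[of "series_coeffs (smul e (B1_mat q T))"]
  let ?n = "subst_affine (-1) 0 :: 'a fps \<Rightarrow> _" and ?h = "subst_affine 1 (1/2) :: 'a fps \<Rightarrow> _"
    and ?k = "subst_affine 1 (-1/2) :: 'a fps \<Rightarrow> _"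
  note hn = is_homD[OF is_hom_subst_affine[OF scale_arith(3), where 'a = 'a]]
  define \<Sigma> where "\<Sigma> = S_mat q (msubst 1 (1/2) T)"
  define b where "b = smul (?h e) \<Sigma>"
  have b: "b = msubst 1 (1/2) (smul e (B1_mat q T))"
    by (simp only: b_def \<Sigma>_def msubst_S_B1(1) msubst_simps(5)[OF one_neq_zero])
  have b_in: "mat_in ?A b" "mat_in ?A (msubst (-1) 0 b)"
    unfolding b by (intro mat_in_intros[OF A] mat_in_entry_alg; simp)+
  have cen: "central (?h e)" "central (?n (?h e))" "central (?k e)"
    using e(1) by (auto intro!: cfps_in_central fps_in_intros subalg_central)
  have "?n (?h e) = subst_affine (-1) (1/2) e" by (simp add: subst_affine_comp)
  moreover have "?k e * subst_affine (-1) (1/2) e = 1"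
    using arg_cong[OF e(3), of ?k]
    by (simp add: is_homD[OF is_hom_subst_affine[OF one_neq_zero]] subst_affine_comp)
  ultimately have ke: "?k e * ?n (?h e) = 1" by simp
  \<comment> \<open>e(u-1/2) inverts e(-u+1/2), so this is the ratio of the factors of b(u) and
    b(-u).\<close>
  let ?r = "?h e * ?k e"
  have sym: "(cfps 2 + pair_eps q * fps_X) * ?n (\<Sigma> $ Pos $ Pos)
    = pair_eps q * (cfps 2 * \<Sigma> $ Neg $ Neg + fps_X * \<Sigma> $ Pos $ Pos)"
    using S_mat_symmetry[OF RTT_translate[OF T(1), of "1/2"], of q] by (simp add: \<Sigma>_def)
  let ?w = "cfps 2 + pair_eps q * fps_X :: 'a fps"
  define z where "z = pair_eps q * (cfps 2 * b $ Neg $ Neg + fps_X * b $ Pos $ Pos)"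
  have ceps: "central (pair_eps q :: 'a fps)" by (rule central_pair_eps)
  have z: "z = ?h e * (pair_eps q * (cfps 2 * \<Sigma> $ Neg $ Neg + fps_X * \<Sigma> $ Pos $ Pos))"
  proof -
    have "cfps 2 * (?h e * x) = ?h e * (cfps 2 * x)" "fps_X * (?h e * x) = ?h e * (fps_X * x)"
      "pair_eps q * (?h e * x) = ?h e * (pair_eps q * x)" for x
      by (rule centralD3[OF cen(1)])+
    then show ?thesis by (simp add: z_def b_def flip: distrib_left)
  qed
  have nb: "?n (b $ Pos $ Pos) = ?n (?h e) * ?n (\<Sigma> $ Pos $ Pos)"
    by (simp add: b_def hn)
  have "?r * (?w * ?n (b $ Pos $ Pos)) = ?h e * ((?k e * ?n (?h e)) * (?w * ?n (\<Sigma> $ Pos $ Pos)))"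
    unfolding nb by (simp only: mult.assoc centralD3[OF cen(2), of ?w])
  also have "\<dots> = z" unfolding ke z sym[symmetric] by simp
  finally have rz: "?r * (?w * ?n (b $ Pos $ Pos)) = z" .
  have eps: "pair_eps q = cfps (pair_eps q)"
    by (cases q) (simp_all add: cfps_arith(3)[symmetric])
  have z_in: "fps_in ?A z" and w_in: "fps_in ?A (?w * ?n (b $ Pos $ Pos))"
    unfolding z_def eps using b_in
    by (auto intro!: fps_in_intros[OF A] simp: mat_in_def)
  have "lead b = G_mat q"
    by (simp add: b_def lead_smul e(2) \<Sigma>_def lead_mult T(2) lead_mtransp)
  \<comment> \<open>This entry of G is 1 in both cases, so the divisor has constant term 2 and is
    invertible in the subalgebra.\<close>
  then have "fps_nth (b $ Pos $ Pos) 0 = 1"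
    by (cases q) (simp_all add: lead_entry K_mat_entry mat_1_entry)
  then have "fps_nth (?w * ?n (b $ Pos $ Pos)) 0 = of_C 2" by simp
  from fps_in_inverse[OF A w_in this] obtain y where y: "fps_in ?A y" "?w * ?n (b $ Pos $ Pos) * y = 1"
    by auto
  have "?r = ?r * (?w * ?n (b $ Pos $ Pos)) * y"
    by (simp only: mult.assoc[of ?r] y(2) mult_1_right)
  then have "?r = z * y" unfolding rz .
  then have "fps_in ?A ?r" using z_in y(1) by (simp add: fps_in_intros[OF A])
  then have "fps_in ?A (?h ?r)" by (simp add: fps_in_intros[OF A])
  moreover have "?h ?r = shift_sq 1 e"
  proof -
    have "?h ?r = subst_affine 1 1 e * e"
      by (simp add: is_homD[OF is_hom_subst_affine[OF one_neq_zero]] subst_affine_comp)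
    also have "\<dots> = e * subst_affine 1 1 e" by (rule centralD[OF cfps_in_central[OF e(1)], symmetric])
    finally show ?thesis .
  qed
  ultimately have "fps_in ?A (shift_sq 1 e)" by simp
  from shift_sq_in[OF A this e(2)] show ?thesis .
qed

text \<open>The endomorphisms exchange the matrices formed from T' up to translation. The remaining
  work is to see that the image of each central factor lies in the opposite subalgebra and is
  restored by the way back.\<close>

theorem S_mat_iso_B_mat:
  "\<exists>f :: Y2 \<Rightarrow> Y2. alg_iso (entry_alg (S_mat q T_gen)) (entry_alg (B_mat q T_gen)) f"
proof -
  let ?n = "subst_affine (-1) 0 :: Y2 fps \<Rightarrow> _"
  note hn = is_homD[OF is_hom_subst_affine[OF scale_arith(3), where 'a = Y2]]
  note Z = subalg_central[where 'a = Y2]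
  have nn: "?n (?n f) = f" for f by (simp add: subst_affine_comp)
  obtain d d' T where nrm: "normalised d d' T" using normalised_exists by blast
  then have d: "cfps_in d" "cfps_in d'" "d * d' = 1" "d' * d = 1" "fps_nth d 0 = 1" "T_gen = smul d T"
    and T: "RTT T" "lead T = mat 1" "qdet T = 1" by (simp_all add: normalised_def)
  have d'0: "fps_nth d' 0 = 1" using arg_cong[OF d(3), of "\<lambda>f. fps_nth f 0"] by (simp add: d(5))
  have cn: "cfps_in (?n d)" "cfps_in (?n d')" using d by (simp_all add: fps_in_intros[OF Z])

  define H where "H = d * ?n d"
  have H: "cfps_in H" "fps_nth H 0 = 1" "?n H = H"
    using d cn central_fps_commute[OF cn(1), of d] by (simp_all add: H_def hn nn fps_in_intros[OF Z])
  have S: "S_mat q T_gen = smul H (S_mat q T)"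
    unfolding H_def by (simp only: d(6) S_mat_smul[OF d(1)])

  define e where "e = d * ?n d'"
  have e: "cfps_in e" "fps_nth e 0 = 1" using d cn d'0 by (simp_all add: e_def fps_in_intros[OF Z])
  have "e * ?n e = d * (?n d' * ?n d) * d'" by (simp add: e_def hn nn mult.assoc)
  also have "?n d' * ?n d = 1" by (simp only: hn(3)[symmetric] d(4) hn(1))
  finally have ene: "e * ?n e = 1" by (simp add: d(3))
  have B: "B_mat q T_gen = smul e (B1_mat q T)"
  proof -
    have "msubst (-1) 0 T ** adj (msubst (-1) 1 T) = mat 1"
      using matrix_inv_lead_1(1)[of "msubst (-1) 0 T"] matrix_inv_qdet_1[OF T(1,3,2)] by (simp add: T(2))
    then have "msubst (-1) 0 T_gen ** smul (?n d') (adj (msubst (-1) 1 T)) = smul (?n (d * d')) (mat 1)"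
      unfolding d(6) by (simp add: msubst_simps smul_mult_left smul_mult_right[OF cfps_in_central[OF cn(2)]]
          smul_smul hn centralD[OF cfps_in_central[OF cn(2)], of "?n d"])
    then have "matrix_inv (msubst (-1) 0 T_gen) = smul (?n d') (adj (msubst (-1) 1 T))"
      by (intro matrix_inv_right_unique) (simp_all add: d(3))
    then show ?thesis
      unfolding e_def d(6)
      by (simp add: smul_mult_left smul_mult_right[OF cfps_in_central[OF cn(2)]] smul_smul)
        (simp add: centralD[OF cfps_in_central[OF cn(2)]])
  qed

  let ?A = "entry_alg (smul H (S_mat q T))" and ?B = "entry_alg (smul e (B1_mat q T))"
  note A = subalg_subalgebra_gen[of "series_coeffs (smul H (S_mat q T))"]
    and B' = subalg_subalgebra_gen[of "series_coeffs (smul e (B1_mat q T))"]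
  have HA: "fps_in ?A H" by (rule S_mat_center[OF T H])
  have eB: "fps_in ?B e" by (rule B1_mat_center[OF T(1,2) e ene])
  have SA: "mat_in ?A (S_mat q T)" by (rule mat_in_smul_cancel[OF A mat_in_entry_alg HA H(2)])
  have BB: "mat_in ?B (B1_mat q T)" by (rule mat_in_smul_cancel[OF B' mat_in_entry_alg eB e(2)])

  \<comment> \<open>The square root is taken inside \<open>?A\<close>, so that everything built from
    it stays there.\<close>
  obtain k where k: "fps_in ?A k" "fps_nth k 0 = 1" "shift_sq 0 k = H"
    using shift_sq_exists[OF A HA H(2)] by blast
  have kZ: "cfps_in k" using shift_sq_in[OF Z, where b = 0 and f = k] k H(1) by simp
  have "shift_sq 0 (?n k) = ?n (shift_sq 0 k)" by (simp add: hn)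
  then have nk: "?n k = k" using shift_sq_unique[where b = 0 and f = "?n k" and g = k] k(2,3) H(3) by simp
  \<comment> \<open>u (k - 1): the shift divides by u^-1, legitimate because k starts with 1. Since
    k is even, this is odd and so has no constant term.\<close>
  define o2 where "o2 = fps_shift 1 (k - 1)"
  have Xo2: "fps_X * o2 = k - 1"
    by (rule fps_ext) (auto simp: o2_def k(2) fps_X_mult_nth)
  have odd: "fps_nth f 0 = 0" if "?n f = - f" for f
  proof -
    have "fps_nth f 0 = - fps_nth f 0" using arg_cong[OF that, of "\<lambda>g. fps_nth g 0"] by simp
    then have "2 * fps_nth f 0 = 0" by (simp add: mult_2 eq_neg_iff_add_eq_0)
    then show ?thesis by (rule half_cancel)
  qed
  have "fps_X * (- ?n o2) = ?n (fps_X * o2)" by (simp add: hn subst_neg_X)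
  also have "\<dots> = fps_X * o2" by (simp add: Xo2 hn nk)
  finally have no2: "?n o2 = - o2" by (metis fps_X_cancel minus_minus)
  have o2_in: "fps_in A' o2" if "subalg A'" "fps_in A' k" for A'
    using that subalgD[OF that(1)] by (simp add: fps_in_def o2_def)

  have one: "fps_nth (e + 1) 0 = of_C 2" by (simp add: e(2))
  have inv_e: "\<exists>g. fps_in A' g \<and> (e + 1) * g = 1 \<and> g * (e + 1) = 1" if "subalg A'" "fps_in A' e" for A'
    using fps_in_inverse[OF that(1) _ one] that by (simp add: fps_in_intros[OF that(1)])
  obtain g where g: "fps_in ?B g" "(e + 1) * g = 1" "g * (e + 1) = 1" using inv_e[OF B' eB] by blast
  obtain g' where g': "cfps_in g'" "(e + 1) * g' = 1" using inv_e[OF Z e(1)] by blast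
  have "g' = g" using fps_inverse_unique[OF g'(2) g(3)] by simp
  with g' have gZ: "cfps_in g" by simp
  \<comment> \<open>Cayley transform of e, odd because e(-u) inverts e(u); e + 1 is invertible, its
    constant term being 2.\<close>
  define o1 where "o1 = (e - 1) * g"
  have o1: "fps_in ?B o1" "cfps_in o1"
    using g(1) gZ e(1) eB by (simp_all add: o1_def fps_in_intros[OF B'] fps_in_intros[OF Z])
  have o1e: "o1 * (e + 1) = e - 1" by (simp only: o1_def mult.assoc g(3) mult_1_right)
  have ne: "?n e * e = 1" using ene central_fps_commute[OF e(1), of "?n e"] by simp
  have "?n o1 * (?n e + 1) = ?n e - 1"
    using arg_cong[OF o1e, of ?n] by (simp only: hn)
  then have "?n o1 * (?n e + 1) * e = (?n e - 1) * e" by (simp only:)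
  moreover have "?n o1 * (?n e + 1) * e = ?n o1 * (e + 1)"
    by (simp only: mult.assoc distrib_right[of "?n e" 1 e] ne mult_1_left add.commute[of 1 e])
  moreover have "(?n e - 1) * e = - (o1 * (e + 1))"
    by (simp only: o1e left_diff_distrib ne mult_1_left minus_diff_eq)
  ultimately have "?n o1 * (e + 1) * g = - (o1 * (e + 1)) * g" by (simp only:)
  then have no1: "?n o1 = - o1"
    by (simp only: mult_minus_left mult.assoc g(2) mult_1_right)

  \<comment> \<open>The images of d. \<open>D1\<close> is even, so d(u) d(-u) goes to its square, k
    to \<open>D1\<close> and \<open>o2\<close> to \<open>o1\<close>. \<open>D2\<close> at -u is 1 -
    \<open>o2\<close>, so e goes to (1 + \<open>o2\<close>) / (1 - \<open>o2\<close>) and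
    \<open>o1\<close> to \<open>o2\<close>.\<close>
  define D1 D2 where "D1 = 1 + fps_X * o1" and "D2 = 1 + o2"
  have D1: "cfps_in D1" "fps_nth D1 0 = 1" "?n D1 = D1" "fps_in ?B D1"
    using o1 by (simp_all add: D1_def fps_in_intros[OF Z] fps_in_intros[OF B'] hn subst_neg_X no1)
  have D2: "cfps_in D2" "fps_nth D2 0 = 1" "?n D2 = 1 - o2" "fps_in ?A D2"
    using o2_in[OF Z kZ] o2_in[OF A k(1)] odd[OF no2]
    by (simp_all add: D2_def fps_in_intros[OF Z] fps_in_intros[OF A] hn no2)
  obtain \<mu> :: "Y2 \<Rightarrow> Y2" where \<mu>: "is_alg_hom \<mu>" "map_fps \<mu> d = D1" "mmap \<mu> T = msubst 1 (1/2) T"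
    using normalised_hom[OF nrm D1(1,2)] by blast
  obtain \<nu> :: "Y2 \<Rightarrow> Y2" where \<nu>: "is_alg_hom \<nu>" "map_fps \<nu> d = D2" "mmap \<nu> T = msubst 1 (-1/2) T"
    using normalised_hom[OF nrm D2(1,2)] by blast
  note h\<mu> = is_homD[OF is_hom_map_fps[OF is_alg_homD(1)[OF \<mu>(1)]]]
    and h\<nu> = is_homD[OF is_hom_map_fps[OF is_alg_homD(1)[OF \<nu>(1)]]]
  have n\<mu>: "map_fps \<mu> (?n f) = ?n (map_fps \<mu> f)" and n\<nu>: "map_fps \<nu> (?n f) = ?n (map_fps \<nu> f)" for f
    by (simp_all add: map_fps_subst_affine \<mu> \<nu>)
  have X\<mu>: "map_fps \<mu> fps_X = fps_X" and X\<nu>: "map_fps \<nu> fps_X = fps_X"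
    using is_homD(1,4)[OF is_alg_homD(1)[OF \<mu>(1)]] is_homD(1,4)[OF is_alg_homD(1)[OF \<nu>(1)]]
    by (simp_all add: fps_eq_iff fps_X_def)

  have \<mu>H: "map_fps \<mu> H = D1 * D1" by (simp add: H_def h\<mu> n\<mu> \<mu> D1(3))
  have \<nu>e: "map_fps \<nu> e * (1 - o2) = 1 + o2"
  proof -
    have "e * ?n d = d"
      unfolding e_def by (simp add: mult.assoc hn(3)[symmetric] d(4) hn(1))
    from arg_cong[OF this, of "map_fps \<nu>"] have "map_fps \<nu> e * ?n D2 = D2" by (simp only: h\<nu>(3) n\<nu> \<nu>(2))
    then show ?thesis unfolding D2(3) unfolding D2_def .
  qed
  obtain y where y: "fps_in ?A y" "(1 - o2) * y = 1"
    using fps_in_inverse[OF A, of "1 - o2" 1] D2(3) o2_in[OF A k(1)] odd[OF no2]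
    by (auto simp: fps_in_intros[OF A])
  have "map_fps \<nu> e = map_fps \<nu> e * (1 - o2) * y" by (simp only: mult.assoc y(2) mult_1_right)
  then have "map_fps \<nu> e = (1 + o2) * y" by (simp only: \<nu>e)
  then have \<nu>e_in: "fps_in ?A (map_fps \<nu> e)"
    using y(1) o2_in[OF A k(1)] by (simp add: fps_in_intros[OF A])

  have \<nu>o1: "map_fps \<nu> o1 = o2"
  proof -
    let ?x = "map_fps \<nu> o1" and ?y = "map_fps \<nu> e"
    have two: "cfps 2 = (2 :: Y2 fps)"
      using cfps_arith(1)[of 1 1, where 'a = Y2] by simp
    have "?x * (?y + 1) = ?y - 1"
      using arg_cong[OF o1e, of "map_fps \<nu>"] by (simp only: h\<nu>)
    then have "?x * (?y + 1) * (1 - o2) = (?y - 1) * (1 - o2)" by (simp only:)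
    moreover have "(?y + 1) * (1 - o2) = cfps 2"
      unfolding distrib_right \<nu>e two by simp
    moreover have "(?y - 1) * (1 - o2) = o2 * cfps 2"
      unfolding left_diff_distrib[of ?y] \<nu>e two by (simp add: mult_2_right)
    ultimately have "?x * cfps 2 * cfps (1/2) = o2 * cfps 2 * cfps (1/2)" by (simp only: mult.assoc)
    then show ?thesis by (simp add: mult.assoc cfps_arith)
  qed
  have \<nu>D1: "map_fps \<nu> D1 = k" by (simp add: D1_def h\<nu> X\<nu> \<nu>o1 Xo2)
  \<comment> \<open>Both are square roots, with constant term 1, of the image of H.\<close>
  have \<mu>k: "map_fps \<mu> k = D1"
  proof (rule shift_sq_unique)
    show "shift_sq 0 (map_fps \<mu> k) = shift_sq 0 D1"
      using map_fps_shift_sq[OF \<mu>(1), where b = 0 and g = k] \<mu>H k(3) by simp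
  qed (simp_all add: k(2) D1(2) is_homD(1)[OF is_alg_homD(1)[OF \<mu>(1)]])
  have "fps_X * map_fps \<mu> o2 = fps_X * o1"
    using arg_cong[OF Xo2, of "map_fps \<mu>"] by (simp add: h\<mu> X\<mu> \<mu>k D1_def)
  then have \<mu>o2: "map_fps \<mu> o2 = o1" by (rule fps_X_cancel)
  have \<mu>\<nu>e: "map_fps \<mu> (map_fps \<nu> e) = e"
  proof -
    have 1: "map_fps \<mu> (map_fps \<nu> e) * (1 - o1) = 1 + o1"
      using arg_cong[OF \<nu>e, of "map_fps \<mu>"] by (simp add: h\<mu> \<mu>o2)
    have 2: "e * (1 - o1) = 1 + o1"
      using o1e central_fps_commute[OF e(1), of o1] by (simp add: algebra_simps)
    obtain w where w: "(1 - o1) * w = 1"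
      using fps_in_inverse[OF Z, of "1 - o1" 1] o1(2) odd[OF no1] by (auto simp: fps_in_intros[OF Z])
    have "map_fps \<mu> (map_fps \<nu> e) * (1 - o1) * w = e * (1 - o1) * w" by (simp only: 1 2)
    then show ?thesis by (simp only: mult.assoc w mult_1_right)
  qed

  have \<mu>S: "mmap \<mu> (S_mat q T) = msubst 1 (1/2) (B1_mat q T)"
    by (simp only: mmap_S_B1[OF \<mu>(1)] \<mu>(3) msubst_S_B1)
  have \<nu>B: "mmap \<nu> (B1_mat q T) = msubst 1 (-1/2) (S_mat q T)"
    by (simp only: mmap_S_B1[OF \<nu>(1)] \<nu>(3) msubst_S_B1)
  have \<nu>\<mu>: "mmap \<nu> (mmap \<mu> (smul H (S_mat q T))) = smul H (S_mat q T)"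
  proof -
    have "mmap \<nu> (mmap \<mu> (smul H (S_mat q T))) = smul (k * k) (msubst 1 (1/2) (msubst 1 (-1/2) (S_mat q T)))"
      by (simp only: mmap_smul[OF \<mu>(1)] mmap_smul[OF \<nu>(1)] \<mu>H h\<nu>(3) \<nu>D1 \<mu>S \<nu>B mmap_simps(6)[OF \<nu>(1) one_neq_zero])
    also have "\<dots> = smul H (S_mat q T)"
      using k(3) by (simp add: msubst_simps(6))
    finally show ?thesis .
  qed
  have \<mu>\<nu>: "mmap \<mu> (mmap \<nu> (smul e (B1_mat q T))) = smul e (B1_mat q T)"
  proof -
    have "mmap \<mu> (mmap \<nu> (smul e (B1_mat q T))) = smul e (msubst 1 (-1/2) (msubst 1 (1/2) (B1_mat q T)))"
      by (simp only: mmap_smul[OF \<mu>(1)] mmap_smul[OF \<nu>(1)] \<mu>\<nu>e \<mu>S \<nu>B mmap_simps(6)[OF \<mu>(1) one_neq_zero])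
    then show ?thesis by (simp add: msubst_simps(6))
  qed
  \<comment> \<open>\<nu>\<mu> sends d to k, so agreement with the identity is checked on the matrix
    generating each subalgebra and extended to that subalgebra only.\<close>
  have fixed: "f x = x" if "is_alg_hom f" "mmap f M = M" "x \<in> entry_alg M" for f :: "Y2 \<Rightarrow> Y2" and M x
  proof -
    note hf = is_homD[OF is_alg_homD(1)[OF that(1)]]
    have "subalg {x. f x = x}"
      by (auto simp: subalg_def hf is_alg_homD(2)[OF that(1)])
    moreover have "mat_in {x. f x = x} M"
      using that(2) by (simp add: mat_in_def fps_in_def vec_eq_iff fps_eq_iff)
    ultimately show ?thesis using entry_alg_subset[of "{x. f x = x}" M] that(3) by blast
  qed
  have "bij_betw \<mu> ?A ?B"
  proof (rule bij_betw_byWitness[of _ \<nu>])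
    show "\<forall>x\<in>?A. \<nu> (\<mu> x) = x"
      using fixed[OF is_alg_hom_comp[OF \<nu>(1) \<mu>(1)]] \<nu>\<mu> by (simp only: mmap_comp[of \<nu> \<mu>]) blast
    show "\<forall>x\<in>?B. \<mu> (\<nu> x) = x"
      using fixed[OF is_alg_hom_comp[OF \<mu>(1) \<nu>(1)]] \<mu>\<nu> by (simp only: mmap_comp[of \<mu> \<nu>]) blast
    show "\<mu> ` ?A \<subseteq> ?B"
      unfolding hom_image_entry_alg[OF \<mu>(1)] mmap_smul[OF \<mu>(1)] \<mu>H \<mu>S
      by (intro entry_alg_subset B' mat_in_intros[OF B'] fps_in_intros[OF B'] D1(4) one_neq_zero BB)
    show "\<nu> ` ?B \<subseteq> ?A"
      unfolding hom_image_entry_alg[OF \<nu>(1)] mmap_smul[OF \<nu>(1)] \<nu>B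
      by (intro entry_alg_subset A mat_in_intros(5,2)[OF A] \<nu>e_in one_neq_zero SA)
  qed
  then have "alg_iso ?A ?B \<mu>" by (simp add: alg_iso_def is_alg_hom_on[OF \<mu>(1)])
  then show ?thesis unfolding S B by blast
qed

theorem corollary4p2:
  shows "
    (\<exists>(\<phi> :: Xt_sp2_sp2 \<Rightarrow> Yt_minus) (\<pi> :: Xt_sp2_sp2 \<Rightarrow> X_sp2) (\<pi>' :: Yt_minus \<Rightarrow> Y2)
       (\<rho> :: X_sp2 \<Rightarrow> Y_sp2) (\<rho>' :: Y2 \<Rightarrow> SY2) (\<psi> :: X_sp2 \<Rightarrow> Y2) (\<omega> :: Y_sp2 \<Rightarrow> SY2).
       alg_hom_sending (St_gen SP2_SP2) (msubst (1/2) (-1/2) T_gen) \<phi> \<and> alg_iso UNIV UNIV \<phi> \<and>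
       alg_hom_sending (St_gen SP2_SP2) (S_sp SP2_SP2 T_gen) \<pi> \<and>
       alg_hom_sending T_gen (S_gl Minus T_gen) \<pi>' \<and>
       alg_hom_sending T_gen T_gen \<rho> \<and>
       alg_hom_sending T_gen T_gen \<rho>' \<and>
       (\<forall>c c'. is_c_sp SP2_SP2 (St_gen SP2_SP2) c \<and> is_c_ol Minus T_gen c' \<longrightarrow>
          \<phi> ` ideal_c c = ideal_c c') \<and>
       alg_iso (X_tw SP2_SP2) (Y_ol Minus) \<psi> \<and> (\<forall>x. \<psi> (\<pi> x) = \<pi>' (\<phi> x)) \<and>
       alg_iso (Y_tw SP2_SP2) (SY_ol Minus) \<omega> \<and> (\<forall>x \<in> X_tw SP2_SP2. \<omega> (\<rho> x) = \<rho>' (\<psi> x))) \<and>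
    (\<exists>(\<phi> :: Xt_sp2_gl1 \<Rightarrow> Yt_plus) (\<pi> :: Xt_sp2_gl1 \<Rightarrow> X_sp2) (\<pi>' :: Yt_plus \<Rightarrow> Y2)
       (\<rho> :: X_sp2 \<Rightarrow> Y_sp2) (\<rho>' :: Y2 \<Rightarrow> SY2) (\<psi> :: X_sp2 \<Rightarrow> Y2) (\<omega> :: Y_sp2 \<Rightarrow> SY2).
       alg_hom_sending (St_gen SP2_GL1) (msubst (1/2) (-1/2) T_gen ** K_mat) \<phi> \<and> alg_iso UNIV UNIV \<phi> \<and>
       alg_hom_sending (St_gen SP2_GL1) (S_sp SP2_GL1 T_gen) \<pi> \<and>
       alg_hom_sending T_gen (S_gl Plus T_gen) \<pi>' \<and>
       alg_hom_sending T_gen T_gen \<rho> \<and>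
       alg_hom_sending T_gen T_gen \<rho>' \<and>
       (\<forall>c c'. is_c_sp SP2_GL1 (St_gen SP2_GL1) c \<and> is_c_ol Plus T_gen c' \<longrightarrow>
          \<phi> ` ideal_c c = ideal_c c') \<and>
       alg_iso (X_tw SP2_GL1) (Y_ol Plus) \<psi> \<and> (\<forall>x. \<psi> (\<pi> x) = \<pi>' (\<phi> x)) \<and>
       alg_iso (Y_tw SP2_GL1) (SY_ol Plus) \<omega> \<and> (\<forall>x \<in> X_tw SP2_GL1. \<omega> (\<rho> x) = \<rho>' (\<psi> x))) \<and>
    (\<exists>f. alg_iso (X_tw SP2_SP2) (B_refl 0) f) \<and>
    (\<exists>f. alg_iso (X_tw SP2_GL1) (B_refl 1) f) \<and>
    (\<exists>f. alg_iso (Y_tw SP2_SP2) (SB_refl 0) f) \<and>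
    (\<exists>f. alg_iso (Y_tw SP2_GL1) (SB_refl 1) f)"
proof -
  have 1: "relators TYPE(Xt_sp2_sp2_pres) = Xt_relators SP2_SP2"
    "relators TYPE(Yt_minus_pres) = Yt_relators (pair_sign SP2_SP2)"
    "relators TYPE(Xt_sp2_gl1_pres) = Xt_relators SP2_GL1"
    "relators TYPE(Yt_plus_pres) = Yt_relators (pair_sign SP2_GL1)"
    by (simp_all add: relators_Xt_sp2_sp2_pres_def relators_Yt_minus_pres_def
        relators_Xt_sp2_gl1_pres_def relators_Yt_plus_pres_def)
  note iso1 = twisted_isomorphisms[OF 1(1,2), unfolded pair_sign.simps G_mat.simps matrix_mul_rid]
    and iso2 = twisted_isomorphisms[OF 1(3,4), unfolded pair_sign.simps G_mat.simps]
  have X: "\<exists>f. alg_iso (X_tw q) (Y_ol (pair_sign q)) f" "\<exists>f. alg_iso (Y_tw q) (SY_ol (pair_sign q)) f" for q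
    using iso1 iso2 by (cases q; fastforce)+
  have B: "\<exists>f. alg_iso (Y_ol (pair_sign q)) (entry_alg (B_mat q T_gen) :: Y2 set) f"
    "\<exists>f. alg_iso (SY_ol (pair_sign q)) (entry_alg (B_mat q T_gen) :: SY2 set) f" for q
    unfolding Y_ol_def SY_ol_def entry_alg_S_gl by (rule S_mat_iso_B_mat SY_iso_SB)+
  have "\<exists>f. alg_iso (X_tw q) (entry_alg (B_mat q T_gen) :: Y2 set) f"
    "\<exists>f. alg_iso (Y_tw q) (entry_alg (B_mat q T_gen) :: SY2 set) f" for q
    using X[of q] B[of q] alg_iso_trans by blast+
  then have "\<exists>f. alg_iso (X_tw SP2_SP2) (B_refl 0) f" "\<exists>f. alg_iso (X_tw SP2_GL1) (B_refl 1) f"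
    "\<exists>f. alg_iso (Y_tw SP2_SP2) (SB_refl 0) f" "\<exists>f. alg_iso (Y_tw SP2_GL1) (SB_refl 1) f"
    unfolding B_refl_def SB_refl_def entry_alg_B_gl by blast+
  with iso1 iso2 show ?thesis by (intro conjI)
qed

end
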